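(* Let $A$ be a unital C*-algebra, let $\mathcal{C}(A)$ be the poset of its unital commutative C*-subalgebras ordered by inclusion, let $\underline{A}$ be the tautological internal commutative C*-algebra $C\mapsto C$ in $[\mathcal{C}(A),\mathbf{Set}]$, and let $\Sigma_{\underline{A}}\to\mathrm{Idl}\,\mathcal{C}(A)$ be the external description of its Gelfand spectrum. Then the locale $\Sigma_{\underline{A}}$ is locally compact. The points of $\mathbb{S}^{\Sigma_{\underline{A}}}$ are the $\mathcal{C}(A)$-indexed families $U=(U_C)_{C\in\mathcal{C}(A)}$, where each $U_{C}$ is a $\eqslantless$-ideal of $L_{C}$, and if $C\subseteq D$, then $L_{CD}(U_{C})\subseteq U_{D}$.
   Context: $\mathbb{S}$ is the Sierpiński locale; for a locally compact locale $X$ the exponential $\mathbb{S}^X$ exists, and its points are the opens of $X$. For a poset $P$, $\mathrm{Idl}\,P$ is the locale whose points are the ideals of $P$ and whose opens are the up-closed subsets of $P$; $[P,\mathbf{Set}]\simeq\mathrm{Sh}(\mathrm{Idl}\,P)$. Internal locales in $\mathrm{Sh}(X)$ are equivalent to locale maps into $X$; the map (and its domain) corresponding to an internal locale is its external description. "Points" can be read as generalized points (maps from arbitrary locales $W$, corresponding to the described structures interpreted in $\mathrm{Sh}(W)$ over constant sheaves). $\underline{A}:\mathcal{C}(A)\to\mathbf{Set}$ is the functor $\underline{A}(C)=C$, with inclusions as transition maps; it is an internal unital commutative C*-algebra. For a commutative unital C*-algebra $C$, with self-adjoint part $C_{sa}$ ordered by $a\leq b$ iff $b-a$ is a square of a self-adjoint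 element, $L_C$ is the distributive lattice presented by generators $D(a)$ ($a\in C_{sa}$) and relations $D(a)\wedge D(-a)=\bot$; $D(a)=\bot$ if $a\le0$; $D(a+b)\le D(a)\vee D(b)$; $D(1)=\top$; $D(ab)=(D(a)\wedge D(b))\vee(D(-a)\wedge D(-b))$. For $C\subseteq D$, $L_{CD}:L_C\to L_D$ is the induced homomorphism $D(a)\mapsto D(a)$. In a distributive lattice, $a'\eqslantless a$ means there is $y$ with $a\vee y=\top$, $a'\wedge y=\bot$. A (rounded) $\eqslantless$-ideal of $L_C$ is an ideal $I$ of the lattice such that for each $a\in I$ there is $b\in I$ with $a\eqslantless b$. A prime filter $x$ is regular if $a\in x$ implies $a'\in x$ for some $a'\eqslantless a$. The Gelfand spectrum of a commutative C*-algebra $C$ is the locale $\mathrm{RSpec}\,L_C$ whose points are the regular prime filters of $L_C$; this construction is applied internally in $[\mathcal{C}(A),\mathbf{Set}]$ to $\underline{A}$, where the internal lattice is $C\mapsto L_C$. *)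

theory Defs
  imports "HOL-Analysis.Analysis" "HOL-Algebra.Lattice"
begin

section \<open>Unital C*-algebras and their commutative subalgebras\<close>

text \<open>Not based on \<open>ring_1\<close>, which would exclude the zero algebra.\<close>

class unital_cstar_algebra = real_normed_algebra + banach + monoid_mult +
  fixes scaleC :: "complex \<Rightarrow> 'a \<Rightarrow> 'a" (infixr \<open>*\<^sub>C\<close> 75)
    and adj :: "'a \<Rightarrow> 'a"
  assumes scaleC_add_right: "c *\<^sub>C (x + y) = c *\<^sub>C x + c *\<^sub>C y"
    and scaleC_add_left: "(c + d) *\<^sub>C x = c *\<^sub>C x + d *\<^sub>C x"
    and scaleC_scaleC: "c *\<^sub>C d *\<^sub>C x = (c * d) *\<^sub>C x"
    and scaleC_of_real: "complex_of_real r *\<^sub>C x = r *\<^sub>R x"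
    and mult_scaleC_left: "(c *\<^sub>C x) * y = c *\<^sub>C (x * y)"
    and mult_scaleC_right: "x * (c *\<^sub>C y) = c *\<^sub>C (x * y)"
    and norm_scaleC: "norm (c *\<^sub>C x) = cmod c * norm x"
    and adj_adj: "adj (adj x) = x"
    and adj_add: "adj (x + y) = adj x + adj y"
    and adj_scaleC: "adj (c *\<^sub>C x) = cnj c *\<^sub>C adj x"
    and adj_mult: "adj (x * y) = adj y * adj x"
    and norm_adj_mult: "norm (adj x * x) = (norm x)\<^sup>2"

instantiation complex :: unital_cstar_algebra
begin
definition scaleC_complex :: "complex \<Rightarrow> complex \<Rightarrow> complex" where "scaleC_complex = (*)"
definition adj_complex :: "complex \<Rightarrow> complex" where "adj_complex = cnj"
instance
  by standard
    (auto simp: scaleC_complex_def adj_complex_def algebra_simps norm_mult power2_eq_square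
      scaleR_conv_of_real)
end

definition comm_subalgs :: "'a::unital_cstar_algebra set set" (\<open>\<C>\<close>) where
  "\<C> = {C. 1 \<in> C \<and> closed C \<and>
        (\<forall>a\<in>C. \<forall>b\<in>C. a + b \<in> C \<and> a * b \<in> C \<and> a * b = b * a) \<and>
        (\<forall>a\<in>C. \<forall>c. c *\<^sub>C a \<in> C) \<and> (\<forall>a\<in>C. adj a \<in> C)}"

definition selfadj :: "'a::unital_cstar_algebra set \<Rightarrow> 'a set" where
  "selfadj C = {a \<in> C. adj a = a}"

definition sa_le :: "'a::unital_cstar_algebra set \<Rightarrow> 'a \<Rightarrow> 'a \<Rightarrow> bool" where
  "sa_le C a b \<longleftrightarrow> (\<exists>c\<in>selfadj C. b - a = c * c)"


section \<open>Distributive lattices given by generators and relations\<close>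

datatype 'g lat_term =
  Gen 'g | Bot | Top | Meet "'g lat_term" "'g lat_term" | Join "'g lat_term" "'g lat_term"

text \<open>\<open>(s, t) \<in> R\<close> stands for the relation \<open>s \<le> t\<close>.\<close>

inductive term_le :: "('g lat_term \<times> 'g lat_term) set \<Rightarrow> 'g lat_term \<Rightarrow> 'g lat_term \<Rightarrow> bool"
  for R where
  rel: "(s, t) \<in> R \<Longrightarrow> term_le R s t"
| refl: "term_le R t t"
| trans: "term_le R s t \<Longrightarrow> term_le R t u \<Longrightarrow> term_le R s u"
| bot: "term_le R Bot t"
| top: "term_le R t Top"
| meet1: "term_le R (Meet s t) s"
| meet2: "term_le R (Meet s t) t"
| meet: "term_le R u s \<Longrightarrow> term_le R u t \<Longrightarrow> term_le R u (Meet s t)"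
| join1: "term_le R s (Join s t)"
| join2: "term_le R t (Join s t)"
| join: "term_le R s u \<Longrightarrow> term_le R t u \<Longrightarrow> term_le R (Join s t) u"
| distrib: "term_le R (Meet s (Join t u)) (Join (Meet s t) (Meet s u))"

text \<open>
  The intermediate terms of a derivation may contain generators outside \<open>G\<close>. If \<open>R\<close> only mentions
  generators in \<open>G\<close> this is harmless: replacing all others by \<open>Bot\<close> maps derivations to
  derivations.
\<close>

definition term_eq :: "'g set \<Rightarrow> ('g lat_term \<times> 'g lat_term) set \<Rightarrow> ('g lat_term \<times> 'g lat_term) set"
  where "term_eq G R = {(s, t). set_lat_term s \<subseteq> G \<and> set_lat_term t \<subseteq> G \<and>
                                term_le R s t \<and> term_le R t s}"

definition presented_lattice ::
  "'g set \<Rightarrow> ('g lat_term \<times> 'g lat_term) set \<Rightarrow> 'g lat_term set gorder" where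
  "presented_lattice G R =
     \<lparr>carrier = {t. set_lat_term t \<subseteq> G} // term_eq G R, eq = (=),
      le = (\<lambda>X Y. \<exists>s\<in>X. \<exists>t\<in>Y. term_le R s t)\<rparr>"

definition spec_rels ::
  "'a::unital_cstar_algebra set \<Rightarrow> ('a lat_term \<times> 'a lat_term) set" where
  "spec_rels C =
     {(Meet (Gen a) (Gen (- a)), Bot) | a. a \<in> selfadj C} \<union>
     {(Gen a, Bot) | a. a \<in> selfadj C \<and> sa_le C a 0} \<union>
     {(Gen (a + b), Join (Gen a) (Gen b)) | a b. a \<in> selfadj C \<and> b \<in> selfadj C} \<union>
     {(Top, Gen 1)} \<union>
     {(Gen (a * b), Join (Meet (Gen a) (Gen b)) (Meet (Gen (- a)) (Gen (- b)))) | a b.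
        a \<in> selfadj C \<and> b \<in> selfadj C} \<union>
     {(Join (Meet (Gen a) (Gen b)) (Meet (Gen (- a)) (Gen (- b))), Gen (a * b)) | a b.
        a \<in> selfadj C \<and> b \<in> selfadj C}"

definition spec_lattice :: "'a::unital_cstar_algebra set \<Rightarrow> 'a lat_term set gorder" (\<open>\<L>\<close>) where
  "\<L> C = presented_lattice (selfadj C) (spec_rels C)"

text \<open>The map \<open>L\<^sub>C \<rightarrow> L\<^sub>D\<close> for \<open>C \<subseteq> D\<close>: the class of a term goes to the class of the same term.\<close>

definition lat_map ::
  "'a::unital_cstar_algebra set \<Rightarrow> 'a lat_term set \<Rightarrow> 'a lat_term set" where
  "lat_map D X = term_eq (selfadj D) (spec_rels D) `` X"

definition well_inside :: "'b gorder \<Rightarrow> 'b \<Rightarrow> 'b \<Rightarrow> bool" where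
  "well_inside L a' a \<longleftrightarrow> a' \<in> carrier L \<and> a \<in> carrier L \<and>
     (\<exists>y\<in>carrier L. a \<squnion>\<^bsub>L\<^esub> y = \<top>\<^bsub>L\<^esub> \<and> a' \<sqinter>\<^bsub>L\<^esub> y = \<bottom>\<^bsub>L\<^esub>)"

definition lat_ideal :: "'b gorder \<Rightarrow> 'b set \<Rightarrow> bool" where
  "lat_ideal L I \<longleftrightarrow> I \<subseteq> carrier L \<and> \<bottom>\<^bsub>L\<^esub> \<in> I \<and>
     (\<forall>a\<in>carrier L. \<forall>b\<in>I. a \<sqsubseteq>\<^bsub>L\<^esub> b \<longrightarrow> a \<in> I) \<and> (\<forall>a\<in>I. \<forall>b\<in>I. a \<squnion>\<^bsub>L\<^esub> b \<in> I)"

definition rounded_ideal :: "'b gorder \<Rightarrow> 'b set \<Rightarrow> bool" where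
  "rounded_ideal L I \<longleftrightarrow> lat_ideal L I \<and> (\<forall>a\<in>I. \<exists>b\<in>I. well_inside L a b)"


section \<open>Frames, locally compact locales\<close>

text \<open>A locale is given by its frame of opens; a map of locales \<open>W \<rightarrow> X\<close> is a frame homomorphism
  from the frame of \<open>X\<close> to the frame of \<open>W\<close>. The terminal locale has frame \<^typ>\<open>bool\<close>.\<close>

class frame = complete_lattice +
  assumes inf_Sup_frame: "inf x (Sup A) = Sup (inf x ` A)"

subclass (in complete_distrib_lattice) frame
  by standard (simp add: inf_Sup)

definition frame_hom :: "('x::frame \<Rightarrow> 'y::frame) \<Rightarrow> bool" where
  "frame_hom h \<longleftrightarrow> h Orderings.top = Orderings.top \<and> (\<forall>u v. h (inf u v) = inf (h u) (h v)) \<and>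
                   (\<forall>A. h (Sup A) = Sup (h ` A))"

definition directed :: "'x::order set \<Rightarrow> bool" where
  "directed S \<longleftrightarrow> S \<noteq> {} \<and> (\<forall>x\<in>S. \<forall>y\<in>S. \<exists>z\<in>S. x \<le> z \<and> y \<le> z)"

definition way_below :: "'x::complete_lattice \<Rightarrow> 'x \<Rightarrow> bool" (infix \<open>\<lless>\<close> 50) where
  "x \<lless> y \<longleftrightarrow> (\<forall>S. directed S \<and> y \<le> Sup S \<longrightarrow> (\<exists>s\<in>S. x \<le> s))"

definition locally_compact_locale :: "'x::frame itself \<Rightarrow> bool" where
  "locally_compact_locale _ \<longleftrightarrow> (\<forall>y::'x. y = Sup {x. x \<lless> y})"

lemma frame_hom_mono: "frame_hom h \<Longrightarrow> u \<le> v \<Longrightarrow> h u \<le> h v"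
  by (metis frame_hom_def inf.absorb_iff1)

lemma frame_hom_INF:
  assumes "frame_hom h" "finite Y"
  shows "h (INF y\<in>Y. f y) = (INF y\<in>Y. h (f y))"
  using assms(2,1) by (induction Y) (auto simp: frame_hom_def)


section \<open>The exponential of the Sierpinski locale by \<open>X\<close>\<close>

text \<open>Its frame consists of the Scott open sets of opens of \<open>X\<close>.
  The lemma \<open>scott_exponential\<close> below shows that for locally compact \<open>X\<close>
  this locale is the exponential.\<close>

definition scott :: "'x::complete_lattice set \<Rightarrow> bool" where
  "scott V \<longleftrightarrow> (\<forall>x\<in>V. \<forall>y. x \<le> y \<longrightarrow> y \<in> V) \<and>
               (\<forall>S. directed S \<and> Sup S \<in> V \<longrightarrow> (\<exists>s\<in>S. s \<in> V))"

lemma scott_up: "scott V \<Longrightarrow> x \<in> V \<Longrightarrow> x \<le> y \<Longrightarrow> y \<in> V"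
  unfolding scott_def by simp

lemma scott_dir: "scott V \<Longrightarrow> directed S \<Longrightarrow> Sup S \<in> V \<Longrightarrow> \<exists>s\<in>S. s \<in> V"
  unfolding scott_def by simp

lemma scottI:
  assumes "\<And>x y. x \<in> V \<Longrightarrow> x \<le> y \<Longrightarrow> y \<in> V"
    and "\<And>S. directed S \<Longrightarrow> Sup S \<in> V \<Longrightarrow> \<exists>s\<in>S. s \<in> V"
  shows "scott V"
  using assms unfolding scott_def by simp

lemma scott_Union: "(\<And>V. V \<in> \<V> \<Longrightarrow> scott V) \<Longrightarrow> scott (\<Union>\<V>)"
  by (rule scottI) (meson UnionE UnionI scott_up, meson UnionE UnionI scott_dir)

lemma scott_Un: "scott V \<Longrightarrow> scott W \<Longrightarrow> scott (V \<union> W)"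
  by (rule scottI) (metis Un_iff scott_up, metis Un_iff scott_dir)

lemma scott_Int:
  assumes "scott V" "scott W"
  shows "scott (V \<inter> W)"
proof (rule scottI)
  show "y \<in> V \<inter> W" if "x \<in> V \<inter> W" "x \<le> y" for x y
    using that assms scott_up by blast
  fix S assume S: "directed S" "Sup S \<in> V \<inter> W"
  then obtain a b where ab: "a \<in> S" "a \<in> V" "b \<in> S" "b \<in> W"
    using assms scott_dir by (metis IntE)
  then obtain c where "c \<in> S" "a \<le> c" "b \<le> c"
    using S(1) unfolding directed_def by metis
  then show "\<exists>s\<in>S. s \<in> V \<inter> W" using ab assms scott_up by (metis IntI)
qed

lemma scott_UNIV: "scott UNIV"
  by (auto simp: scott_def directed_def)

typedef (overloaded) 'x scott_open = "{V :: 'x::complete_lattice set. scott V}"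
  using scott_UNIV by auto

instantiation scott_open :: (complete_lattice) complete_lattice
begin
definition "U \<le> V \<longleftrightarrow> Rep_scott_open U \<subseteq> Rep_scott_open V"
definition "U < V \<longleftrightarrow> Rep_scott_open U \<subset> Rep_scott_open V"
definition "inf U V = Abs_scott_open (Rep_scott_open U \<inter> Rep_scott_open V)"
definition "sup U V = Abs_scott_open (Rep_scott_open U \<union> Rep_scott_open V)"
definition "Sup A = Abs_scott_open (\<Union>V\<in>A. Rep_scott_open V)"
definition "Inf A = Abs_scott_open (\<Union>{V. scott V \<and> (\<forall>W\<in>A. V \<subseteq> Rep_scott_open W)})"
definition "bot = (Abs_scott_open {} :: 'a scott_open)"
definition "Orderings.top = (Abs_scott_open UNIV :: 'a scott_open)"

lemma scott_Rep: "scott (Rep_scott_open V)"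
  using Rep_scott_open by simp

lemma Rep_scott_simps:
  fixes U V :: "'a scott_open" and A :: "'a scott_open set"
  shows "Rep_scott_open (inf U V) = Rep_scott_open U \<inter> Rep_scott_open V"
    and "Rep_scott_open (sup U V) = Rep_scott_open U \<union> Rep_scott_open V"
    and "Rep_scott_open (Sup A) = (\<Union>V\<in>A. Rep_scott_open V)"
    and "Rep_scott_open (Inf A) = \<Union>{V. scott V \<and> (\<forall>W\<in>A. V \<subseteq> Rep_scott_open W)}"
    and "Rep_scott_open (bot :: 'a scott_open) = {}"
    and "Rep_scott_open (Orderings.top :: 'a scott_open) = UNIV"
proof -
  have *: "scott X \<Longrightarrow> Rep_scott_open (Abs_scott_open X) = X" for X :: "'a set"
    by (simp add: Abs_scott_open_inverse)
  show "Rep_scott_open (inf U V) = Rep_scott_open U \<inter> Rep_scott_open V"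
    unfolding inf_scott_open_def by (intro * scott_Int scott_Rep)
  show "Rep_scott_open (sup U V) = Rep_scott_open U \<union> Rep_scott_open V"
    unfolding sup_scott_open_def by (intro * scott_Un scott_Rep)
  show "Rep_scott_open (Sup A) = (\<Union>V\<in>A. Rep_scott_open V)"
    unfolding Sup_scott_open_def by (intro * scott_Union) (metis imageE scott_Rep)
  show "Rep_scott_open (Inf A) = \<Union>{V. scott V \<and> (\<forall>W\<in>A. V \<subseteq> Rep_scott_open W)}"
    unfolding Inf_scott_open_def by (intro * scott_Union) simp
  show "Rep_scott_open (bot :: 'a scott_open) = {}"
    unfolding bot_scott_open_def by (intro * scottI) simp_all
  show "Rep_scott_open (Orderings.top :: 'a scott_open) = UNIV"
    unfolding top_scott_open_def by (intro * scott_UNIV)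
qed

instance
proof
  fix x y z :: "'a scott_open" and A :: "'a scott_open set"
  show "x \<in> A \<Longrightarrow> Inf A \<le> x" "(\<And>x. x \<in> A \<Longrightarrow> z \<le> x) \<Longrightarrow> z \<le> Inf A"
    using scott_Rep[of z] by (auto simp: less_eq_scott_open_def Rep_scott_simps)
  show "x \<in> A \<Longrightarrow> x \<le> Sup A" "(\<And>x. x \<in> A \<Longrightarrow> x \<le> z) \<Longrightarrow> Sup A \<le> z"
    by (auto simp: less_eq_scott_open_def Rep_scott_simps)
  have Inf0: "\<Union>{V :: 'a set. scott V} = UNIV" using scott_UNIV by blast
  show "Inf {} = (Orderings.top :: 'a scott_open)" "Sup {} = (bot :: 'a scott_open)"
    by (simp_all add: Rep_scott_open_inject[symmetric] Rep_scott_simps Inf0)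
qed (auto simp: less_eq_scott_open_def less_scott_open_def Rep_scott_simps Rep_scott_open_inject)
end

instance scott_open :: (complete_lattice) frame
  by standard (auto simp: Rep_scott_open_inject[symmetric] Rep_scott_simps)

text \<open>Opens of a product of locales, as sets of open rectangles.\<close>

definition prod_open :: "('w::frame \<times> 'x::frame) set \<Rightarrow> bool" where
  "prod_open J \<longleftrightarrow>
     (\<forall>w x w' x'. (w, x) \<in> J \<and> w' \<le> w \<and> x' \<le> x \<longrightarrow> (w', x') \<in> J) \<and>
     (\<forall>A x. (\<forall>w\<in>A. (w, x) \<in> J) \<longrightarrow> (Sup A, x) \<in> J) \<and>
     (\<forall>w B. (\<forall>x\<in>B. (w, x) \<in> J) \<longrightarrow> (w, Sup B) \<in> J)"

definition prod_gen :: "('w::frame \<times> 'x::frame) set \<Rightarrow> ('w \<times> 'x) set" where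
  "prod_gen A = \<Inter>{J. prod_open J \<and> A \<subseteq> J}"

text \<open>The evaluation map, as an open of the product of the exponential with \<open>X\<close>.\<close>

definition evaluation :: "('x::frame scott_open \<times> 'x) set" where
  "evaluation = {(V, x). Rep_scott_open V \<subseteq> {x..}}"

lemma prod_openI:
  assumes "\<And>w x w' x'. (w, x) \<in> J \<Longrightarrow> w' \<le> w \<Longrightarrow> x' \<le> x \<Longrightarrow> (w', x') \<in> J"
    and "\<And>A x. (\<And>w. w \<in> A \<Longrightarrow> (w, x) \<in> J) \<Longrightarrow> (Sup A, x) \<in> J"
    and "\<And>w B. (\<And>x. x \<in> B \<Longrightarrow> (w, x) \<in> J) \<Longrightarrow> (w, Sup B) \<in> J"
  shows "prod_open J"
  unfolding prod_open_def by (intro conjI allI impI) (use assms in \<open>metis\<close>)+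

lemma prod_openD:
  assumes "prod_open J"
  shows "(w, x) \<in> J \<Longrightarrow> w' \<le> w \<Longrightarrow> x' \<le> x \<Longrightarrow> (w', x') \<in> J"
    and "(\<And>w. w \<in> A \<Longrightarrow> (w, x) \<in> J) \<Longrightarrow> (Sup A, x) \<in> J"
    and "(\<And>x. x \<in> B \<Longrightarrow> (w, x) \<in> J) \<Longrightarrow> (w, Sup B) \<in> J"
  using assms unfolding prod_open_def by metis+

lemma prod_open_evaluation: "prod_open evaluation"
proof (rule prod_openI, goal_cases)
  case (1 w x w' x')
  then show ?case
    by (auto simp: evaluation_def less_eq_scott_open_def)
qed (auto simp: evaluation_def Rep_scott_simps intro!: Sup_least)

lemma prod_open_prod_gen: "prod_open (prod_gen A)"
  unfolding prod_gen_def
  by (rule prod_openI) (simp_all, (meson prod_openD)+)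

lemma prod_gen_incl: "p \<in> A \<Longrightarrow> p \<in> prod_gen A"
  by (auto simp: prod_gen_def)

lemma prod_gen_least: "prod_open J \<Longrightarrow> A \<subseteq> J \<Longrightarrow> prod_gen A \<subseteq> J"
  by (auto simp: prod_gen_def)

lemma directedI:
  assumes "S \<noteq> {}" "\<And>x y. x \<in> S \<Longrightarrow> y \<in> S \<Longrightarrow> \<exists>z\<in>S. x \<le> z \<and> y \<le> z"
  shows "directed S"
  using assms unfolding directed_def by simp

lemma wbD: "x \<lless> y \<Longrightarrow> directed S \<Longrightarrow> y \<le> Sup S \<Longrightarrow> \<exists>s\<in>S. x \<le> s"
  unfolding way_below_def by simp

lemma wbI: "(\<And>S. directed S \<Longrightarrow> y \<le> Sup S \<Longrightarrow> \<exists>s\<in>S. x \<le> s) \<Longrightarrow> x \<lless> y"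
  unfolding way_below_def by simp

lemma wb_le: "x \<lless> y \<Longrightarrow> x \<le> (y::'x::complete_lattice)"
  using wbD[of x y "{y}"] by (auto simp: directed_def)

lemma wb_mono: "x \<le> y \<Longrightarrow> y \<lless> z \<Longrightarrow> z \<le> w \<Longrightarrow> x \<lless> (w::'x::complete_lattice)"
  by (rule wbI) (meson order_trans wbD)

lemma wb_bot: "bot \<lless> (y::'x::complete_lattice)"
  by (rule wbI) (auto simp: directed_def)

lemma wb_sup:
  assumes "x \<lless> z" "y \<lless> z"
  shows "sup x y \<lless> (z::'x::complete_lattice)"
proof (rule wbI)
  fix S assume S: "directed S" "z \<le> Sup S"
  obtain a b where ab: "a \<in> S" "x \<le> a" "b \<in> S" "y \<le> b"
    using wbD[OF assms(1) S] wbD[OF assms(2) S] by blast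
  then obtain c where "c \<in> S" "a \<le> c" "b \<le> c"
    using S(1) unfolding directed_def by metis
  then show "\<exists>s\<in>S. sup x y \<le> s" using ab by (meson le_sup_iff order_trans)
qed

lemma directed_wb: "directed {x. x \<lless> (y::'x::complete_lattice)}"
proof (rule directedI)
  show "{x. x \<lless> y} \<noteq> {}" using wb_bot by auto
  show "\<exists>c\<in>{x. x \<lless> y}. a \<le> c \<and> b \<le> c" if "a \<in> {x. x \<lless> y}" "b \<in> {x. x \<lless> y}" for a b
    using that wb_sup by (intro bexI[of _ "sup a b"]) auto
qed

lemma lc_Sup: "locally_compact_locale TYPE('x::frame) \<Longrightarrow> Sup {x. x \<lless> y} = (y::'x)"
  by (simp add: locally_compact_locale_def)

lemma wb_interpolate:
  assumes lc: "locally_compact_locale TYPE('x::frame)" and "x \<lless> (z::'x)"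
  shows "\<exists>y. x \<lless> y \<and> y \<lless> z"
proof -
  let ?S = "{y. \<exists>y'. y \<lless> y' \<and> y' \<lless> z}"
  have "directed ?S"
  proof (rule directedI)
    show "?S \<noteq> {}" using wb_bot by auto
    fix a b assume "a \<in> ?S" "b \<in> ?S"
    then obtain a' b' where *: "a \<lless> a'" "a' \<lless> z" "b \<lless> b'" "b' \<lless> z" by auto
    then have "sup a b \<lless> sup a' b'" "sup a' b' \<lless> z"
      by (meson order_refl sup_ge1 sup_ge2 wb_mono wb_sup)+
    then show "\<exists>c\<in>?S. a \<le> c \<and> b \<le> c"
      by (metis (mono_tags, lifting) mem_Collect_eq sup_ge1 sup_ge2)
  qed
  moreover have "z \<le> Sup ?S"
  proof -
    have "y' \<le> Sup ?S" if "y' \<lless> z" for y'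
    proof -
      have "Sup {y. y \<lless> y'} \<le> Sup ?S" using that by (intro Sup_subset_mono) auto
      then show ?thesis by (simp add: lc_Sup[OF lc])
    qed
    then have "Sup {y'. y' \<lless> z} \<le> Sup ?S" by (intro Sup_least) auto
    then show ?thesis by (simp add: lc_Sup[OF lc])
  qed
  ultimately have "\<exists>s\<in>?S. x \<le> s" by (rule wbD[OF \<open>x \<lless> z\<close>])
  then obtain s y' where "x \<le> s" "s \<lless> y'" "y' \<lless> z" by auto
  then have "x \<lless> y'" "y' \<lless> z" using wb_mono[of x s y' y'] by auto
  then show ?thesis by auto
qed

lemma scott_above:
  assumes lc: "locally_compact_locale TYPE('x::frame)"
  shows "scott {z. y \<lless> (z::'x)}"
proof (rule scottI)
  show "v \<in> {z. y \<lless> z}" if "u \<in> {z. y \<lless> z}" "u \<le> v" for u v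
    using that wb_mono by blast
  fix S assume S: "directed S" "Sup S \<in> {z. y \<lless> z}"
  then obtain y' where y': "y \<lless> y'" "y' \<lless> Sup S" using wb_interpolate[OF lc] by blast
  obtain s where "s \<in> S" "y' \<le> s" using wbD[OF y'(2) S(1)] by blast
  with y'(1) show "\<exists>s\<in>S. s \<in> {z. y \<lless> z}" by (metis mem_Collect_eq order_refl wb_mono)
qed

text \<open>
  The universal property of the exponential: every open \<open>P\<close> of \<open>W \<times> X\<close> is the inverse image of
  \<open>evaluation\<close> along \<open>h \<times> X\<close> for a unique map \<open>h\<close> from \<open>W\<close> to the exponential.
\<close>

theorem scott_exponential:
  assumes lc: "locally_compact_locale TYPE('x::frame)"
    and P: "prod_open (P :: ('w::frame \<times> 'x) set)"
  shows "\<exists>!h :: 'x scott_open \<Rightarrow> 'w.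
           frame_hom h \<and> prod_gen ((\<lambda>(V, x). (h V, x)) ` evaluation) = P"
proof -
  define h :: "'x scott_open \<Rightarrow> 'w" where "h V = Sup {w. \<exists>x\<in>Rep_scott_open V. (w, x) \<in> P}" for V
  define up :: "'x \<Rightarrow> 'x scott_open" where "up y = Abs_scott_open {z. y \<lless> z}" for y
  have Rep_up: "Rep_scott_open (up y) = {z. y \<lless> z}" for y
    by (simp add: up_def Abs_scott_open_inverse scott_above[OF lc])
  have up_cl: "y \<in> Rep_scott_open V \<Longrightarrow> y \<le> z \<Longrightarrow> z \<in> Rep_scott_open V" for y z :: 'x and V
    using scott_up[OF scott_Rep] .
  have approx: "\<exists>y\<in>Rep_scott_open V. y \<lless> v" if "v \<in> Rep_scott_open V" for V and v :: 'x
    using scott_dir[OF scott_Rep[of V] directed_wb[of v]] that unfolding lc_Sup[OF lc] by auto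
  have dn: "(w, x) \<in> P \<Longrightarrow> w' \<le> w \<Longrightarrow> x' \<le> x \<Longrightarrow> (w', x') \<in> P" for w x w' x'
    using P by (rule prod_openD(1))
  have SupL: "(\<And>w. w \<in> A \<Longrightarrow> (w, x) \<in> P) \<Longrightarrow> (Sup A, x) \<in> P" for A x
    using P by (rule prod_openD(2))
  have SupR: "(\<And>x. x \<in> B \<Longrightarrow> (w, x) \<in> P) \<Longrightarrow> (w, Sup B) \<in> P" for w B
    using P by (rule prod_openD(3))
  have le_h: "x \<in> Rep_scott_open V \<Longrightarrow> (w, x) \<in> P \<Longrightarrow> w \<le> h V" for w x V
    unfolding h_def by (rule Sup_upper) auto
  have h_mono: "h V \<le> h V'" if "V \<le> V'" for V V'
    unfolding h_def using that by (intro Sup_subset_mono) (auto simp: less_eq_scott_open_def)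
  have hom: "frame_hom h"
    unfolding frame_hom_def
  proof (intro conjI allI)
    have "(Orderings.top, bot) \<in> P" using SupR[of "{}"] by simp
    then show "h Orderings.top = Orderings.top"
      by (intro top_le le_h) (auto simp: Rep_scott_simps)
    fix U V
    show "h (inf U V) = inf (h U) (h V)"
    proof (rule antisym)
      show "h (inf U V) \<le> inf (h U) (h V)" by (simp add: h_mono)
      have "inf w w' \<le> h (inf U V)"
        if "x \<in> Rep_scott_open U" "(w, x) \<in> P" "x' \<in> Rep_scott_open V" "(w', x') \<in> P" for w x w' x'
      proof (rule le_h)
        show "sup x x' \<in> Rep_scott_open (inf U V)"
          using that up_cl by (auto simp: Rep_scott_simps)
        have "(inf w w', Sup {x, x'}) \<in> P"
          by (rule SupR) (use that dn in auto)
        then show "(inf w w', sup x x') \<in> P" by simp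
      qed
      then show "inf (h U) (h V) \<le> h (inf U V)"
        unfolding h_def[of U] h_def[of V] 
        by (auto simp: inf_Sup_frame inf.commute[of "Sup _"] intro!: Sup_least)
          (metis inf.commute)
    qed
  next
    fix A
    show "h (Sup A) = Sup (h ` A)"
    proof (rule antisym)
      show "h (Sup A) \<le> Sup (h ` A)"
        unfolding h_def[of "Sup A"]
        by (rule Sup_least) (auto simp: Rep_scott_simps intro: le_h SUP_upper2)
      show "Sup (h ` A) \<le> h (Sup A)"
        by (rule Sup_least) (auto intro!: h_mono Sup_upper)
    qed
  qed
  have gen: "prod_gen ((\<lambda>(V, x). (h V, x)) ` evaluation) = P"
  proof (rule antisym)
    have "(h V, x) \<in> P" if "Rep_scott_open V \<subseteq> {x..}" for V x
      unfolding h_def by (rule SupL) (use that dn in auto)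
    then show "prod_gen ((\<lambda>(V, x). (h V, x)) ` evaluation) \<subseteq> P"
      by (intro prod_gen_least P) (auto simp: evaluation_def)
    let ?H = "prod_gen ((\<lambda>(V, x). (h V, x)) ` evaluation)"
    have H: "prod_open ?H" by (rule prod_open_prod_gen)
    show "P \<subseteq> ?H"
    proof clarify
      fix w x assume wx: "(w, x) \<in> P"
      have "(w, y) \<in> ?H" if "y \<lless> x" for y
      proof -
        have "(up y, y) \<in> evaluation" using wb_le by (auto simp: evaluation_def Rep_up)
        then have "(h (up y), y) \<in> ?H" by (intro prod_gen_incl) force
        moreover have "w \<le> h (up y)" using wx that by (intro le_h) (auto simp: Rep_up)
        ultimately show ?thesis using prod_openD(1)[OF H] by blast
      qed
      then have "(w, Sup {y. y \<lless> x}) \<in> ?H"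
        by (intro prod_openD(3)[OF H]) simp
      then show "(w, x) \<in> ?H" by (simp add: lc_Sup[OF lc])
    qed
  qed
  have uniq: "k = h" if k: "frame_hom k" "prod_gen ((\<lambda>(V, x). (k V, x)) ` evaluation) = P" for k
  proof
    fix V
    show "k V = h V"
    proof (rule antisym)
      have "V \<le> Sup (up ` Rep_scott_open V)"
        using approx by (auto simp: less_eq_scott_open_def Rep_scott_simps Rep_up)
      then have "k V \<le> Sup (k ` up ` Rep_scott_open V)"
        using k(1) frame_hom_mono[OF k(1)] by (metis frame_hom_def)
      also have "\<dots> \<le> h V"
      proof (rule Sup_least)
        fix w assume "w \<in> k ` up ` Rep_scott_open V"
        then obtain y where y: "w = k (up y)" "y \<in> Rep_scott_open V" by auto
        have "(up y, y) \<in> evaluation" using wb_le by (auto simp: evaluation_def Rep_up)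
        then have "(k (up y), y) \<in> P" unfolding k(2)[symmetric] by (intro prod_gen_incl) force
        then show "w \<le> h V" using y le_h by blast
      qed
      finally show "k V \<le> h V" .
    next
      define J where "J = {(w, x). \<forall>V. x \<in> Rep_scott_open V \<longrightarrow> w \<le> k V}"
      have "prod_open J"
      proof (rule prod_openI)
        show "(w', x') \<in> J" if "(w, x) \<in> J" "w' \<le> w" "x' \<le> x" for w x w' x'
          using that up_cl unfolding J_def by (auto intro: order_trans)
        show "(Sup A, x) \<in> J" if "\<And>w. w \<in> A \<Longrightarrow> (w, x) \<in> J" for A x
          using that unfolding J_def by (auto intro: Sup_least)
        fix w B assume B: "\<And>x. x \<in> B \<Longrightarrow> (w, x) \<in> J"
        have "w \<le> k V" if V: "Sup B \<in> Rep_scott_open V" for V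
        proof -
          define S where "S = {Sup Y | Y. finite Y \<and> (\<forall>y\<in>Y. \<exists>b\<in>B. y \<lless> b)}"
          have "directed S"
          proof (rule directedI)
            show "S \<noteq> {}" unfolding S_def by (auto intro: exI[of _ "{}"])
            fix a b assume "a \<in> S" "b \<in> S"
            then obtain Y Z where *: "a = Sup Y" "b = Sup Z" "finite Y" "finite Z"
              "\<forall>y\<in>Y. \<exists>b\<in>B. y \<lless> b" "\<forall>y\<in>Z. \<exists>b\<in>B. y \<lless> b" unfolding S_def by auto
            then have "Sup (Y \<union> Z) \<in> S" unfolding S_def by blast
            with * show "\<exists>z\<in>S. a \<le> z \<and> b \<le> z" by (metis Sup_union_distrib sup_ge1 sup_ge2)
          qed
          have "b \<le> Sup S" if "b \<in> B" for b
          proof -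
            have "y \<le> Sup S" if "y \<lless> b" for y
              using that \<open>b \<in> B\<close> unfolding S_def by (intro Sup_upper) (auto intro!: exI[of _ "{y}"])
            then have "Sup {y. y \<lless> b} \<le> Sup S" by (intro Sup_least) auto
            then show ?thesis by (simp add: lc_Sup[OF lc])
          qed
          then have "Sup B \<le> Sup S" by (rule Sup_least)
          then have "Sup S \<in> Rep_scott_open V" using V up_cl by blast
          then obtain Y where Y: "finite Y" "\<forall>y\<in>Y. \<exists>b\<in>B. y \<lless> b" "Sup Y \<in> Rep_scott_open V"
            using scott_dir[OF scott_Rep \<open>directed S\<close>] unfolding S_def by auto
          have "w \<le> k (up y)" if "y \<in> Y" for y
            using that Y(2) B unfolding J_def by (auto simp: Rep_up)
          then have "w \<le> (INF y\<in>Y. k (up y))" by (rule INF_greatest)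
          also have "\<dots> = k (INF y\<in>Y. up y)" by (simp add: frame_hom_INF k(1) Y(1))
          also have "\<dots> \<le> k V"
          proof (rule frame_hom_mono[OF k(1)])
            have "z \<in> Rep_scott_open V" if z: "z \<in> Rep_scott_open (INF y\<in>Y. up y)" for z
            proof -
              have "y \<lless> z" if "y \<in> Y" for y
                using z INF_lower[OF that, of up] by (auto simp: less_eq_scott_open_def Rep_up)
              then have "Sup Y \<le> z" by (intro Sup_least wb_le)
              then show ?thesis using Y(3) up_cl by blast
            qed
            then show "(INF y\<in>Y. up y) \<le> V" by (auto simp: less_eq_scott_open_def)
          qed
          finally show ?thesis .
        qed
        then show "(w, Sup B) \<in> J" unfolding J_def by auto
      qed
      moreover have "(\<lambda>(V, x). (k V, x)) ` evaluation \<subseteq> J"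
      proof clarify
        fix V and x :: 'x assume "(V, x) \<in> evaluation"
        then have "V \<le> V'" if "x \<in> Rep_scott_open V'" for V'
          using that up_cl[of x V']
          by (auto simp: evaluation_def less_eq_scott_open_def dest!: subsetD)
        then show "(k V, x) \<in> J" unfolding J_def using frame_hom_mono[OF k(1)] by auto
      qed
      ultimately have "P \<subseteq> J" unfolding k(2)[symmetric] by (rule prod_gen_least)
      then show "h V \<le> k V" unfolding h_def J_def by (intro Sup_least) auto
    qed
  qed
  show ?thesis using hom gen uniq by blast
qed


section \<open>Locales presented by propositional geometric theories\<close>

text \<open>
  An axiom \<open>R S \<S>\<close> of a theory over the set \<open>G\<close> of propositional symbols says that the conjunction
  of \<open>S\<close> entails the disjunction, over all \<open>S' \<in> \<S>\<close>, of the conjunction of \<open>S'\<close>; here \<open>S\<close> and all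
  \<open>S'\<close> are finite subsets of \<open>G\<close>. An open of the classifying locale is represented by the set of all
  finite \<open>T \<subseteq> G\<close> whose conjunction lies below it.
\<close>

definition theory_open ::
  "'g set \<Rightarrow> ('g set \<Rightarrow> 'g set set \<Rightarrow> bool) \<Rightarrow> 'g set set \<Rightarrow> bool" where
  "theory_open G R U \<longleftrightarrow> U \<subseteq> {T. finite T \<and> T \<subseteq> G} \<and>
     (\<forall>S T. S \<in> U \<and> S \<subseteq> T \<and> finite T \<and> T \<subseteq> G \<longrightarrow> T \<in> U) \<and>
     (\<forall>S \<S> T. R S \<S> \<and> S \<subseteq> T \<and> finite T \<and> T \<subseteq> G \<and> (\<forall>S'\<in>\<S>. S' \<union> T \<in> U) \<longrightarrow> T \<in> U)"

definition theory_hull ::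
  "'g set \<Rightarrow> ('g set \<Rightarrow> 'g set set \<Rightarrow> bool) \<Rightarrow> 'g set set \<Rightarrow> 'g set set" where
  "theory_hull G R A = \<Inter>{U. theory_open G R U \<and> {T\<in>A. finite T \<and> T \<subseteq> G} \<subseteq> U}"

lemma theory_openI:
  assumes "\<And>T. T \<in> U \<Longrightarrow> finite T \<and> T \<subseteq> G"
    and "\<And>S T. S \<in> U \<Longrightarrow> S \<subseteq> T \<Longrightarrow> finite T \<Longrightarrow> T \<subseteq> G \<Longrightarrow> T \<in> U"
    and "\<And>S \<S> T. R S \<S> \<Longrightarrow> S \<subseteq> T \<Longrightarrow> finite T \<Longrightarrow> T \<subseteq> G \<Longrightarrow> (\<And>S'. S' \<in> \<S> \<Longrightarrow> S' \<union> T \<in> U) \<Longrightarrow> T \<in> U"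
  shows "theory_open G R U"
  unfolding theory_open_def
proof (intro conjI subsetI allI impI, goal_cases)
  case (1 T)
  then show ?case using assms(1) by simp
next
  case (2 S T)
  then show ?case using assms(2)[of S T] by simp
next
  case (3 S \<S> T)
  then show ?case using assms(3)[of S \<S> T] by simp
qed

lemma theory_openD:
  assumes "theory_open G R U"
  shows "T \<in> U \<Longrightarrow> finite T \<and> T \<subseteq> G"
    and "S \<in> U \<Longrightarrow> S \<subseteq> T \<Longrightarrow> finite T \<Longrightarrow> T \<subseteq> G \<Longrightarrow> T \<in> U"
    and "R S \<S> \<Longrightarrow> S \<subseteq> T \<Longrightarrow> finite T \<Longrightarrow> T \<subseteq> G \<Longrightarrow> (\<And>S'. S' \<in> \<S> \<Longrightarrow> S' \<union> T \<in> U) \<Longrightarrow> T \<in> U"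
proof -
  note * = assms[unfolded theory_open_def, THEN conjunct1]
    assms[unfolded theory_open_def, THEN conjunct2, THEN conjunct1, rule_format, of S T]
    assms[unfolded theory_open_def, THEN conjunct2, THEN conjunct2, rule_format, of S \<S> T]
  show "T \<in> U \<Longrightarrow> finite T \<and> T \<subseteq> G" using *(1) by (auto dest: subsetD[of U])
  show "S \<in> U \<Longrightarrow> S \<subseteq> T \<Longrightarrow> finite T \<Longrightarrow> T \<subseteq> G \<Longrightarrow> T \<in> U" using *(2) by simp
  show "R S \<S> \<Longrightarrow> S \<subseteq> T \<Longrightarrow> finite T \<Longrightarrow> T \<subseteq> G \<Longrightarrow> (\<And>S'. S' \<in> \<S> \<Longrightarrow> S' \<union> T \<in> U) \<Longrightarrow> T \<in> U"
    using *(3) by simp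
qed

lemma theory_open_Inter:
  assumes "\<U> \<noteq> {}" "\<And>U. U \<in> \<U> \<Longrightarrow> theory_open G R U"
  shows "theory_open G R (\<Inter>\<U>)"
proof (rule theory_openI, goal_cases)
  case (1 T)
  then show ?case using assms theory_openD(1) by (metis Inter_iff ex_in_conv)
next
  case (2 S T)
  then show ?case using theory_openD(2)[OF assms(2)] by (metis Inter_iff)
next
  case (3 S \<S> T)
  then show ?case using theory_openD(3)[OF assms(2), of _ S \<S> T] by (auto intro!: InterI)
qed

lemma theory_open_all: "theory_open G R {T. finite T \<and> T \<subseteq> G}"
  by (rule theory_openI) auto

lemma theory_open_hull: "theory_open G R (theory_hull G R A)"
  unfolding theory_hull_def
  by (rule theory_open_Inter) (use theory_open_all[of G R] in auto)

lemma theory_hull_incl: "T \<in> A \<Longrightarrow> finite T \<Longrightarrow> T \<subseteq> G \<Longrightarrow> T \<in> theory_hull G R A"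
  unfolding theory_hull_def by blast

lemma theory_hull_least:
  "theory_open G R U \<Longrightarrow> {T\<in>A. finite T \<and> T \<subseteq> G} \<subseteq> U \<Longrightarrow> theory_hull G R A \<subseteq> U"
  unfolding theory_hull_def by (rule Inter_lower) simp


section \<open>The external description of the Gelfand spectrum\<close>

text \<open>
  The functor \<open>C \<mapsto> L\<^sub>C\<close> has stalk \<open>colim\<^bsub>C\<in>I\<^esub> L\<^sub>C\<close> at a point \<open>I\<close> of \<open>Idl \<C>\<close>, and the formation of
  \<open>RSpec\<close> commutes with change of base. Hence the (generalized) points of the external description
  are the pairs \<open>(I, x)\<close> of an ideal \<open>I\<close> of \<open>\<C>\<close> and a regular prime filter \<open>x\<close> of
  \<open>colim\<^bsub>C\<in>I\<^esub> L\<^sub>C\<close>; the map to \<open>Idl \<C>\<close> sends \<open>(I, x)\<close> to \<open>I\<close>, so the inverse image of an up-closed \<open>V\<close>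
  is the join of the \<open>InIdl C\<close> with \<open>C \<in> V\<close>. The geometric theory of these pairs has symbols
  \<open>InIdl C\<close>, for \<open>C \<in> I\<close>, and \<open>InFilter C a\<close> (where \<open>a \<in> L\<^sub>C\<close>), for \<open>C \<in> I\<close> and \<open>[a] \<in> x\<close>.
  Its axioms, in order: \<open>I\<close> is an ideal; \<open>x\<close> is a subset of the colimit; \<open>x\<close> is a filter; \<open>x\<close> is prime;
  \<open>x\<close> is regular. In the last one, an element well
  inside \<open>[a]\<close> and the witness of this relation may only exist at some later stage \<open>D\<close>.
\<close>

datatype 'a spec_symbol = InIdl "'a set" | InFilter "'a set" "'a lat_term set"

definition spec_symbols :: "'a::unital_cstar_algebra spec_symbol set" where
  "spec_symbols = InIdl ` \<C> \<union> {InFilter C a | C a. C \<in> \<C> \<and> a \<in> carrier (\<L> C)}"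

inductive spec_axiom ::
  "'a::unital_cstar_algebra spec_symbol set \<Rightarrow> 'a spec_symbol set set \<Rightarrow> bool" where
  inhabited: "spec_axiom {} {{InIdl C} | C. C \<in> \<C>}"
| down_closed: "C \<in> \<C> \<Longrightarrow> D \<in> \<C> \<Longrightarrow> C \<subseteq> D \<Longrightarrow> spec_axiom {InIdl D} {{InIdl C}}"
| directed: "C \<in> \<C> \<Longrightarrow> D \<in> \<C> \<Longrightarrow>
    spec_axiom {InIdl C, InIdl D} {{InIdl E} | E. E \<in> \<C> \<and> C \<subseteq> E \<and> D \<subseteq> E}"
| over: "C \<in> \<C> \<Longrightarrow> a \<in> carrier (\<L> C) \<Longrightarrow> spec_axiom {InFilter C a} {{InIdl C}}"
| later: "C \<in> \<C> \<Longrightarrow> D \<in> \<C> \<Longrightarrow> C \<subseteq> D \<Longrightarrow> a \<in> carrier (\<L> C) \<Longrightarrow>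
    spec_axiom {InIdl D, InFilter C a} {{InFilter D (lat_map D a)}}"
| earlier: "C \<in> \<C> \<Longrightarrow> D \<in> \<C> \<Longrightarrow> C \<subseteq> D \<Longrightarrow> a \<in> carrier (\<L> C) \<Longrightarrow>
    spec_axiom {InFilter D (lat_map D a)} {{InFilter C a}}"
| filter_top: "C \<in> \<C> \<Longrightarrow> spec_axiom {InIdl C} {{InFilter C \<top>\<^bsub>\<L> C\<^esub>}}"
| filter_meet: "C \<in> \<C> \<Longrightarrow> a \<in> carrier (\<L> C) \<Longrightarrow> b \<in> carrier (\<L> C) \<Longrightarrow>
    spec_axiom {InFilter C a, InFilter C b} {{InFilter C (a \<sqinter>\<^bsub>\<L> C\<^esub> b)}}"
| filter_up: "C \<in> \<C> \<Longrightarrow> a \<in> carrier (\<L> C) \<Longrightarrow> b \<in> carrier (\<L> C) \<Longrightarrow> a \<sqsubseteq>\<^bsub>\<L> C\<^esub> b \<Longrightarrow>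
    spec_axiom {InFilter C a} {{InFilter C b}}"
| prime_bot: "C \<in> \<C> \<Longrightarrow> spec_axiom {InFilter C \<bottom>\<^bsub>\<L> C\<^esub>} {}"
| prime_join: "C \<in> \<C> \<Longrightarrow> a \<in> carrier (\<L> C) \<Longrightarrow> b \<in> carrier (\<L> C) \<Longrightarrow>
    spec_axiom {InFilter C (a \<squnion>\<^bsub>\<L> C\<^esub> b)} {{InFilter C a}, {InFilter C b}}"
| regular: "C \<in> \<C> \<Longrightarrow> a \<in> carrier (\<L> C) \<Longrightarrow>
    spec_axiom {InFilter C a}
      {{InFilter D a'} | D a'. D \<in> \<C> \<and> C \<subseteq> D \<and> well_inside (\<L> D) a' (lat_map D a)}"

typedef (overloaded) 'a spec_open =
  "{U :: 'a::unital_cstar_algebra spec_symbol set set. theory_open spec_symbols spec_axiom U}"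
  using theory_open_all by auto

abbreviation spec_hull ::
  "'a::unital_cstar_algebra spec_symbol set set \<Rightarrow> 'a spec_symbol set set" where
  "spec_hull \<equiv> theory_hull spec_symbols spec_axiom"

instantiation spec_open :: (unital_cstar_algebra) complete_lattice
begin
definition "U \<le> V \<longleftrightarrow> Rep_spec_open U \<subseteq> Rep_spec_open V"
definition "U < V \<longleftrightarrow> Rep_spec_open U \<subset> Rep_spec_open V"
definition "inf U V = Abs_spec_open (Rep_spec_open U \<inter> Rep_spec_open V)"
definition "sup U V = Abs_spec_open (spec_hull (Rep_spec_open U \<union> Rep_spec_open V))"
definition "Sup A = Abs_spec_open (spec_hull (\<Union>V\<in>A. Rep_spec_open V))"
definition "Inf A = Abs_spec_open ({T. finite T \<and> T \<subseteq> spec_symbols} \<inter> (\<Inter>V\<in>A. Rep_spec_open V))"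
definition "bot = (Abs_spec_open (spec_hull {}) :: 'a spec_open)"
definition "Orderings.top = (Abs_spec_open {T. finite T \<and> T \<subseteq> spec_symbols} :: 'a spec_open)"

lemma theory_open_Rep: "theory_open spec_symbols spec_axiom (Rep_spec_open U)"
  using Rep_spec_open by simp

lemma Rep_spec_simps:
  fixes U V :: "'a spec_open" and A :: "'a spec_open set"
  shows "Rep_spec_open (inf U V) = Rep_spec_open U \<inter> Rep_spec_open V"
    and "Rep_spec_open (sup U V) = spec_hull (Rep_spec_open U \<union> Rep_spec_open V)"
    and "Rep_spec_open (Sup A) = spec_hull (\<Union>V\<in>A. Rep_spec_open V)"
    and "Rep_spec_open (Inf A) = {T. finite T \<and> T \<subseteq> spec_symbols} \<inter> (\<Inter>V\<in>A. Rep_spec_open V)"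
    and "Rep_spec_open (bot :: 'a spec_open) = spec_hull {}"
    and "Rep_spec_open (Orderings.top :: 'a spec_open) = {T. finite T \<and> T \<subseteq> spec_symbols}"
proof -
  have *: "theory_open spec_symbols spec_axiom X \<Longrightarrow> Rep_spec_open (Abs_spec_open X) = X"
    for X :: "'a spec_symbol set set"
    by (simp add: Abs_spec_open_inverse)
  show "Rep_spec_open (inf U V) = Rep_spec_open U \<inter> Rep_spec_open V"
    unfolding inf_spec_open_def
    by (rule *) (use theory_open_Inter[of "{Rep_spec_open U, Rep_spec_open V}"] theory_open_Rep in auto)
  show "Rep_spec_open (Inf A) = {T. finite T \<and> T \<subseteq> spec_symbols} \<inter> (\<Inter>V\<in>A. Rep_spec_open V)"
    unfolding Inf_spec_open_def
  proof (rule *)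
    have "theory_open spec_symbols spec_axiom
        (\<Inter>(insert {T. finite T \<and> T \<subseteq> spec_symbols} (Rep_spec_open ` A)))"
    proof (rule theory_open_Inter)
      show "theory_open spec_symbols spec_axiom V"
        if "V \<in> insert {T. finite T \<and> T \<subseteq> spec_symbols} (Rep_spec_open ` A)" for V
        using that
      proof (elim insertE imageE)
        show ?thesis if "V = {T. finite T \<and> T \<subseteq> spec_symbols}"
          unfolding that by (rule theory_open_all)
        show ?thesis if "V = Rep_spec_open U" for U
          unfolding that by (rule theory_open_Rep)
      qed
    qed simp
    then show "theory_open spec_symbols spec_axiom
        ({T. finite T \<and> T \<subseteq> spec_symbols} \<inter> (\<Inter>V\<in>A. Rep_spec_open V))"
      by simp
  qed
  show "Rep_spec_open (sup U V) = spec_hull (Rep_spec_open U \<union> Rep_spec_open V)"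
    "Rep_spec_open (Sup A) = spec_hull (\<Union>V\<in>A. Rep_spec_open V)"
    "Rep_spec_open (bot :: 'a spec_open) = spec_hull {}"
    "Rep_spec_open (Orderings.top :: 'a spec_open) = {T. finite T \<and> T \<subseteq> spec_symbols}"
    unfolding sup_spec_open_def Sup_spec_open_def bot_spec_open_def top_spec_open_def
    by (intro * theory_open_hull theory_open_all)+
qed

lemma in_Rep_spec_open: "T \<in> Rep_spec_open U \<Longrightarrow> finite T \<and> T \<subseteq> spec_symbols"
  using theory_openD(1)[OF theory_open_Rep] .

lemma Rep_sub_hull: "Rep_spec_open U \<subseteq> B \<Longrightarrow> Rep_spec_open U \<subseteq> spec_hull B"
  using in_Rep_spec_open by (meson subsetD subsetI theory_hull_incl)

lemma hull_sub_Rep: "B \<subseteq> Rep_spec_open U \<Longrightarrow> spec_hull B \<subseteq> Rep_spec_open U"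
  by (rule theory_hull_least[OF theory_open_Rep]) auto

instance
proof
  fix x y z :: "'a spec_open" and A :: "'a spec_open set"
  show "x < y \<longleftrightarrow> x \<le> y \<and> \<not> y \<le> x" "x \<le> x" "x \<le> y \<Longrightarrow> y \<le> z \<Longrightarrow> x \<le> z"
    "x \<le> y \<Longrightarrow> y \<le> x \<Longrightarrow> x = y"
    by (auto simp: less_eq_spec_open_def less_spec_open_def Rep_spec_open_inject)
  show "inf x y \<le> x" "inf x y \<le> y" "x \<le> y \<Longrightarrow> x \<le> z \<Longrightarrow> x \<le> inf y z"
    by (auto simp: less_eq_spec_open_def Rep_spec_simps)
  show "x \<le> sup x y" "y \<le> sup x y"
    unfolding less_eq_spec_open_def Rep_spec_simps by (rule Rep_sub_hull, simp)+
  show "y \<le> x \<Longrightarrow> z \<le> x \<Longrightarrow> sup y z \<le> x"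
    unfolding less_eq_spec_open_def Rep_spec_simps by (rule hull_sub_Rep) simp
  show "x \<in> A \<Longrightarrow> Inf A \<le> x" "(\<And>x. x \<in> A \<Longrightarrow> z \<le> x) \<Longrightarrow> z \<le> Inf A"
    using in_Rep_spec_open[of _ z] by (auto simp: less_eq_spec_open_def Rep_spec_simps)
  show "x \<in> A \<Longrightarrow> x \<le> Sup A"
    unfolding less_eq_spec_open_def Rep_spec_simps by (rule Rep_sub_hull) auto
  show "(\<And>x. x \<in> A \<Longrightarrow> x \<le> z) \<Longrightarrow> Sup A \<le> z"
    unfolding less_eq_spec_open_def Rep_spec_simps by (rule hull_sub_Rep) auto
  show "Inf {} = (Orderings.top :: 'a spec_open)" "Sup {} = (bot :: 'a spec_open)"
    by (simp_all add: Rep_spec_open_inject[symmetric] Rep_spec_simps)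
qed
end

instance spec_open :: (unital_cstar_algebra) frame
proof
  fix x :: "'a spec_open" and A
  show "inf x (Sup A) = Sup (inf x ` A)"
  proof (rule antisym)
    show "Sup (inf x ` A) \<le> inf x (Sup A)"
      by (intro Sup_least) (auto intro: le_infI2 Sup_upper)
    let ?K = "Rep_spec_open (Sup (inf x ` A))"
    let ?U = "{S. finite S \<and> S \<subseteq> spec_symbols \<and> (\<forall>T\<in>Rep_spec_open x. S \<union> T \<in> ?K)}"
    have K: "theory_open spec_symbols spec_axiom ?K" by (rule theory_open_Rep)
    have "theory_open spec_symbols spec_axiom ?U"
    proof (rule theory_openI, goal_cases)
      case (1 T)
      then show ?case by simp
    next
      case (2 S T)
      have "T \<union> T' \<in> ?K" if "T' \<in> Rep_spec_open x" for T'
        by (rule theory_openD(2)[OF K, of "S \<union> T'"])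
          (use 2 that in_Rep_spec_open in \<open>auto dest!: in_Rep_spec_open\<close>)
      with 2 show ?case by simp
    next
      case (3 S \<S> T)
      have "T \<union> T' \<in> ?K" if "T' \<in> Rep_spec_open x" for T'
        by (rule theory_openD(3)[OF K 3(1)])
          (use 3 that in \<open>auto simp: Un_assoc dest!: in_Rep_spec_open\<close>)
      with 3 show ?case by simp
    qed
    moreover have "(\<Union>V\<in>A. Rep_spec_open V) \<subseteq> ?U"
    proof (intro UN_least subsetI CollectI conjI ballI)
      fix V S T assume V: "V \<in> A" "S \<in> Rep_spec_open V"
      then show "finite S" "\<And>g. g \<in> S \<Longrightarrow> g \<in> spec_symbols"
        using in_Rep_spec_open by blast+
    next
      fix V S T assume V: "V \<in> A" "S \<in> Rep_spec_open V" and T: "T \<in> Rep_spec_open x"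
      have "S \<union> T \<in> Rep_spec_open (inf x V)"
        using V T in_Rep_spec_open[OF T] in_Rep_spec_open[OF V(2)]
          theory_openD(2)[OF theory_open_Rep, of S V "S \<union> T"]
          theory_openD(2)[OF theory_open_Rep, of T x "S \<union> T"]
        by (simp add: Rep_spec_simps)
      moreover have "inf x V \<le> Sup (inf x ` A)" using V by (intro Sup_upper) simp
      ultimately show "S \<union> T \<in> ?K" unfolding less_eq_spec_open_def by blast
    qed
    ultimately have "Rep_spec_open (Sup A) \<subseteq> ?U"
      unfolding Rep_spec_simps(3) by (intro theory_hull_least) auto
    then show "inf x (Sup A) \<le> Sup (inf x ` A)"
      unfolding less_eq_spec_open_def Rep_spec_simps(1) by force
  qed
qed

definition spec_prop :: "'a::unital_cstar_algebra spec_symbol \<Rightarrow> 'a spec_open" where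
  "spec_prop g = Abs_spec_open (spec_hull {{g}})"

text \<open>
  The universal property: a map from a locale \<open>W\<close> to the external spectrum is the same as a
  \<open>W\<close>-valued model of the theory.
\<close>

theorem spec_universal:
  fixes f :: "'a::unital_cstar_algebra spec_symbol \<Rightarrow> 'w::frame"
  assumes f: "\<And>S \<S>. spec_axiom S \<S> \<Longrightarrow> (INF g\<in>S. f g) \<le> (SUP S'\<in>\<S>. INF g\<in>S'. f g)"
  shows "\<exists>!h :: 'a spec_open \<Rightarrow> 'w. frame_hom h \<and> (\<forall>g\<in>spec_symbols. h (spec_prop g) = f g)"
proof -
  define h :: "'a spec_open \<Rightarrow> 'w" where "h U = (SUP T\<in>Rep_spec_open U. INF g\<in>T. f g)" for U
  have below: "theory_open spec_symbols spec_axiom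
      {T. finite T \<and> T \<subseteq> spec_symbols \<and> (INF g\<in>T. f g) \<le> w}" for w
  proof (rule theory_openI, goal_cases)
    case (1 T)
    then show ?case by simp
  next
    case (2 S T)
    then show ?case using INF_superset_mono[of S T f f] by auto
  next
    case (3 S \<S> T)
    have "(INF g\<in>T. f g) \<le> inf (INF g\<in>T. f g) (SUP S'\<in>\<S>. INF g\<in>S'. f g)"
      using f[OF 3(1)] INF_superset_mono[OF 3(2), of f f] by auto
    also have "\<dots> = (SUP S'\<in>\<S>. INF g\<in>S' \<union> T. f g)"
      by (simp add: inf_Sup_frame image_image INF_union inf.commute)
    also have "\<dots> \<le> w" using 3(5) by (intro SUP_least) simp
    finally show ?case using 3 by simp
  qed
  have h_le: "h U \<le> w" if "B \<subseteq> {T. finite T \<and> T \<subseteq> spec_symbols \<longrightarrow> (INF g\<in>T. f g) \<le> w}"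
    "Rep_spec_open U = spec_hull B" for U w B
  proof -
    have "spec_hull B \<subseteq> {T. finite T \<and> T \<subseteq> spec_symbols \<and> (INF g\<in>T. f g) \<le> w}"
      by (rule theory_hull_least[OF below]) (use that in auto)
    then show ?thesis unfolding h_def that(2) by (intro SUP_least) auto
  qed
  have Rep_prop: "Rep_spec_open (spec_prop g) = spec_hull {{g}}" for g :: "'a spec_symbol"
    by (simp add: spec_prop_def Abs_spec_open_inverse theory_open_hull)
  have hom: "frame_hom h"
    unfolding frame_hom_def
  proof (intro conjI allI)
    have "(INF g\<in>{}. f g) \<le> h Orderings.top"
      unfolding h_def by (rule SUP_upper) (simp add: Rep_spec_simps)
    then show "h Orderings.top = Orderings.top" by (simp add: top_unique)
    fix U V
    show "h (inf U V) = inf (h U) (h V)"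
    proof (rule antisym)
      show "h (inf U V) \<le> inf (h U) (h V)"
        unfolding h_def by (intro le_infI SUP_subset_mono) (auto simp: Rep_spec_simps)
      have "inf (INF g\<in>T. f g) (INF g\<in>S. f g) \<le> h (inf U V)"
        if ST: "S \<in> Rep_spec_open U" "T \<in> Rep_spec_open V" for S T
      proof -
        have "S \<union> T \<in> Rep_spec_open (inf U V)"
          using ST in_Rep_spec_open[OF ST(1)] in_Rep_spec_open[OF ST(2)]
            theory_openD(2)[OF theory_open_Rep, of S U "S \<union> T"]
            theory_openD(2)[OF theory_open_Rep, of T V "S \<union> T"]
          by (simp add: Rep_spec_simps)
        then have "(INF g\<in>S \<union> T. f g) \<le> h (inf U V)" unfolding h_def by (rule SUP_upper)
        then show ?thesis by (simp add: INF_union inf.commute)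
      qed
      then show "inf (h U) (h V) \<le> h (inf U V)"
        unfolding h_def[of U] h_def[of V]
        by (simp add: inf_Sup_frame image_image inf.commute[of "Sup _"] SUP_le_iff)
    qed
  next
    fix A
    show "h (Sup A) = Sup (h ` A)"
    proof (rule antisym)
      show "h (Sup A) \<le> Sup (h ` A)"
        by (rule h_le[OF _ Rep_spec_simps(3)]) (auto simp: h_def intro!: SUP_upper2 SUP_upper)
      have "h V \<le> h (Sup A)" if "V \<in> A" for V
        unfolding h_def using Sup_upper[OF that]
        by (intro SUP_subset_mono) (auto simp: less_eq_spec_open_def)
      then show "Sup (h ` A) \<le> h (Sup A)" by (intro SUP_least)
    qed
  qed
  have gens: "h (spec_prop g) = f g" if "g \<in> spec_symbols" for g
  proof (rule antisym)
    show "h (spec_prop g) \<le> f g" by (rule h_le[OF _ Rep_prop]) simp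
    have "{g} \<in> Rep_spec_open (spec_prop g)"
      unfolding Rep_prop by (rule theory_hull_incl) (use that in auto)
    then have "(INF g\<in>{g}. f g) \<le> h (spec_prop g)" unfolding h_def by (rule SUP_upper)
    then show "f g \<le> h (spec_prop g)" by simp
  qed
  have decomp: "U = (SUP T\<in>Rep_spec_open U. INF g\<in>T. spec_prop g)" for U :: "'a spec_open"
  proof (rule antisym)
    have "T \<in> Rep_spec_open (INF g\<in>T. spec_prop g)" if "T \<in> Rep_spec_open U" for T
    proof -
      have T: "finite T" "T \<subseteq> spec_symbols" using in_Rep_spec_open[OF that] by auto
      have "T \<in> spec_hull {{g}}" if "g \<in> T" for g
        by (rule theory_openD(2)[OF theory_open_hull theory_hull_incl[of "{g}"]]) (use T that in auto)
      then show ?thesis using T by (auto simp: Rep_spec_simps Rep_prop)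
    qed
    then have "Rep_spec_open U \<subseteq> (\<Union>V\<in>(\<lambda>T. INF g\<in>T. spec_prop g) ` Rep_spec_open U. Rep_spec_open V)"
      by blast
    then show "U \<le> (SUP T\<in>Rep_spec_open U. INF g\<in>T. spec_prop g)"
      unfolding less_eq_spec_open_def Rep_spec_simps(3) by (rule Rep_sub_hull)
    show "(SUP T\<in>Rep_spec_open U. INF g\<in>T. spec_prop g) \<le> U"
    proof (rule SUP_least)
      fix T assume TU: "T \<in> Rep_spec_open U"
      have "S \<in> Rep_spec_open U" if S: "S \<in> Rep_spec_open (INF g\<in>T. spec_prop g)" for S
      proof -
        have S': "finite S" "S \<subseteq> spec_symbols" using in_Rep_spec_open[OF S] by auto
        have T: "finite T" "T \<subseteq> spec_symbols" using in_Rep_spec_open[OF TU] by auto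
        have *: "S \<in> spec_hull {{g}}" if "g \<in> T" for g
          using S that by (auto simp: Rep_spec_simps Rep_prop)
        have "S \<union> (T - T') \<in> Rep_spec_open U" if "finite T'" "T' \<subseteq> T" for T'
          using that
        proof (induction T')
          case empty
          show ?case by (rule theory_openD(2)[OF theory_open_Rep TU]) (use S' T in auto)
        next
          case (insert g T')
          let ?R = "S \<union> (T - insert g T')"
          let ?V = "{Q. finite Q \<and> Q \<subseteq> spec_symbols \<and> Q \<union> ?R \<in> Rep_spec_open U}"
          have fin: "finite ?R" "?R \<subseteq> spec_symbols" using S' T by auto
          have "theory_open spec_symbols spec_axiom ?V"
          proof (rule theory_openI, goal_cases)
            case (1 Q)
            then show ?case by simp
          next
            case (2 Q Q')
            have "Q' \<union> ?R \<in> Rep_spec_open U"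
              by (rule theory_openD(2)[OF theory_open_Rep, of "Q \<union> ?R"]) (use 2 fin in auto)
            with 2 show ?case by simp
          next
            case (3 Q \<S> Q')
            have "Q' \<union> ?R \<in> Rep_spec_open U"
              by (rule theory_openD(3)[OF theory_open_Rep 3(1)]) (use 3 fin in \<open>auto simp: Un_assoc\<close>)
            with 3 show ?case by simp
          qed
          moreover have "insert g (S \<union> (T - insert g T')) = S \<union> (T - T')"
            using insert by auto
          then have "{Q \<in> {{g}}. finite Q \<and> Q \<subseteq> spec_symbols} \<subseteq> ?V"
            using insert by auto
          ultimately have "spec_hull {{g}} \<subseteq> ?V" by (rule theory_hull_least)
          then have "S \<union> ?R \<in> Rep_spec_open U" using * insert.prems by blast
          then show ?case by (simp add: Un_assoc[symmetric])
        qed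
        from this[of T] T show ?thesis by simp
      qed
      then show "(INF g\<in>T. spec_prop g) \<le> U" by (auto simp: less_eq_spec_open_def)
    qed
  qed
  have uniq: "k = h" if k: "frame_hom k" "\<And>g. g \<in> spec_symbols \<Longrightarrow> k (spec_prop g) = f g" for k
  proof
    fix U
    have "k U = k (SUP T\<in>Rep_spec_open U. INF g\<in>T. spec_prop g)" by (subst decomp) simp
    also have "\<dots> = (SUP T\<in>Rep_spec_open U. k (INF g\<in>T. spec_prop g))"
      using k(1) by (simp add: frame_hom_def image_image)
    also have "\<dots> = h U"
      unfolding h_def
    proof (rule SUP_cong[OF HOL.refl])
      fix T assume "T \<in> Rep_spec_open U"
      then have T: "finite T" "T \<subseteq> spec_symbols" using in_Rep_spec_open by auto
      have "k (INF g\<in>T. spec_prop g) = (INF g\<in>T. k (spec_prop g))"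
        by (rule frame_hom_INF[OF k(1) T(1)])
      also have "\<dots> = (INF g\<in>T. f g)" by (rule INF_cong) (use T k(2) in auto)
      finally show "k (INF g\<in>T. spec_prop g) = (INF g\<in>T. f g)" .
    qed
    finally show "k U = h U" .
  qed
  show ?thesis using hom gens uniq by blast
qed


section \<open>Families of rounded ideals\<close>

definition open_of_family ::
  "('a::unital_cstar_algebra set \<Rightarrow> 'a lat_term set set) \<Rightarrow> 'a spec_open" where
  "open_of_family U = (SUP C\<in>\<C>. SUP a\<in>U C. spec_prop (InFilter C a))"

definition ideal_families :: "('a::unital_cstar_algebra set \<Rightarrow> 'a lat_term set set) set" where
  "ideal_families = {U \<in> \<Pi>\<^sub>E C\<in>\<C>. {I. rounded_ideal (\<L> C) I}.
     \<forall>C\<in>\<C>. \<forall>D\<in>\<C>. C \<subseteq> D \<longrightarrow> lat_map D ` U C \<subseteq> U D}"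

text \<open>The point of the exponential given by an open \<open>u\<close> of \<open>X\<close>.\<close>

definition point_of_open :: "'x::frame \<Rightarrow> 'x scott_open \<Rightarrow> bool" where
  "point_of_open u V \<longleftrightarrow> u \<in> Rep_scott_open V"

text \<open>
  The same notions interpreted in sheaves over a locale \<open>W\<close>: a subsheaf of the constant sheaf on a
  set \<open>X\<close> is a function from \<open>X\<close> to the frame of \<open>W\<close>.
\<close>

definition rounded_ideal_over :: "'b gorder \<Rightarrow> ('b \<Rightarrow> 'w::frame) \<Rightarrow> bool" where
  "rounded_ideal_over L I \<longleftrightarrow> I \<bottom>\<^bsub>L\<^esub> = Orderings.top \<and>
     (\<forall>a\<in>carrier L. \<forall>b\<in>carrier L. a \<sqsubseteq>\<^bsub>L\<^esub> b \<longrightarrow> I b \<le> I a) \<and>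
     (\<forall>a\<in>carrier L. \<forall>b\<in>carrier L. inf (I a) (I b) \<le> I (a \<squnion>\<^bsub>L\<^esub> b)) \<and>
     (\<forall>a\<in>carrier L. I a \<le> (SUP b\<in>{b. well_inside L a b}. I b))"

definition ideal_families_over ::
  "('a::unital_cstar_algebra set \<Rightarrow> 'a lat_term set \<Rightarrow> 'w::frame) set" where
  "ideal_families_over = {U \<in> \<Pi>\<^sub>E C\<in>\<C>. {I \<in> carrier (\<L> C) \<rightarrow>\<^sub>E UNIV. rounded_ideal_over (\<L> C) I}.
     \<forall>C\<in>\<C>. \<forall>D\<in>\<C>. C \<subseteq> D \<longrightarrow> (\<forall>a\<in>carrier (\<L> C). U C a \<le> U D (lat_map D a))}"

text \<open>
  The map from \<open>W\<close> to the exponential given by a family: the open \<open>\<Or>\<^bsub>C, a\<^esub> U\<^sub>C(a) \<and> InFilter C a\<close> of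
  \<open>W \<times> X\<close> lies in the Scott open \<open>V\<close> to the extent that \<open>V\<close> contains the join of finitely many
  \<open>InFilter C a\<close> for which \<open>a \<in> U\<^sub>C\<close> holds.
\<close>

definition point_of_family_over ::
  "('a::unital_cstar_algebra set \<Rightarrow> 'a lat_term set \<Rightarrow> 'w::frame) \<Rightarrow> 'a spec_open scott_open \<Rightarrow> 'w"
  where
  "point_of_family_over U V =
     (SUP F\<in>{F. finite F \<and> F \<subseteq> (SIGMA C:\<C>. carrier (\<L> C)) \<and>
                (SUP (C, a)\<in>F. spec_prop (InFilter C a)) \<in> Rep_scott_open V}.
        INF (C, a)\<in>F. U C a)"

end

theory Submission
  imports Defs
begin

text \<open>
  Sending \<open>D(a)\<close> to the ideal generated by all \<open>D(a - r)\<close>, \<open>r > 0\<close>, respects the relations of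
  \<open>L\<^sub>C\<close>; for the multiplicative relation this uses that \<open>r - a\<close> is a square when \<open>\<parallel>a\<parallel> < r\<close>. Hence a
  witness for \<open>s\<close> being well inside \<open>t\<close> still works after every generator of \<open>t\<close> has been lowered by
  a small \<open>r\<close>, and so the well-inside relation interpolates and splits along joins.

  Write \<open>e(C, a)\<close> for the open \<open>InFilter C a\<close>. These opens form a basis. Given a family \<open>V\<close> of ideals
  that is closed under the transition maps, call a finite conjunction of symbols good if at every
  later stage \<open>E\<close> all elements well inside a lower bound of the conjunction lie in \<open>V\<^sub>E\<close>. Good
  conjunctions form an open, which contains \<open>e(D, d)\<close> for every \<open>d \<in> V\<^sub>D\<close>. So if \<open>a\<close> is well inside \<open>b\<close>
  and \<open>e(C, b) \<le> \<Or>{e(D, d) | d \<in> V\<^sub>D}\<close>, then \<open>a \<in> V\<^sub>C\<close>. This gives that \<open>e(C, a)\<close> is way below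
  \<open>e(C, b)\<close>, hence local compactness, and that opens correspond to families of rounded ideals. A point
  \<open>p\<close> of the exponential is recovered from its values at the Scott opens of all \<open>u\<close> such that
  \<open>e(C, b) \<le> u\<close> for some \<open>b\<close> with \<open>a\<close> well inside \<open>b\<close>.
\<close>

section \<open>Square roots in commutative C*-algebras\<close>

lemma comm_subalgsD:
  assumes "C \<in> \<C>"
  shows "1 \<in> C" "closed C" "a \<in> C \<Longrightarrow> b \<in> C \<Longrightarrow> a + b \<in> C" "a \<in> C \<Longrightarrow> b \<in> C \<Longrightarrow> a * b \<in> C"
    "a \<in> C \<Longrightarrow> b \<in> C \<Longrightarrow> a * b = b * a" "a \<in> C \<Longrightarrow> c *\<^sub>C a \<in> C" "a \<in> C \<Longrightarrow> adj a \<in> C"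
    "a \<in> C \<Longrightarrow> r *\<^sub>R a \<in> C"
  using assms unfolding comm_subalgs_def scaleC_of_real[symmetric] by blast+

lemma adj_one: "adj (1::'a::unital_cstar_algebra) = 1"
  by (metis adj_adj adj_mult mult_1_left mult_1_right)

lemma adj_scaleR: "adj (r *\<^sub>R x) = r *\<^sub>R adj (x::'a::unital_cstar_algebra)"
  by (simp add: adj_scaleC flip: scaleC_of_real)

lemma norm_one_le: "norm (1::'a::unital_cstar_algebra) \<le> 1"
  using norm_adj_mult[of "1::'a"] by (auto simp: adj_one power2_eq_square)

lemma norm_power_le: "norm (x ^ n) \<le> norm (x::'a::unital_cstar_algebra) ^ n"
proof (induction n)
  case (Suc n)
  have "norm (x ^ Suc n) \<le> norm x * norm (x ^ n)" by (simp add: norm_mult_ineq)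
  also have "\<dots> \<le> norm x * norm x ^ n" by (rule mult_left_mono[OF Suc norm_ge_zero])
  finally show ?case by simp
qed (simp add: norm_one_le)

lemma norm_le_norm_adj: "norm x \<le> norm (adj (x::'a::unital_cstar_algebra))"
proof (cases "norm x = 0")
  case False
  have "norm x * norm x \<le> norm (adj x) * norm x"
    using norm_adj_mult[of x] norm_mult_ineq[of "adj x" x] by (simp add: power2_eq_square)
  with False show ?thesis by simp
qed simp

lemma bounded_linear_adj: "bounded_linear (adj :: 'a::unital_cstar_algebra \<Rightarrow> 'a)"
proof (rule bounded_linear_intro)
  show "norm (adj x) \<le> norm x * 1" for x :: 'a
    using norm_le_norm_adj[of "adj x"] by (simp add: adj_adj)
qed (simp_all add: adj_add adj_scaleR)

lemma selfadj_closed: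
  assumes C: "C \<in> \<C>"
  shows "1 \<in> selfadj C" "a \<in> selfadj C \<Longrightarrow> r *\<^sub>R a \<in> selfadj C"
    "a \<in> selfadj C \<Longrightarrow> b \<in> selfadj C \<Longrightarrow> a + b \<in> selfadj C"
    "a \<in> selfadj C \<Longrightarrow> b \<in> selfadj C \<Longrightarrow> a * b \<in> selfadj C"
    "a \<in> selfadj C \<Longrightarrow> - a \<in> selfadj C" "0 \<in> selfadj C"
    "a \<in> selfadj C \<Longrightarrow> b \<in> selfadj C \<Longrightarrow> a - b \<in> selfadj C"
proof -
  note [simp] = selfadj_def adj_one adj_scaleR adj_add adj_mult
  show one: "1 \<in> selfadj C" using comm_subalgsD[OF C] by simp
  show scale: "a \<in> selfadj C \<Longrightarrow> r *\<^sub>R a \<in> selfadj C" for r a using comm_subalgsD[OF C] by simp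
  show add: "a \<in> selfadj C \<Longrightarrow> b \<in> selfadj C \<Longrightarrow> a + b \<in> selfadj C" for a b
    using comm_subalgsD[OF C] by simp
  show "a \<in> selfadj C \<Longrightarrow> b \<in> selfadj C \<Longrightarrow> a * b \<in> selfadj C"
    using comm_subalgsD[OF C] by simp
  show minus: "a \<in> selfadj C \<Longrightarrow> - a \<in> selfadj C" for a using scale[of a "-1"] by simp
  show "0 \<in> selfadj C" using scale[OF one, of 0] by simp
  show "a \<in> selfadj C \<Longrightarrow> b \<in> selfadj C \<Longrightarrow> a - b \<in> selfadj C"
    using add[OF _ minus, of a b] by simp
qed

lemma selfadj_commute: "C \<in> \<C> \<Longrightarrow> a \<in> selfadj C \<Longrightarrow> b \<in> selfadj C \<Longrightarrow> a * b = b * a"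
  using comm_subalgsD(5) by (auto simp: selfadj_def)

lemma abs_gbinomial_half_le: "\<bar>(1/2 :: real) gchoose n\<bar> \<le> 1"
proof (induction n)
  case (Suc n)
  have "((1/2 :: real) gchoose Suc n) = (1/2 gchoose n) * ((1/2 - real n) / (real n + 1))"
    by (simp add: gbinomial_prod_rev atLeast0LessThan field_simps)
  moreover have "\<bar>(1/2 - real n) / (real n + 1)\<bar> \<le> 1" by (simp add: abs_le_iff divide_simps)
  ultimately show ?case using Suc by (metis abs_ge_zero abs_mult mult_le_one)
qed simp

text \<open>The square root of \<open>1 - x\<close> is its binomial series, whose Cauchy square is given by
  Vandermonde's identity.\<close>

lemma sqrt_one_minus:
  assumes C: "C \<in> \<C>" and x: "x \<in> selfadj C" "norm x < 1"
  shows "\<exists>c\<in>selfadj C. 1 - x = c * c"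
proof -
  define f where "f n = ((1/2 gchoose n) * (- 1) ^ n) *\<^sub>R x ^ n" for n
  have norm_f: "norm (f n) \<le> norm x ^ n" for n
  proof -
    have "norm (f n) \<le> 1 * norm (x ^ n)"
      unfolding f_def using abs_gbinomial_half_le[of n] by (simp add: abs_mult mult_left_le_one_le)
    then show ?thesis using norm_power_le[of x n] by simp
  qed
  have summ: "summable (\<lambda>n. norm (f n))"
    by (rule summable_comparison_test'[OF summable_geometric[of "norm x"]]) (use x(2) norm_f in simp_all)
  have "x ^ n \<in> selfadj C" for n by (induction n) (simp_all add: selfadj_closed[OF C] x)
  then have f_sa: "f n \<in> selfadj C" for n by (simp add: f_def selfadj_closed[OF C])
  define c where "c = suminf f"
  have sums: "f sums c" unfolding c_def by (rule summable_sums[OF summable_norm_cancel[OF summ]])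
  have "sum f {..<n} \<in> selfadj C" for n
    by (induction n) (simp_all add: selfadj_closed[OF C] f_sa)
  then have "c \<in> C"
    by (intro closed_sequentially[OF comm_subalgsD(2)[OF C] _ sums[unfolded sums_def]])
      (simp add: selfadj_def)
  moreover have "adj c = c"
    using bounded_linear.sums[OF bounded_linear_adj sums] f_sa sums
    by (simp add: selfadj_def sums_iff)
  ultimately have "c \<in> selfadj C" by (simp add: selfadj_def)
  moreover have "c * c = 1 - x"
  proof (rule sums_unique2)
    show "(\<lambda>k. \<Sum>i\<le>k. f i * f (k - i)) sums (c * c)"
      unfolding c_def by (rule Cauchy_product_sums[OF summ summ])
    have "(\<Sum>i\<le>k. f i * f (k - i)) = ((1 gchoose k) * (- 1) ^ k) *\<^sub>R x ^ k" for k
    proof -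
      have "(\<Sum>i\<le>k. f i * f (k - i)) =
          (\<Sum>i\<le>k. ((1/2 gchoose i) * (1/2 gchoose (k - i)) * (- 1) ^ k) *\<^sub>R x ^ k)"
        unfolding f_def
      proof (rule sum.cong)
        fix i assume "i \<in> {..k}"
        then have "k = i + (k - i)" by simp
        then have "x ^ k = x ^ i * x ^ (k - i)" "(- 1) ^ k = (- 1 :: real) ^ i * (- 1) ^ (k - i)"
          by (metis power_add)+
        then show "(((1/2 gchoose i) * (- 1) ^ i) *\<^sub>R x ^ i) *
            (((1/2 gchoose (k - i)) * (- 1) ^ (k - i)) *\<^sub>R x ^ (k - i)) =
            ((1/2 gchoose i) * (1/2 gchoose (k - i)) * (- 1) ^ k) *\<^sub>R x ^ k"
          by (simp add: mult.left_commute mult.commute mult.assoc)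
      qed simp
      also have "\<dots> = ((\<Sum>i\<le>k. (1/2 gchoose i) * (1/2 gchoose (k - i))) * (- 1) ^ k) *\<^sub>R x ^ k"
        by (simp add: scaleR_sum_left sum_distrib_right)
      also have "(\<Sum>i\<le>k. (1/2 gchoose i) * (1/2 gchoose (k - i))) = (1 :: real) gchoose k"
        using gbinomial_Vandermonde[of "1/2 :: real" "1/2" k] by (simp add: atLeast0AtMost)
      finally show ?thesis .
    qed
    moreover have "(\<lambda>k. ((1 gchoose k) * (- 1) ^ k) *\<^sub>R x ^ k) sums
        (\<Sum>k\<in>{0, 1}. (((1 :: real) gchoose k) * (- 1) ^ k) *\<^sub>R x ^ k)"
    proof (rule sums_finite)
      fix k :: nat assume "k \<notin> {0, 1}"
      then have "1 choose k = 0" by (simp add: binomial_eq_0)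
      then have "(1 :: real) gchoose k = 0" by (metis binomial_gbinomial of_nat_0 of_nat_1)
      then show "(((1 :: real) gchoose k) * (- 1) ^ k) *\<^sub>R x ^ k = 0" by simp
    qed simp
    ultimately show "(\<lambda>k. \<Sum>i\<le>k. f i * f (k - i)) sums (1 - x)" by simp
  qed
  ultimately show ?thesis by metis
qed

lemma sqrt_scaleR_one_minus:
  assumes C: "C \<in> \<C>" and x: "x \<in> selfadj C" "norm x < r"
  shows "\<exists>c\<in>selfadj C. r *\<^sub>R 1 - x = c * c"
proof -
  have r: "r > 0" using x(2) norm_ge_zero[of x] by linarith
  obtain d where d: "d \<in> selfadj C" "1 - (1 / r) *\<^sub>R x = d * d"
    using sqrt_one_minus[OF C, of "(1 / r) *\<^sub>R x"] x r selfadj_closed(2)[OF C] by auto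
  have "r *\<^sub>R 1 - x = r *\<^sub>R (d * d)" unfolding d(2)[symmetric] using r by (simp add: scaleR_diff_right)
  also have "\<dots> = (sqrt r *\<^sub>R d) * (sqrt r *\<^sub>R d)" using r by simp
  finally show ?thesis using selfadj_closed(2)[OF C d(1)] by blast
qed

section \<open>Calculus in presented lattices\<close>

lemmas [trans] = term_le.trans

lemma term_le_join_mono: "term_le R s s' \<Longrightarrow> term_le R t t' \<Longrightarrow> term_le R (Join s t) (Join s' t')"
  by (meson term_le.intros)

lemma term_le_meet_mono: "term_le R s s' \<Longrightarrow> term_le R t t' \<Longrightarrow> term_le R (Meet s t) (Meet s' t')"
  by (meson term_le.intros)

lemma term_le_joinI1: "term_le R u s \<Longrightarrow> term_le R u (Join s t)"
  by (meson term_le.intros)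

lemma term_le_joinI2: "term_le R u t \<Longrightarrow> term_le R u (Join s t)"
  by (meson term_le.intros)

lemma term_le_meetI1: "term_le R s u \<Longrightarrow> term_le R (Meet s t) u"
  by (meson term_le.intros)

lemma term_le_meetI2: "term_le R t u \<Longrightarrow> term_le R (Meet s t) u"
  by (meson term_le.intros)

lemma term_le_split:
  assumes "term_le R u (Join s t)" "term_le R (Meet u s) v" "term_le R (Meet u t) v"
  shows "term_le R u v"
proof -
  have "term_le R u (Meet u (Join s t))" by (intro term_le.meet term_le.refl assms)
  also have "term_le R \<dots> (Join (Meet u s) (Meet u t))" by (rule term_le.distrib)
  also have "term_le R \<dots> v" by (intro term_le.join assms)
  finally show ?thesis .
qed

lemma term_le_join_bot: "term_le R u (Join s t) \<Longrightarrow> term_le R t Bot \<Longrightarrow> term_le R u s"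
  by (erule term_le_split) (meson term_le.intros)+

lemma term_le_join_meet:
  assumes "term_le R u (Join s t)" "term_le R u (Join s t')"
  shows "term_le R u (Join s (Meet t t'))"
proof (rule term_le_split[OF assms(1)])
  show "term_le R (Meet u s) (Join s (Meet t t'))" by (intro term_le_joinI1 term_le.meet2)
  show "term_le R (Meet u t) (Join s (Meet t t'))"
  proof (rule term_le_split)
    show "term_le R (Meet u t) (Join s t')" by (rule term_le_meetI1[OF assms(2)])
    show "term_le R (Meet (Meet u t) s) (Join s (Meet t t'))"
      by (intro term_le_joinI1 term_le.meet2)
    show "term_le R (Meet (Meet u t) t') (Join s (Meet t t'))"
      by (intro term_le_joinI2 term_le_meet_mono term_le.meet2 term_le.refl)
  qed
qed

lemma term_le_join_commute: "term_le R u (Join s t) \<Longrightarrow> term_le R u (Join t s)"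
  by (meson term_le.intros)

lemma term_le_join_of_meets:
  assumes "term_le R u (Join s s')" "term_le R u (Join s t')" "term_le R u (Join t s')"
    "term_le R u (Join t t')"
  shows "term_le R u (Join (Meet s t) (Meet s' t'))"
proof -
  have "term_le R u (Join (Meet s' t') (Meet s t))"
    by (intro term_le_join_meet term_le_join_commute[OF term_le_join_meet] assms)
  then show ?thesis by (rule term_le_join_commute)
qed

lemma term_le_subset: "term_le R s t \<Longrightarrow> R \<subseteq> R' \<Longrightarrow> term_le R' s t"
  by (induction rule: term_le.induct) (blast intro: term_le.intros)+


section \<open>Positivity in the lattice of a commutative C*-algebra\<close>

context
  fixes C :: "'a::unital_cstar_algebra set"
  assumes C: "C \<in> \<C>"
begin

abbreviation spec_le (infix \<open>\<preceq>\<close> 50) where "s \<preceq> t \<equiv> term_le (spec_rels C) s t"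

lemmas sa_closed = selfadj_closed[OF C]

lemma spec_le_pos_neg: "a \<in> selfadj C \<Longrightarrow> Meet (Gen a) (Gen (- a)) \<preceq> Bot"
  by (rule term_le.rel) (auto simp: spec_rels_def)

lemma spec_le_nonpos: "a \<in> selfadj C \<Longrightarrow> c \<in> selfadj C \<Longrightarrow> - a = c * c \<Longrightarrow> Gen a \<preceq> Bot"
  by (rule term_le.rel) (auto simp: spec_rels_def sa_le_def)

lemma spec_le_add: "a \<in> selfadj C \<Longrightarrow> b \<in> selfadj C \<Longrightarrow> Gen (a + b) \<preceq> Join (Gen a) (Gen b)"
  by (rule term_le.rel) (unfold spec_rels_def, blast)

lemma spec_le_one: "Top \<preceq> Gen 1"
  by (rule term_le.rel) (simp add: spec_rels_def)

lemma spec_le_mult: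
  assumes "a \<in> selfadj C" "b \<in> selfadj C"
  shows "Gen (a * b) \<preceq> Join (Meet (Gen a) (Gen b)) (Meet (Gen (- a)) (Gen (- b)))"
    "Join (Meet (Gen a) (Gen b)) (Meet (Gen (- a)) (Gen (- b))) \<preceq> Gen (a * b)"
  by (rule term_le.rel; unfold spec_rels_def; use assms in blast)+

lemma spec_le_mult_meet: "a \<in> selfadj C \<Longrightarrow> b \<in> selfadj C \<Longrightarrow> Meet (Gen a) (Gen b) \<preceq> Gen (a * b)"
  by (rule term_le.trans[OF term_le.join1 spec_le_mult(2)])

lemma spec_le_mult_join:
  assumes "a \<in> selfadj C" "b \<in> selfadj C"
  shows "Gen (a * b) \<preceq> Join (Gen a) (Gen (- b))"
proof -
  have "Gen (a * b) \<preceq> Join (Meet (Gen a) (Gen b)) (Meet (Gen (- a)) (Gen (- b)))"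
    by (rule spec_le_mult(1)[OF assms])
  also have "\<dots> \<preceq> Join (Gen a) (Gen (- b))"
    by (intro term_le_join_mono term_le.meet1 term_le.meet2)
  finally show ?thesis .
qed

lemma spec_le_neg_bound:
  assumes "a \<in> selfadj C" "norm a < r"
  shows "Gen (a - r *\<^sub>R 1) \<preceq> Bot"
proof -
  obtain c where "c \<in> selfadj C" "r *\<^sub>R 1 - a = c * c"
    using sqrt_scaleR_one_minus[OF C assms] by blast
  then show ?thesis by (intro spec_le_nonpos[of _ c]) (use assms sa_closed in auto)
qed

lemma spec_le_mono:
  assumes "a \<in> selfadj C" "b \<in> selfadj C" "c \<in> selfadj C" "b - a = c * c"
  shows "Gen a \<preceq> Gen b"
proof (rule term_le_join_bot)
  show "Gen a \<preceq> Join (Gen b) (Gen (a - b))"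
    using spec_le_add[of b "a - b"] assms sa_closed by simp
  show "Gen (a - b) \<preceq> Bot"
    using spec_le_nonpos[of "a - b" c] assms sa_closed by simp
qed

lemma spec_le_diff_const:
  assumes "a \<in> selfadj C" "q \<le> r"
  shows "Gen (a - r *\<^sub>R 1) \<preceq> Gen (a - q *\<^sub>R 1)"
  by (rule spec_le_mono[of _ _ "sqrt (r - q) *\<^sub>R 1"])
    (use assms sa_closed in \<open>simp_all add: scaleR_diff_left\<close>)

lemma spec_le_const:
  assumes "r > 0"
  shows "Top \<preceq> Gen (r *\<^sub>R 1)"
proof -
  have "Top \<preceq> Gen ((r *\<^sub>R 1) * ((1 / r) *\<^sub>R 1))" using assms spec_le_one by simp
  also have "\<dots> \<preceq> Join (Gen (r *\<^sub>R 1)) (Gen (- ((1 / r) *\<^sub>R 1)))"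
    by (intro spec_le_mult_join sa_closed)
  finally show ?thesis
  proof (rule term_le_join_bot)
    show "Gen (- ((1 / r) *\<^sub>R 1)) \<preceq> Bot"
      by (rule spec_le_nonpos[of _ "sqrt (1 / r) *\<^sub>R 1"]) (use assms sa_closed in simp_all)
  qed
qed

lemma spec_le_scaleR:
  assumes "r > 0" "a \<in> selfadj C"
  shows "Gen a \<preceq> Gen (r *\<^sub>R a)"
proof -
  have "Gen a \<preceq> Meet (Gen (r *\<^sub>R 1)) (Gen a)"
    using assms spec_le_const by (meson term_le.intros)
  also have "\<dots> \<preceq> Gen (r *\<^sub>R 1 * a)"
    by (intro spec_le_mult_meet sa_closed assms)
  finally show ?thesis by simp
qed

lemma spec_le_add_meet:
  assumes "a \<in> selfadj C" "b \<in> selfadj C"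
  shows "Meet (Gen a) (Gen b) \<preceq> Gen (a + b)"
proof (rule term_le_join_bot)
  show "Meet (Gen a) (Gen b) \<preceq> Join (Gen (a + b)) (Meet (Gen (- b)) (Gen b))"
  proof (rule term_le_join_meet)
    show "Meet (Gen a) (Gen b) \<preceq> Join (Gen (a + b)) (Gen (- b))"
      using spec_le_add[of "a + b" "- b"] assms sa_closed by (intro term_le_meetI1) simp
    show "Meet (Gen a) (Gen b) \<preceq> Join (Gen (a + b)) (Gen b)"
      by (intro term_le_joinI2 term_le.meet2)
  qed
  show "Meet (Gen (- b)) (Gen b) \<preceq> Bot"
    using spec_le_pos_neg[of "- b"] assms sa_closed by simp
qed

lemma spec_le_mult_diff_join:
  assumes a: "a \<in> selfadj C" and b: "b \<in> selfadj C" and s: "s > 0" and M: "norm b < M" "s * M \<le> r"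
  shows "Gen (a * b - r *\<^sub>R 1) \<preceq> Join (Gen (a - s *\<^sub>R 1)) (Gen (- a - s *\<^sub>R 1))"
proof -
  have *: "Gen ((a' - s *\<^sub>R 1) * (b' + M *\<^sub>R 1)) \<preceq> Gen (a' - s *\<^sub>R 1)"
    if "a' \<in> selfadj C" "b' \<in> selfadj C" "norm b' < M" for a' b'
  proof (rule term_le_join_bot[OF spec_le_mult_join])
    show "Gen (- (b' + M *\<^sub>R 1)) \<preceq> Bot"
      using spec_le_neg_bound[of "- b'" M] that sa_closed by simp
  qed (use that sa_closed in simp_all)
  have "Gen (a * b - r *\<^sub>R 1) \<preceq> Gen (a * b - (s * M) *\<^sub>R 1)"
    using a b M(2) sa_closed by (intro spec_le_diff_const)
  also have "\<dots> \<preceq> Gen (2 *\<^sub>R (a * b - (s * M) *\<^sub>R 1))"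
    using a b sa_closed by (intro spec_le_scaleR) simp_all
  also have "2 *\<^sub>R (a * b - (s * M) *\<^sub>R 1) =
      (a - s *\<^sub>R 1) * (b + M *\<^sub>R 1) + (- a - s *\<^sub>R 1) * (- b + M *\<^sub>R 1)"
    by (simp add: algebra_simps scaleR_2 flip: scaleR_left.add)
  also have "Gen \<dots> \<preceq> Join (Gen ((a - s *\<^sub>R 1) * (b + M *\<^sub>R 1)))
      (Gen ((- a - s *\<^sub>R 1) * (- b + M *\<^sub>R 1)))"
    by (intro spec_le_add sa_closed a b)
  also have "\<dots> \<preceq> Join (Gen (a - s *\<^sub>R 1)) (Gen (- a - s *\<^sub>R 1))"
    using a b M(1) sa_closed by (intro term_le_join_mono *) simp_all
  finally show ?thesis .
qed

lemma spec_le_mult_diff_join_neg: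
  assumes a: "a \<in> selfadj C" and b: "b \<in> selfadj C"
    and s: "0 < s" "s \<le> 1" and r: "s * (1 + norm a + norm b) < r"
  shows "Gen (a * b - r *\<^sub>R 1) \<preceq> Join (Gen (a - s *\<^sub>R 1)) (Gen (- b - s *\<^sub>R 1))"
proof -
  let ?c = "s *\<^sub>R (s *\<^sub>R 1 + (b - a))"
  have "norm (s *\<^sub>R 1 + (b - a)) \<le> norm (s *\<^sub>R (1::'a)) + (norm b + norm a)"
    by (meson add_left_mono norm_triangle_ineq norm_triangle_ineq4 order_trans)
  also have "norm (s *\<^sub>R (1::'a)) \<le> 1" using s norm_one_le[where 'a = 'a] mult_le_one[of s "norm (1::'a)"] by simp
  finally have "norm ?c \<le> s * (1 + norm a + norm b)" using s by simp
  then have c: "norm ?c < r" using r by linarith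
  have "a * b - r *\<^sub>R 1 = (a - s *\<^sub>R 1) * (b + s *\<^sub>R 1) + (?c - r *\<^sub>R 1)"
    by (simp add: algebra_simps)
  also have "Gen \<dots> \<preceq> Join (Gen ((a - s *\<^sub>R 1) * (b + s *\<^sub>R 1))) (Gen (?c - r *\<^sub>R 1))"
    by (intro spec_le_add sa_closed a b)
  finally have "Gen (a * b - r *\<^sub>R 1) \<preceq> Gen ((a - s *\<^sub>R 1) * (b + s *\<^sub>R 1))"
    by (rule term_le_join_bot) (intro spec_le_neg_bound sa_closed a b c)
  also have "\<dots> \<preceq> Join (Gen (a - s *\<^sub>R 1)) (Gen (- (b + s *\<^sub>R 1)))"
    by (intro spec_le_mult_join sa_closed a b)
  finally show ?thesis by simp
qed

lemma spec_le_mult_diff: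
  assumes a: "a \<in> selfadj C" and b: "b \<in> selfadj C" and r: "r > 0"
  shows "\<exists>s>0. Gen (a * b - r *\<^sub>R 1) \<preceq>
    Join (Meet (Gen (a - s *\<^sub>R 1)) (Gen (b - s *\<^sub>R 1)))
      (Meet (Gen (- a - s *\<^sub>R 1)) (Gen (- b - s *\<^sub>R 1)))"
proof -
  define M where "M = 1 + norm a + norm b"
  have M: "1 \<le> M" "norm a < M" "norm b < M"
    using norm_ge_zero[of a] norm_ge_zero[of b] by (auto simp: M_def simp del: norm_ge_zero)
  define s where "s = min 1 (r / (2 * M))"
  have s: "0 < s" "s \<le> 1" using r M by (auto simp: s_def)
  have "s * M \<le> r / (2 * M) * M" using M by (intro mult_right_mono) (auto simp: s_def)
  then have sM: "s * M < r" using r M by simp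
  have ab: "a * b = b * a" by (rule selfadj_commute[OF C a b])
  have "Gen (a * b - r *\<^sub>R 1) \<preceq>
    Join (Meet (Gen (a - s *\<^sub>R 1)) (Gen (b - s *\<^sub>R 1)))
      (Meet (Gen (- a - s *\<^sub>R 1)) (Gen (- b - s *\<^sub>R 1)))"
    using spec_le_mult_diff_join[OF a b s(1) M(3), of r] spec_le_mult_diff_join[OF b a s(1) M(2), of r]
      spec_le_mult_diff_join_neg[OF a b s, of r] spec_le_mult_diff_join_neg[OF b a s, of r] sM
    by (intro term_le_join_of_meets) (simp_all add: ab M_def add.commute add.left_commute)
  with s show ?thesis by blast
qed

lemma spec_le_meet_mult_diff:
  assumes a: "a \<in> selfadj C" and b: "b \<in> selfadj C" and s: "s > 0"
  shows "Meet (Gen (a - s *\<^sub>R 1)) (Gen (b - s *\<^sub>R 1)) \<preceq> Gen (a * b - (s * s) *\<^sub>R 1)"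
proof -
  let ?a = "a - s *\<^sub>R 1" and ?b = "b - s *\<^sub>R 1"
  have sa: "?a \<in> selfadj C" "?b \<in> selfadj C" using a b sa_closed by simp_all
  have "Meet (Gen ?a) (Gen ?b) \<preceq> Meet (Gen (?a * ?b)) (Gen (?a + ?b))"
    by (intro term_le.meet spec_le_mult_meet spec_le_add_meet sa)
  also have "\<dots> \<preceq> Meet (Gen (?a * ?b)) (Gen (s *\<^sub>R (?a + ?b)))"
    using s sa sa_closed by (intro term_le_meet_mono term_le.refl spec_le_scaleR) simp_all
  also have "\<dots> \<preceq> Gen (?a * ?b + s *\<^sub>R (?a + ?b))"
    using sa sa_closed by (intro spec_le_add_meet) simp_all
  also have "?a * ?b + s *\<^sub>R (?a + ?b) = a * b - (s * s) *\<^sub>R 1"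
    by (simp add: algebra_simps)
  finally show ?thesis .
qed

text \<open>The terms \<open>shrink r t\<close>, \<open>r > 0\<close>, generate the ideal assigned to \<open>t\<close>. Derivations may pass
  through generators outside \<open>C\<close>, which are sent to \<open>\<bottom>\<close>.\<close>

primrec shrink :: "real \<Rightarrow> 'a lat_term \<Rightarrow> 'a lat_term" where
  "shrink r (Gen a) = (if a \<in> selfadj C then Gen (a - r *\<^sub>R 1) else Bot)"
| "shrink r Bot = Bot"
| "shrink r Top = Top"
| "shrink r (Meet s t) = Meet (shrink r s) (shrink r t)"
| "shrink r (Join s t) = Join (shrink r s) (shrink r t)"

lemma set_shrink: "set_lat_term (shrink r t) \<subseteq> selfadj C"
  by (induction t) (auto simp: sa_closed)

lemma shrink_antimono: "q \<le> r \<Longrightarrow> shrink r t \<preceq> shrink q t"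
  by (induction t) (auto intro: term_le_meet_mono term_le_join_mono term_le.refl spec_le_diff_const)

lemma shrink_rel:
  assumes st: "(s, t) \<in> spec_rels C" and r: "r > 0"
  shows "\<exists>q>0. shrink r s \<preceq> shrink q t"
  using st[unfolded spec_rels_def]
proof (elim UnE CollectE exE conjE insertE emptyE Pair_inject, goal_cases)
  case (1 a)
  have "Meet (Gen (a - r *\<^sub>R 1)) (Gen (- a - r *\<^sub>R 1)) \<preceq> Meet (Gen a) (Gen (- a))"
    using spec_le_diff_const[of a 0 r] spec_le_diff_const[of "- a" 0 r] 1 r sa_closed
    by (intro term_le_meet_mono) simp_all
  also have "\<dots> \<preceq> Bot" using 1 by (intro spec_le_pos_neg)
  finally show ?case using 1 sa_closed by (auto intro: exI[of _ 1])
next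
  case (2 a)
  have "Gen (a - r *\<^sub>R 1) \<preceq> Gen a"
    using spec_le_diff_const[of a 0 r] 2 r by simp
  also obtain c where "c \<in> selfadj C" "- a = c * c" using 2 by (auto simp: sa_le_def)
  then have "Gen a \<preceq> Bot" using 2 by (intro spec_le_nonpos)
  finally show ?case using 2 by (auto intro: exI[of _ 1])
next
  case (3 a b)
  have "a + b - r *\<^sub>R 1 = (a - (r / 2) *\<^sub>R 1) + (b - (r / 2) *\<^sub>R 1)"
    by (simp add: algebra_simps flip: scaleR_left.add)
  also have "Gen \<dots> \<preceq> Join (Gen (a - (r / 2) *\<^sub>R 1)) (Gen (b - (r / 2) *\<^sub>R 1))"
    using 3 sa_closed by (intro spec_le_add) simp_all
  finally show ?case using 3 sa_closed r by (intro exI[of _ "r / 2"]) simp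
next
  case 4
  have "(1 :: 'a) - (1 / 2) *\<^sub>R 1 = (1 / 2) *\<^sub>R 1"
    using scaleR_diff_left[of 1 "1 / 2" "1 :: 'a"] by simp
  then show ?case using 4 spec_le_const[of "1 / 2"] sa_closed by (intro exI[of _ "1 / 2"]) simp
next
  case (5 a b)
  then show ?case using spec_le_mult_diff[of a b r] r sa_closed by simp
next
  case (6 a b)
  have "Meet (Gen (- a - r *\<^sub>R 1)) (Gen (- b - r *\<^sub>R 1)) \<preceq> Gen (a * b - (r * r) *\<^sub>R 1)"
    using spec_le_meet_mult_diff[of "- a" "- b" r] 6 r sa_closed by simp
  then have "Join (Meet (Gen (a - r *\<^sub>R 1)) (Gen (b - r *\<^sub>R 1)))
      (Meet (Gen (- a - r *\<^sub>R 1)) (Gen (- b - r *\<^sub>R 1))) \<preceq> Gen (a * b - (r * r) *\<^sub>R 1)"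
    using spec_le_meet_mult_diff[of a b r] 6 r by (intro term_le.join)
  then show ?case using 6 r sa_closed by (intro exI[of _ "r * r"]) simp
qed

lemma shrink_le:
  assumes "s \<preceq> t" "r > 0"
  shows "\<exists>q>0. shrink r s \<preceq> shrink q t"
  using assms
proof (induction arbitrary: r rule: term_le.induct)
  case (rel s t)
  then show ?case by (rule shrink_rel)
next
  case (trans s t u)
  then show ?case by (meson term_le.trans)
next
  case (meet u s t)
  then obtain q q' where q: "q > 0" "q' > 0" "shrink r u \<preceq> shrink q s" "shrink r u \<preceq> shrink q' t"
    by meson
  have "shrink r u \<preceq> shrink (min q q') s" "shrink r u \<preceq> shrink (min q q') t"
    using term_le.trans[OF q(3) shrink_antimono] term_le.trans[OF q(4) shrink_antimono] by simp_all
  with q(1,2) show ?case by (intro exI[of _ "min q q'"]) (simp add: term_le.meet)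
next
  case (join s u t)
  then obtain q q' where q: "q > 0" "q' > 0" "shrink r s \<preceq> shrink q u" "shrink r t \<preceq> shrink q' u"
    by meson
  have "shrink r s \<preceq> shrink (min q q') u" "shrink r t \<preceq> shrink (min q q') u"
    using term_le.trans[OF q(3) shrink_antimono] term_le.trans[OF q(4) shrink_antimono] by simp_all
  with q(1,2) show ?case by (intro exI[of _ "min q q'"]) (simp add: term_le.join)
qed (auto intro: term_le.intros)

lemma shrink_below:
  assumes "set_lat_term t \<subseteq> selfadj C" "r > 0"
  shows "shrink r t \<preceq> t"
  using assms
proof (induction t)
  case (Gen a)
  then show ?case using spec_le_diff_const[of a 0 r] by simp
qed (auto intro: term_le_meet_mono term_le_join_mono term_le.refl)

lemma shrink_well_inside:
  assumes "set_lat_term t \<subseteq> selfadj C" "r > 0"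
  shows "\<exists>y. set_lat_term y \<subseteq> selfadj C \<and> Top \<preceq> Join t y \<and> Meet (shrink r t) y \<preceq> Bot"
  using assms
proof (induction t)
  case (Gen a)
  then have a: "a \<in> selfadj C" by simp
  let ?y = "r *\<^sub>R 1 - a"
  have y: "?y \<in> selfadj C" using a sa_closed by simp
  have "Top \<preceq> Join (Gen a) (Gen ?y)"
    using term_le.trans[OF spec_le_const[OF assms(2)]] spec_le_add[OF a y] by simp
  moreover have "Meet (Gen (a - r *\<^sub>R 1)) (Gen ?y) \<preceq> Bot"
    using spec_le_pos_neg[of "a - r *\<^sub>R 1"] a sa_closed by simp
  ultimately show ?case using a y by (intro exI[of _ "Gen ?y"]) simp
next
  case Bot
  then show ?case by (intro exI[of _ Top]) (auto intro: term_le.intros)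
next
  case Top
  then show ?case by (intro exI[of _ Bot]) (auto intro: term_le.intros)
next
  case (Meet s t)
  then obtain y z where y: "set_lat_term y \<subseteq> selfadj C" "Top \<preceq> Join s y" "Meet (shrink r s) y \<preceq> Bot"
    and z: "set_lat_term z \<subseteq> selfadj C" "Top \<preceq> Join t z" "Meet (shrink r t) z \<preceq> Bot" by auto
  have "Top \<preceq> Join (Join y z) (Meet s t)"
    using y(2) z(2) by (intro term_le_join_meet) (meson term_le.intros)+
  then have "Top \<preceq> Join (Meet s t) (Join y z)" by (rule term_le_join_commute)
  moreover have "Meet (Meet (shrink r s) (shrink r t)) (Join y z) \<preceq> Bot"
  proof (rule term_le_split[OF term_le.meet2])
    show "Meet (Meet (Meet (shrink r s) (shrink r t)) (Join y z)) y \<preceq> Bot"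
      by (rule term_le.trans[OF _ y(3)])
        (intro term_le_meet_mono term_le_meetI1 term_le.refl)
    show "Meet (Meet (Meet (shrink r s) (shrink r t)) (Join y z)) z \<preceq> Bot"
      by (rule term_le.trans[OF _ z(3)])
        (intro term_le_meet_mono term_le_meetI1 term_le.meet2 term_le.refl)
  qed
  ultimately show ?case using y(1) z(1) by (intro exI[of _ "Join y z"]) simp
next
  case (Join s t)
  then obtain y z where y: "set_lat_term y \<subseteq> selfadj C" "Top \<preceq> Join s y" "Meet (shrink r s) y \<preceq> Bot"
    and z: "set_lat_term z \<subseteq> selfadj C" "Top \<preceq> Join t z" "Meet (shrink r t) z \<preceq> Bot" by auto
  have "Top \<preceq> Join (Join s t) (Meet y z)"
    using y(2) z(2) by (intro term_le_join_meet) (meson term_le.intros)+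
  moreover have "Meet (Join (shrink r s) (shrink r t)) (Meet y z) \<preceq> Bot"
  proof (rule term_le_split[OF term_le.meet1])
    show "Meet (Meet (Join (shrink r s) (shrink r t)) (Meet y z)) (shrink r s) \<preceq> Bot"
      by (rule term_le.trans[OF _ y(3)])
        (intro term_le.meet term_le.meet2 term_le_meetI1[OF term_le_meetI2[OF term_le.meet1]])
    show "Meet (Meet (Join (shrink r s) (shrink r t)) (Meet y z)) (shrink r t) \<preceq> Bot"
      by (rule term_le.trans[OF _ z(3)])
        (intro term_le.meet term_le.meet2 term_le_meetI1[OF term_le_meetI2[OF term_le.meet2]])
  qed
  ultimately show ?case using y(1) z(1) by (intro exI[of _ "Meet y z"]) simp
qed

lemma well_inside_shrink:
  assumes "set_lat_term y \<subseteq> selfadj C" "Top \<preceq> Join t y" "Meet s y \<preceq> Bot"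
  shows "\<exists>q>0. Top \<preceq> Join (shrink q t) y"
proof -
  obtain q where q: "q > 0" "Top \<preceq> Join (shrink q t) (shrink q y)"
    using shrink_le[OF assms(2), of 1] by auto
  then show ?thesis
    using shrink_below[OF assms(1) q(1)] by (meson term_le.trans term_le_join_mono term_le.refl)
qed

end

section \<open>The lattices of a commutative C*-algebra and their transition maps\<close>

definition term_class :: "'g set \<Rightarrow> ('g lat_term \<times> 'g lat_term) set \<Rightarrow> 'g lat_term \<Rightarrow> 'g lat_term set"
  where "term_class G R t = term_eq G R `` {t}"

lemma equiv_term_eq: "equiv {t. set_lat_term t \<subseteq> G} (term_eq G R)"
proof (rule equivI)
  show "refl_on {t. set_lat_term t \<subseteq> G} (term_eq G R)"
    by (auto simp: refl_on_def term_eq_def intro: term_le.refl)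
  show "sym (term_eq G R)" by (auto simp: sym_def term_eq_def)
  show "trans (term_eq G R)" unfolding trans_def term_eq_def by (auto intro: term_le.trans)
qed (auto simp: term_eq_def)

lemma carrier_presented:
  "a \<in> carrier (presented_lattice G R) \<longleftrightarrow> (\<exists>t. set_lat_term t \<subseteq> G \<and> a = term_class G R t)"
  by (auto simp: presented_lattice_def quotient_def term_class_def)

lemma term_class_in_carrier: "set_lat_term t \<subseteq> G \<Longrightarrow> term_class G R t \<in> carrier (presented_lattice G R)"
  by (auto simp: carrier_presented)

lemma le_presented:
  assumes "set_lat_term s \<subseteq> G" "set_lat_term t \<subseteq> G"
  shows "term_class G R s \<sqsubseteq>\<^bsub>presented_lattice G R\<^esub> term_class G R t \<longleftrightarrow> term_le R s t"
  using assms unfolding presented_lattice_def term_class_def term_eq_def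
  by (auto intro: term_le.refl) (meson term_le.trans)

lemma term_class_eq_iff:
  assumes "set_lat_term s \<subseteq> G" "set_lat_term t \<subseteq> G"
  shows "term_class G R s = term_class G R t \<longleftrightarrow> term_le R s t \<and> term_le R t s"
  using eq_equiv_class_iff[OF equiv_term_eq, of s G t R] assms
  by (auto simp: term_class_def term_eq_def)

lemma eq_presented: "eq (presented_lattice G R) = (=)"
  by (simp add: presented_lattice_def)

lemma partial_order_presented: "partial_order (presented_lattice G R)"
proof
  fix x y z
  let ?L = "presented_lattice G R"
  show "x \<sqsubseteq>\<^bsub>?L\<^esub> x" if x: "x \<in> carrier ?L"
    using that by (auto simp: carrier_presented le_presented intro: term_le.refl)
  show "x .=\<^bsub>?L\<^esub> y" if "x \<sqsubseteq>\<^bsub>?L\<^esub> y" "y \<sqsubseteq>\<^bsub>?L\<^esub> x" "x \<in> carrier ?L" "y \<in> carrier ?L"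
    using that by (clarsimp simp: eq_presented carrier_presented le_presented term_class_eq_iff)
  show "x \<sqsubseteq>\<^bsub>?L\<^esub> z" if "x \<sqsubseteq>\<^bsub>?L\<^esub> y" "y \<sqsubseteq>\<^bsub>?L\<^esub> z" "x \<in> carrier ?L" "y \<in> carrier ?L" "z \<in> carrier ?L"
    using that by (auto simp: carrier_presented le_presented intro: term_le.trans)
qed (auto simp: eq_presented)

lemma least_join_presented:
  assumes s: "set_lat_term s \<subseteq> G" and t: "set_lat_term t \<subseteq> G"
  shows "least (presented_lattice G R) (term_class G R (Join s t))
    (Upper (presented_lattice G R) {term_class G R s, term_class G R t})"
    (is "least ?L ?j (Upper ?L {?s, ?t})")
proof -
  have st: "set_lat_term (Join s t) \<subseteq> G" using s t by simp
  have "?j \<in> carrier ?L" "?s \<in> carrier ?L" "?t \<in> carrier ?L"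
    using s t st by (simp_all only: term_class_in_carrier)
  moreover have "?s \<sqsubseteq>\<^bsub>?L\<^esub> ?j" "?t \<sqsubseteq>\<^bsub>?L\<^esub> ?j"
    using term_le.join1 term_le.join2 by (simp_all only: le_presented[OF s st] le_presented[OF t st])
  moreover have "?j \<sqsubseteq>\<^bsub>?L\<^esub> x" if x: "x \<in> carrier ?L" "?s \<sqsubseteq>\<^bsub>?L\<^esub> x" "?t \<sqsubseteq>\<^bsub>?L\<^esub> x" for x
  proof -
    obtain u where u: "set_lat_term u \<subseteq> G" "x = term_class G R u"
      using x(1) unfolding carrier_presented by blast
    then have "term_le R s u" "term_le R t u"
      using x(2,3) by (simp_all only: u(2) le_presented[OF s u(1)] le_presented[OF t u(1)])
    then have "term_le R (Join s t) u" by (rule term_le.join)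
    then show ?thesis by (simp only: u(2) le_presented[OF st u(1)])
  qed
  ultimately show ?thesis unfolding least_def Upper_def by blast
qed

lemma greatest_meet_presented:
  assumes s: "set_lat_term s \<subseteq> G" and t: "set_lat_term t \<subseteq> G"
  shows "greatest (presented_lattice G R) (term_class G R (Meet s t))
    (Lower (presented_lattice G R) {term_class G R s, term_class G R t})"
    (is "greatest ?L ?j (Lower ?L {?s, ?t})")
proof -
  have st: "set_lat_term (Meet s t) \<subseteq> G" using s t by simp
  have "?j \<in> carrier ?L" "?s \<in> carrier ?L" "?t \<in> carrier ?L"
    using s t st by (simp_all only: term_class_in_carrier)
  moreover have "?j \<sqsubseteq>\<^bsub>?L\<^esub> ?s" "?j \<sqsubseteq>\<^bsub>?L\<^esub> ?t"
    using term_le.meet1 term_le.meet2 by (simp_all only: le_presented[OF st s] le_presented[OF st t])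
  moreover have "x \<sqsubseteq>\<^bsub>?L\<^esub> ?j" if x: "x \<in> carrier ?L" "x \<sqsubseteq>\<^bsub>?L\<^esub> ?s" "x \<sqsubseteq>\<^bsub>?L\<^esub> ?t" for x
  proof -
    obtain u where u: "set_lat_term u \<subseteq> G" "x = term_class G R u"
      using x(1) unfolding carrier_presented by blast
    then have "term_le R u s" "term_le R u t"
      using x(2,3) by (simp_all only: u(2) le_presented[OF u(1) s] le_presented[OF u(1) t])
    then have "term_le R u (Meet s t)" by (rule term_le.meet)
    then show ?thesis by (simp only: u(2) le_presented[OF u(1) st])
  qed
  ultimately show ?thesis unfolding greatest_def Lower_def by blast
qed

lemma least_bot_presented:
  "least (presented_lattice G R) (term_class G R Bot) (carrier (presented_lattice G R))"
  unfolding least_def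
  using le_presented[of Bot G _ R] by (auto simp: carrier_presented term_le.bot intro: exI[of _ Bot])

lemma greatest_top_presented:
  "greatest (presented_lattice G R) (term_class G R Top) (carrier (presented_lattice G R))"
  unfolding greatest_def
  using le_presented[of _ G Top R] by (auto simp: carrier_presented term_le.top intro: exI[of _ Top])

lemma join_meet_presented:
  assumes "set_lat_term s \<subseteq> G" "set_lat_term t \<subseteq> G"
  shows "term_class G R s \<squnion>\<^bsub>presented_lattice G R\<^esub> term_class G R t = term_class G R (Join s t)"
    and "term_class G R s \<sqinter>\<^bsub>presented_lattice G R\<^esub> term_class G R t = term_class G R (Meet s t)"
proof -
  interpret partial_order "presented_lattice G R" by (rule partial_order_presented)
  note least = least_join_presented[OF assms] and greatest = greatest_meet_presented[OF assms]
  show "term_class G R s \<squnion>\<^bsub>presented_lattice G R\<^esub> term_class G R t = term_class G R (Join s t)"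
    unfolding join_def Lattice.sup_def by (rule some_equality, rule least, erule least_unique[OF _ least])
  show "term_class G R s \<sqinter>\<^bsub>presented_lattice G R\<^esub> term_class G R t = term_class G R (Meet s t)"
    unfolding meet_def Lattice.inf_def by (rule some_equality, rule greatest, erule greatest_unique[OF _ greatest])
qed

lemma bot_top_presented:
  shows "\<bottom>\<^bsub>presented_lattice G R\<^esub> = term_class G R Bot"
    and "\<top>\<^bsub>presented_lattice G R\<^esub> = term_class G R Top"
proof -
  interpret partial_order "presented_lattice G R" by (rule partial_order_presented)
  note least = least_bot_presented and greatest = greatest_top_presented
  show "\<bottom>\<^bsub>presented_lattice G R\<^esub> = term_class G R Bot"
    unfolding bottom_def by (rule some_equality, rule least, erule least_unique[OF _ least])
  show "\<top>\<^bsub>presented_lattice G R\<^esub> = term_class G R Top"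
    unfolding Order.top_def by (rule some_equality, rule greatest, erule greatest_unique[OF _ greatest])
qed

abbreviation spec_class :: "'a::unital_cstar_algebra set \<Rightarrow> 'a lat_term \<Rightarrow> 'a lat_term set" where
  "spec_class C \<equiv> term_class (selfadj C) (spec_rels C)"

lemmas spec_simps =
  join_meet_presented[of _ "selfadj C" _ "spec_rels C" for C, folded spec_lattice_def]
  bot_top_presented[of "selfadj C" "spec_rels C" for C, folded spec_lattice_def]
  le_presented[of _ "selfadj C" _ "spec_rels C" for C, folded spec_lattice_def]
  term_class_in_carrier[of _ "selfadj C" "spec_rels C" for C, folded spec_lattice_def]
lemmas carrier_spec = carrier_presented[of _ "selfadj C" "spec_rels C" for C, folded spec_lattice_def]

lemma spec_carrierE:
  assumes "a \<in> carrier (\<L> C)"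
  obtains t where "set_lat_term t \<subseteq> selfadj C" "a = spec_class C t"
  using assms by (auto simp: carrier_spec)

lemma spec_le_refl: "a \<in> carrier (\<L> C) \<Longrightarrow> a \<sqsubseteq>\<^bsub>\<L> C\<^esub> a"
  by (auto simp: spec_simps term_le.refl elim!: spec_carrierE)

lemma spec_le_trans:
  "a \<sqsubseteq>\<^bsub>\<L> C\<^esub> b \<Longrightarrow> b \<sqsubseteq>\<^bsub>\<L> C\<^esub> c \<Longrightarrow> a \<in> carrier (\<L> C) \<Longrightarrow> b \<in> carrier (\<L> C) \<Longrightarrow> c \<in> carrier (\<L> C)
    \<Longrightarrow> a \<sqsubseteq>\<^bsub>\<L> C\<^esub> c"
  by (auto simp: spec_simps intro: term_le.trans elim!: spec_carrierE)

lemma spec_lattice_closed: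
  "\<bottom>\<^bsub>\<L> C\<^esub> \<in> carrier (\<L> C)" "\<top>\<^bsub>\<L> C\<^esub> \<in> carrier (\<L> C)"
  "a \<in> carrier (\<L> C) \<Longrightarrow> b \<in> carrier (\<L> C) \<Longrightarrow> a \<squnion>\<^bsub>\<L> C\<^esub> b \<in> carrier (\<L> C)"
  "a \<in> carrier (\<L> C) \<Longrightarrow> b \<in> carrier (\<L> C) \<Longrightarrow> a \<sqinter>\<^bsub>\<L> C\<^esub> b \<in> carrier (\<L> C)"
  by (auto simp: spec_simps elim!: spec_carrierE)

lemma spec_le_bounds:
  assumes "a \<in> carrier (\<L> C)"
  shows "\<bottom>\<^bsub>\<L> C\<^esub> \<sqsubseteq>\<^bsub>\<L> C\<^esub> a" "a \<sqsubseteq>\<^bsub>\<L> C\<^esub> \<top>\<^bsub>\<L> C\<^esub>"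
  using assms by (auto simp: spec_simps term_le.bot term_le.top elim!: spec_carrierE)

lemma spec_meet_lower:
  assumes "a \<in> carrier (\<L> C)" "b \<in> carrier (\<L> C)"
  shows "a \<sqinter>\<^bsub>\<L> C\<^esub> b \<sqsubseteq>\<^bsub>\<L> C\<^esub> a" "a \<sqinter>\<^bsub>\<L> C\<^esub> b \<sqsubseteq>\<^bsub>\<L> C\<^esub> b"
  using assms by (auto simp: spec_simps term_le.meet1 term_le.meet2 elim!: spec_carrierE)

lemma spec_meet_greatest:
  assumes "c \<sqsubseteq>\<^bsub>\<L> C\<^esub> a" "c \<sqsubseteq>\<^bsub>\<L> C\<^esub> b" "a \<in> carrier (\<L> C)" "b \<in> carrier (\<L> C)" "c \<in> carrier (\<L> C)"
  shows "c \<sqsubseteq>\<^bsub>\<L> C\<^esub> a \<sqinter>\<^bsub>\<L> C\<^esub> b"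
  using assms by (auto simp: spec_simps term_le.meet elim!: spec_carrierE)

lemma bex_spec_carrier:
  "(\<exists>a\<in>carrier (\<L> C). P a) \<longleftrightarrow> (\<exists>t. set_lat_term t \<subseteq> selfadj C \<and> P (spec_class C t))"
proof -
  have "carrier (\<L> C) = spec_class C ` {t. set_lat_term t \<subseteq> selfadj C}"
    unfolding set_eq_iff carrier_spec image_iff by blast
  then show ?thesis by simp
qed

lemma well_inside_class:
  assumes "set_lat_term s \<subseteq> selfadj C" "set_lat_term t \<subseteq> selfadj C"
  shows "well_inside (\<L> C) (spec_class C s) (spec_class C t) \<longleftrightarrow>
    (\<exists>y. set_lat_term y \<subseteq> selfadj C \<and> spec_le C Top (Join t y) \<and> spec_le C (Meet s y) Bot)"
proof -
  have "well_inside (\<L> C) (spec_class C s) (spec_class C t) \<longleftrightarrow>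
      (\<exists>y. set_lat_term y \<subseteq> selfadj C \<and>
        spec_class C t \<squnion>\<^bsub>\<L> C\<^esub> spec_class C y = \<top>\<^bsub>\<L> C\<^esub> \<and>
        spec_class C s \<sqinter>\<^bsub>\<L> C\<^esub> spec_class C y = \<bottom>\<^bsub>\<L> C\<^esub>)"
    using spec_simps(6)[OF assms(1)] spec_simps(6)[OF assms(2)]
    unfolding well_inside_def bex_spec_carrier by simp
  also have "\<dots> \<longleftrightarrow> (\<exists>y. set_lat_term y \<subseteq> selfadj C \<and>
      spec_le C Top (Join t y) \<and> spec_le C (Meet s y) Bot)"
    by (rule ex_cong1, rule conj_cong[OF HOL.refl])
      (use assms in \<open>simp add: spec_simps term_class_eq_iff term_le.top term_le.bot\<close>)
  finally show ?thesis .
qed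

lemma well_insideD: "well_inside L a b \<Longrightarrow> a \<in> carrier L" "well_inside L a b \<Longrightarrow> b \<in> carrier L"
  by (simp_all add: well_inside_def)

lemma well_insideE:
  assumes "well_inside (\<L> C) a b"
  obtains s t y where "set_lat_term s \<subseteq> selfadj C" "set_lat_term t \<subseteq> selfadj C"
    "set_lat_term y \<subseteq> selfadj C" "a = spec_class C s" "b = spec_class C t"
    "term_le (spec_rels C) Top (Join t y)" "term_le (spec_rels C) (Meet s y) Bot"
  using assms well_insideD[OF assms] by (auto simp: well_inside_class elim!: spec_carrierE)

lemma well_inside_mono:
  assumes "a' \<sqsubseteq>\<^bsub>\<L> C\<^esub> a" "well_inside (\<L> C) a b" "b \<sqsubseteq>\<^bsub>\<L> C\<^esub> b'"
    and "a' \<in> carrier (\<L> C)" "b' \<in> carrier (\<L> C)"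
  shows "well_inside (\<L> C) a' b'"
  using assms(2)
proof (rule well_insideE)
  fix s t y
  assume *: "set_lat_term s \<subseteq> selfadj C" "set_lat_term t \<subseteq> selfadj C"
    "set_lat_term y \<subseteq> selfadj C" "a = spec_class C s" "b = spec_class C t"
    "term_le (spec_rels C) Top (Join t y)" "term_le (spec_rels C) (Meet s y) Bot"
  from assms(4,5) obtain s' t' where st: "set_lat_term s' \<subseteq> selfadj C" "set_lat_term t' \<subseteq> selfadj C"
    "a' = spec_class C s'" "b' = spec_class C t'" by (metis spec_carrierE)
  have "term_le (spec_rels C) s' s" "term_le (spec_rels C) t t'"
    using assms(1,3) * st by (simp_all add: spec_simps)
  then have "term_le (spec_rels C) Top (Join t' y)" "term_le (spec_rels C) (Meet s' y) Bot"
    using *(6,7) by (meson term_le.trans term_le.refl term_le_join_mono term_le_meet_mono)+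
  then show ?thesis using * st by (auto simp: well_inside_class)
qed

lemma well_inside_bot:
  assumes "a \<in> carrier (\<L> C)"
  shows "well_inside (\<L> C) \<bottom>\<^bsub>\<L> C\<^esub> a"
proof -
  obtain t where t: "set_lat_term t \<subseteq> selfadj C" "a = spec_class C t" using assms by (rule spec_carrierE)
  have "term_le (spec_rels C) Top (Join t Top)" "term_le (spec_rels C) (Meet Bot Top) Bot"
    by (auto intro: term_le.intros)
  then show ?thesis using t by (auto simp: spec_simps well_inside_class intro: exI[of _ Top])
qed

lemma well_inside_join:
  assumes "well_inside (\<L> C) a b" "well_inside (\<L> C) a' b'"
  shows "well_inside (\<L> C) (a \<squnion>\<^bsub>\<L> C\<^esub> a') (b \<squnion>\<^bsub>\<L> C\<^esub> b')"
proof -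
  obtain s t y where *: "set_lat_term s \<subseteq> selfadj C" "set_lat_term t \<subseteq> selfadj C"
    "set_lat_term y \<subseteq> selfadj C" "a = spec_class C s" "b = spec_class C t"
    "term_le (spec_rels C) Top (Join t y)" "term_le (spec_rels C) (Meet s y) Bot"
    using assms(1) by (rule well_insideE)
  obtain s' t' y' where **: "set_lat_term s' \<subseteq> selfadj C" "set_lat_term t' \<subseteq> selfadj C"
    "set_lat_term y' \<subseteq> selfadj C" "a' = spec_class C s'" "b' = spec_class C t'"
    "term_le (spec_rels C) Top (Join t' y')" "term_le (spec_rels C) (Meet s' y') Bot"
    using assms(2) by (rule well_insideE)
  have "term_le (spec_rels C) Top (Join (Join t t') (Meet y y'))"
    using *(6) **(6) by (intro term_le_join_meet) (meson term_le.intros)+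
  moreover have "term_le (spec_rels C) (Meet (Join s s') (Meet y y')) Bot"
  proof (rule term_le_split[OF term_le.meet1])
    show "term_le (spec_rels C) (Meet (Meet (Join s s') (Meet y y')) s) Bot"
      by (rule term_le.trans[OF _ *(7)])
        (intro term_le.meet term_le.meet2 term_le_meetI1[OF term_le_meetI2[OF term_le.meet1]])
    show "term_le (spec_rels C) (Meet (Meet (Join s s') (Meet y y')) s') Bot"
      by (rule term_le.trans[OF _ **(7)])
        (intro term_le.meet term_le.meet2 term_le_meetI1[OF term_le_meetI2[OF term_le.meet2]])
  qed
  ultimately show ?thesis
    using * ** by (auto simp: spec_simps well_inside_class intro!: exI[of _ "Meet y y'"])
qed

lemma well_inside_le:
  assumes "well_inside (\<L> C) a b"
  shows "a \<sqsubseteq>\<^bsub>\<L> C\<^esub> b"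
  using assms
proof (rule well_insideE)
  fix s t y
  assume *: "set_lat_term s \<subseteq> selfadj C" "set_lat_term t \<subseteq> selfadj C"
    "a = spec_class C s" "b = spec_class C t"
    "term_le (spec_rels C) Top (Join t y)" "term_le (spec_rels C) (Meet s y) Bot"
  have "term_le (spec_rels C) s t"
    by (rule term_le_split[OF term_le.trans[OF term_le.top *(5)]])
      (rule term_le.meet2 term_le.trans[OF *(6) term_le.bot])+
  then show ?thesis using * by (simp add: spec_simps)
qed

lemma well_inside_interpolate:
  assumes C: "C \<in> \<C>" and "well_inside (\<L> C) a b"
  shows "\<exists>c. well_inside (\<L> C) a c \<and> well_inside (\<L> C) c b"
  using assms(2)
proof (rule well_insideE)
  fix s t y
  assume *: "set_lat_term s \<subseteq> selfadj C" "set_lat_term t \<subseteq> selfadj C"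
    "set_lat_term y \<subseteq> selfadj C" "a = spec_class C s" "b = spec_class C t"
    "term_le (spec_rels C) Top (Join t y)" "term_le (spec_rels C) (Meet s y) Bot"
  obtain q where "q > 0" "term_le (spec_rels C) Top (Join (shrink C q t) y)"
    using well_inside_shrink[OF C *(3,6,7)] by blast
  then have "well_inside (\<L> C) a (spec_class C (shrink C q t))"
    "well_inside (\<L> C) (spec_class C (shrink C q t)) b"
    using shrink_well_inside[OF C *(2), of q] *(3,7)
    unfolding *(4,5) well_inside_class[OF *(1) set_shrink[OF C]] well_inside_class[OF set_shrink[OF C] *(2)]
    by blast+
  then show ?thesis by blast
qed

lemma well_inside_join_split:
  assumes C: "C \<in> \<C>" and ac: "well_inside (\<L> C) a c" and c: "c \<sqsubseteq>\<^bsub>\<L> C\<^esub> b \<squnion>\<^bsub>\<L> C\<^esub> b'"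
    and b: "b \<in> carrier (\<L> C)" "b' \<in> carrier (\<L> C)"
  obtains d d' where "a \<sqsubseteq>\<^bsub>\<L> C\<^esub> d \<squnion>\<^bsub>\<L> C\<^esub> d'" "d \<in> carrier (\<L> C)" "d' \<in> carrier (\<L> C)"
    "\<exists>e. well_inside (\<L> C) d e \<and> e \<sqsubseteq>\<^bsub>\<L> C\<^esub> b \<and> e \<sqsubseteq>\<^bsub>\<L> C\<^esub> c"
    "\<exists>e. well_inside (\<L> C) d' e \<and> e \<sqsubseteq>\<^bsub>\<L> C\<^esub> b' \<and> e \<sqsubseteq>\<^bsub>\<L> C\<^esub> c"
proof -
  let ?R = "spec_rels C"
  obtain s u y where *: "set_lat_term s \<subseteq> selfadj C" "set_lat_term u \<subseteq> selfadj C"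
    "set_lat_term y \<subseteq> selfadj C" "a = spec_class C s" "c = spec_class C u"
    "term_le ?R Top (Join u y)" "term_le ?R (Meet s y) Bot"
    using ac by (rule well_insideE)
  obtain t where t: "set_lat_term t \<subseteq> selfadj C" "b = spec_class C t" using b(1) by (rule spec_carrierE)
  obtain t' where t': "set_lat_term t' \<subseteq> selfadj C" "b' = spec_class C t'" using b(2) by (rule spec_carrierE)
  let ?v = "Meet u t" and ?v' = "Meet u t'"
  have sets: "set_lat_term ?v \<subseteq> selfadj C" "set_lat_term ?v' \<subseteq> selfadj C" using * t t' by auto
  have "term_le ?R u (Join t t')" using c * t t' by (simp add: spec_simps)
  then have "term_le ?R u (Join ?v ?v')"
    by (meson term_le.distrib term_le.meet term_le.refl term_le.trans)
  then have "term_le ?R Top (Join (Join ?v ?v') y)"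
    using *(6) by (meson term_le.trans term_le_join_mono term_le.refl)
  then obtain q where q: "q > 0" "term_le ?R Top (Join (shrink C q (Join ?v ?v')) y)"
    using well_inside_shrink[OF C *(3) _ *(7)] by blast
  have "term_le ?R s (shrink C q (Join ?v ?v'))"
    by (rule term_le_split[OF term_le.trans[OF term_le.top q(2)]])
      (rule term_le.meet2 term_le.trans[OF *(7) term_le.bot])+
  then have s: "term_le ?R s (Join (shrink C q ?v) (shrink C q ?v'))" by (simp add: C)
  have wi: "well_inside (\<L> C) (spec_class C (shrink C q v)) (spec_class C v)"
    if "set_lat_term v \<subseteq> selfadj C" for v
    using shrink_well_inside[OF C that q(1)] that set_shrink[OF C] by (simp add: well_inside_class)
  show ?thesis
  proof (rule that[of "spec_class C (shrink C q ?v)" "spec_class C (shrink C q ?v')"])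
    show "a \<sqsubseteq>\<^bsub>\<L> C\<^esub> spec_class C (shrink C q ?v) \<squnion>\<^bsub>\<L> C\<^esub> spec_class C (shrink C q ?v')"
      using s * set_shrink[OF C] by (simp add: spec_simps del: shrink.simps)
    show "\<exists>e. well_inside (\<L> C) (spec_class C (shrink C q ?v)) e \<and> e \<sqsubseteq>\<^bsub>\<L> C\<^esub> b \<and> e \<sqsubseteq>\<^bsub>\<L> C\<^esub> c"
      using wi[OF sets(1)] sets * t
      by (intro exI[of _ "spec_class C ?v"]) (simp add: spec_simps term_le.meet1 term_le.meet2 del: shrink.simps)
    show "\<exists>e. well_inside (\<L> C) (spec_class C (shrink C q ?v')) e \<and> e \<sqsubseteq>\<^bsub>\<L> C\<^esub> b' \<and> e \<sqsubseteq>\<^bsub>\<L> C\<^esub> c"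
      using wi[OF sets(2)] sets * t'
      by (intro exI[of _ "spec_class C ?v'"]) (simp add: spec_simps term_le.meet1 term_le.meet2 del: shrink.simps)
  qed (use set_shrink[OF C] in \<open>simp_all add: spec_simps del: shrink.simps\<close>)
qed

lemma selfadj_mono: "C \<subseteq> D \<Longrightarrow> selfadj C \<subseteq> selfadj D"
  by (auto simp: selfadj_def)

lemma spec_rels_mono:
  assumes "C \<subseteq> D"
  shows "spec_rels C \<subseteq> spec_rels D"
proof -
  have "selfadj C \<subseteq> selfadj D" using assms by (rule selfadj_mono)
  moreover from this have "sa_le C a b \<Longrightarrow> sa_le D a b" for a b by (auto simp: sa_le_def)
  ultimately show ?thesis unfolding spec_rels_def by (intro Un_mono) blast+
qed

lemma lat_map_class:
  assumes "C \<subseteq> D" "set_lat_term t \<subseteq> selfadj C"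
  shows "lat_map D (spec_class C t) = spec_class D t"
proof -
  let ?C = "term_eq (selfadj C) (spec_rels C)" and ?D = "term_eq (selfadj D) (spec_rels D)"
  have "?C \<subseteq> ?D"
    using selfadj_mono[OF assms(1)] term_le_subset[OF _ spec_rels_mono[OF assms(1)]]
    by (auto simp: term_eq_def)
  moreover have "(t, t) \<in> ?C" using assms by (simp add: term_eq_def term_le.refl)
  moreover have "trans ?D" using equiv_term_eq by (rule equivE)
  ultimately show ?thesis
    unfolding lat_map_def term_class_def by (auto dest: transD)
qed

lemma lat_map_id: "a \<in> carrier (\<L> C) \<Longrightarrow> lat_map C a = a"
  by (auto simp: lat_map_class elim!: spec_carrierE)

context
  fixes C D :: "'a::unital_cstar_algebra set"
  assumes CD: "C \<subseteq> D"
begin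

lemma lat_map_closed: "a \<in> carrier (\<L> C) \<Longrightarrow> lat_map D a \<in> carrier (\<L> D)"
  using selfadj_mono[OF CD] by (auto simp: lat_map_class[OF CD] spec_simps elim!: spec_carrierE)

lemma lat_map_mono:
  "a \<sqsubseteq>\<^bsub>\<L> C\<^esub> b \<Longrightarrow> a \<in> carrier (\<L> C) \<Longrightarrow> b \<in> carrier (\<L> C) \<Longrightarrow> lat_map D a \<sqsubseteq>\<^bsub>\<L> D\<^esub> lat_map D b"
  using selfadj_mono[OF CD] term_le_subset[OF _ spec_rels_mono[OF CD]]
  by (auto simp: lat_map_class[OF CD] spec_simps elim!: spec_carrierE)

lemma lat_map_simps:
  "lat_map D \<bottom>\<^bsub>\<L> C\<^esub> = \<bottom>\<^bsub>\<L> D\<^esub>" "lat_map D \<top>\<^bsub>\<L> C\<^esub> = \<top>\<^bsub>\<L> D\<^esub>"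
  "a \<in> carrier (\<L> C) \<Longrightarrow> b \<in> carrier (\<L> C) \<Longrightarrow>
    lat_map D (a \<squnion>\<^bsub>\<L> C\<^esub> b) = lat_map D a \<squnion>\<^bsub>\<L> D\<^esub> lat_map D b"
  "a \<in> carrier (\<L> C) \<Longrightarrow> b \<in> carrier (\<L> C) \<Longrightarrow>
    lat_map D (a \<sqinter>\<^bsub>\<L> C\<^esub> b) = lat_map D a \<sqinter>\<^bsub>\<L> D\<^esub> lat_map D b"
  using selfadj_mono[OF CD]
  by (auto simp: lat_map_class[OF CD] spec_simps elim!: spec_carrierE)

lemma lat_map_well_inside:
  assumes "well_inside (\<L> C) a b"
  shows "well_inside (\<L> D) (lat_map D a) (lat_map D b)"
proof -
  obtain y where y: "y \<in> carrier (\<L> C)" "b \<squnion>\<^bsub>\<L> C\<^esub> y = \<top>\<^bsub>\<L> C\<^esub>"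
    "a \<sqinter>\<^bsub>\<L> C\<^esub> y = \<bottom>\<^bsub>\<L> C\<^esub>" and ab: "a \<in> carrier (\<L> C)" "b \<in> carrier (\<L> C)"
    using assms by (auto simp: well_inside_def)
  have "lat_map D b \<squnion>\<^bsub>\<L> D\<^esub> lat_map D y = \<top>\<^bsub>\<L> D\<^esub>"
    "lat_map D a \<sqinter>\<^bsub>\<L> D\<^esub> lat_map D y = \<bottom>\<^bsub>\<L> D\<^esub>"
    using lat_map_simps(1,2) lat_map_simps(3)[OF ab(2) y(1)] lat_map_simps(4)[OF ab(1) y(1)]
    by (simp_all add: y)
  then show ?thesis using lat_map_closed y(1) ab unfolding well_inside_def by blast
qed

lemma lat_map_lat_map: "D \<subseteq> E \<Longrightarrow> a \<in> carrier (\<L> C) \<Longrightarrow> lat_map E (lat_map D a) = lat_map E a"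
  using selfadj_mono[OF CD] CD by (auto simp: lat_map_class elim!: spec_carrierE)

end

section \<open>Opens of the external spectrum\<close>

lemma Rep_spec_prop: "Rep_spec_open (spec_prop g) = spec_hull {{g}}"
  by (simp add: spec_prop_def Abs_spec_open_inverse theory_open_hull)

lemma mem_spec_prop:
  assumes "g \<in> T" "finite T" "T \<subseteq> spec_symbols"
  shows "T \<in> Rep_spec_open (spec_prop g)"
  unfolding Rep_spec_prop
  by (rule theory_openD(2)[OF theory_open_hull theory_hull_incl[of "{g}"]]) (use assms in auto)

lemma mem_INF_spec_prop:
  "T \<in> Rep_spec_open (INF g\<in>S. spec_prop g) \<longleftrightarrow>
    finite T \<and> T \<subseteq> spec_symbols \<and> (\<forall>g\<in>S. T \<in> Rep_spec_open (spec_prop g))"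
  by (simp add: Rep_spec_simps)

lemma spec_open_cut:
  assumes T: "T \<in> Rep_spec_open (spec_prop g)" and gT: "insert g T \<in> Rep_spec_open U"
  shows "T \<in> Rep_spec_open U"
proof -
  let ?V = "{Q. finite Q \<and> Q \<subseteq> spec_symbols \<and> Q \<union> T \<in> Rep_spec_open U}"
  have fin: "finite T" "T \<subseteq> spec_symbols" using in_Rep_spec_open[OF T] by auto
  have "theory_open spec_symbols spec_axiom ?V"
  proof (rule theory_openI, goal_cases)
    case (1 Q)
    then show ?case by simp
  next
    case (2 Q Q')
    have "Q' \<union> T \<in> Rep_spec_open U"
      by (rule theory_openD(2)[OF theory_open_Rep, of "Q \<union> T"]) (use 2 fin in auto)
    with 2 show ?case by simp
  next
    case (3 Q \<S> Q')
    have "Q' \<union> T \<in> Rep_spec_open U"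
      by (rule theory_openD(3)[OF theory_open_Rep 3(1)]) (use 3 fin in \<open>auto simp: Un_assoc\<close>)
    with 3 show ?case by simp
  qed
  then have "spec_hull {{g}} \<subseteq> ?V"
    by (rule theory_hull_least) (use gT in auto)
  then have "T \<union> T \<in> Rep_spec_open U" using T unfolding Rep_spec_prop by blast
  then show ?thesis by simp
qed

lemma spec_open_cut_finite:
  assumes "finite S" "T \<in> Rep_spec_open (INF g\<in>S. spec_prop g)" "S \<union> T \<in> Rep_spec_open U"
  shows "T \<in> Rep_spec_open U"
  using assms
proof (induction S)
  case (insert g S)
  have T: "finite T" "T \<subseteq> spec_symbols" "T \<in> Rep_spec_open (spec_prop g)"
    "T \<in> Rep_spec_open (INF g\<in>S. spec_prop g)"
    using insert.prems(1) unfolding mem_INF_spec_prop by auto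
  have "S \<union> T \<in> Rep_spec_open (spec_prop g)"
    using theory_openD(2)[OF theory_open_Rep T(3), of "S \<union> T"] T insert.hyps(1)
      in_Rep_spec_open[OF insert.prems(2)] by simp
  then have "S \<union> T \<in> Rep_spec_open U"
    by (rule spec_open_cut) (use insert.prems(2) in simp)
  with T(4) show ?case by (rule insert.IH)
qed simp

lemma spec_axiom_symbols:
  assumes "spec_axiom S \<S>"
  shows "finite S" "S \<subseteq> spec_symbols" "S' \<in> \<S> \<Longrightarrow> finite S'" "S' \<in> \<S> \<Longrightarrow> S' \<subseteq> spec_symbols"
  using assms
  by (cases rule: spec_axiom.cases;
      auto simp: spec_symbols_def lat_map_closed spec_lattice_closed dest: well_insideD)+

lemma spec_axiom_holds:
  assumes ax: "spec_axiom S \<S>"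
  shows "(INF g\<in>S. spec_prop g) \<le> (SUP S'\<in>\<S>. INF g\<in>S'. spec_prop g)"
  unfolding less_eq_spec_open_def
proof
  let ?U = "SUP S'\<in>\<S>. INF g\<in>S'. spec_prop g"
  fix T assume T: "T \<in> Rep_spec_open (INF g\<in>S. spec_prop g)"
  have fin: "finite T" "T \<subseteq> spec_symbols" using in_Rep_spec_open[OF T] by auto
  have "S' \<union> (S \<union> T) \<in> Rep_spec_open ?U" if "S' \<in> \<S>" for S'
  proof -
    have "S' \<union> (S \<union> T) \<in> Rep_spec_open (INF g\<in>S'. spec_prop g)"
      unfolding mem_INF_spec_prop
      using fin spec_axiom_symbols(1,2)[OF ax] spec_axiom_symbols(3,4)[OF ax that]
      by (auto intro!: mem_spec_prop)
    moreover have "(INF g\<in>S'. spec_prop g) \<le> ?U" using that by (rule SUP_upper)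
    ultimately show ?thesis unfolding less_eq_spec_open_def by blast
  qed
  then have "S \<union> T \<in> Rep_spec_open ?U"
    using fin spec_axiom_symbols(1,2)[OF ax]
    by (intro theory_openD(3)[OF theory_open_Rep ax, of "S \<union> T"]) simp_all
  then show "T \<in> Rep_spec_open ?U" by (rule spec_open_cut_finite[OF spec_axiom_symbols(1)[OF ax] T])
qed

lemma spec_open_eq_SUP: "U = (SUP T\<in>Rep_spec_open U. INF g\<in>T. spec_prop g)"
proof (rule antisym)
  have "T \<in> Rep_spec_open (INF g\<in>T. spec_prop g)" if "T \<in> Rep_spec_open U" for T
    using in_Rep_spec_open[OF that] by (auto simp: mem_INF_spec_prop intro: mem_spec_prop)
  then have "Rep_spec_open U \<subseteq> (\<Union>V\<in>(\<lambda>T. INF g\<in>T. spec_prop g) ` Rep_spec_open U. Rep_spec_open V)"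
    by blast
  then show "U \<le> (SUP T\<in>Rep_spec_open U. INF g\<in>T. spec_prop g)"
    unfolding less_eq_spec_open_def Rep_spec_simps(3) by (rule Rep_sub_hull)
  show "(SUP T\<in>Rep_spec_open U. INF g\<in>T. spec_prop g) \<le> U"
  proof (rule SUP_least)
    fix T assume T: "T \<in> Rep_spec_open U"
    show "(INF g\<in>T. spec_prop g) \<le> U"
      unfolding less_eq_spec_open_def
    proof
      fix S assume S: "S \<in> Rep_spec_open (INF g\<in>T. spec_prop g)"
      have "T \<union> S \<in> Rep_spec_open U"
        using theory_openD(2)[OF theory_open_Rep T, of "T \<union> S"] in_Rep_spec_open[OF T]
          in_Rep_spec_open[OF S] by simp
      then show "S \<in> Rep_spec_open U"
        using spec_open_cut_finite S in_Rep_spec_open[OF T] by blast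
    qed
  qed
qed

abbreviation basic_open :: "'a::unital_cstar_algebra set \<Rightarrow> 'a lat_term set \<Rightarrow> 'a spec_open" where
  "basic_open C a \<equiv> spec_prop (InFilter C a)"

context
  fixes C :: "'a::unital_cstar_algebra set"
  assumes C: "C \<in> \<C>"
begin

lemma basic_open_mono:
  "a \<sqsubseteq>\<^bsub>\<L> C\<^esub> b \<Longrightarrow> a \<in> carrier (\<L> C) \<Longrightarrow> b \<in> carrier (\<L> C) \<Longrightarrow> basic_open C a \<le> basic_open C b"
  using spec_axiom_holds[OF spec_axiom.filter_up[OF C]] by simp

lemma basic_open_bot: "basic_open C \<bottom>\<^bsub>\<L> C\<^esub> = bot"
  using spec_axiom_holds[OF spec_axiom.prime_bot[OF C]] by (simp add: bot_unique)

lemma basic_open_join: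
  "a \<in> carrier (\<L> C) \<Longrightarrow> b \<in> carrier (\<L> C) \<Longrightarrow>
    basic_open C (a \<squnion>\<^bsub>\<L> C\<^esub> b) \<le> sup (basic_open C a) (basic_open C b)"
  using spec_axiom_holds[OF spec_axiom.prime_join[OF C]] by simp

lemma basic_open_meet:
  "a \<in> carrier (\<L> C) \<Longrightarrow> b \<in> carrier (\<L> C) \<Longrightarrow>
    inf (basic_open C a) (basic_open C b) \<le> basic_open C (a \<sqinter>\<^bsub>\<L> C\<^esub> b)"
  using spec_axiom_holds[OF spec_axiom.filter_meet[OF C]] by simp

lemma basic_open_earlier:
  "D \<in> \<C> \<Longrightarrow> C \<subseteq> D \<Longrightarrow> a \<in> carrier (\<L> C) \<Longrightarrow> basic_open D (lat_map D a) \<le> basic_open C a"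
  using spec_axiom_holds[OF spec_axiom.earlier[OF C]] by simp

lemma basic_open_later:
  "D \<in> \<C> \<Longrightarrow> C \<subseteq> D \<Longrightarrow> a \<in> carrier (\<L> C) \<Longrightarrow>
    inf (spec_prop (InIdl D)) (basic_open C a) \<le> basic_open D (lat_map D a)"
  using spec_axiom_holds[OF spec_axiom.later[OF C]] by simp

lemma basic_open_over: "a \<in> carrier (\<L> C) \<Longrightarrow> basic_open C a \<le> spec_prop (InIdl C)"
  using spec_axiom_holds[OF spec_axiom.over[OF C]] by simp

lemma idl_open_eq: "spec_prop (InIdl C) = basic_open C \<top>\<^bsub>\<L> C\<^esub>"
  using spec_axiom_holds[OF spec_axiom.filter_top[OF C]] basic_open_over[of "\<top>\<^bsub>\<L> C\<^esub>"]
  by (intro antisym) (simp_all add: spec_lattice_closed)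

lemma basic_open_regular:
  assumes "a \<in> carrier (\<L> C)"
    "\<And>D a'. D \<in> \<C> \<Longrightarrow> C \<subseteq> D \<Longrightarrow> well_inside (\<L> D) a' (lat_map D a) \<Longrightarrow> basic_open D a' \<le> u"
  shows "basic_open C a \<le> u"
proof -
  have "basic_open C a \<le> (SUP S'\<in>{{InFilter D a'} | D a'. D \<in> \<C> \<and> C \<subseteq> D \<and>
      well_inside (\<L> D) a' (lat_map D a)}. INF g\<in>S'. spec_prop g)"
    using spec_axiom_holds[OF spec_axiom.regular[OF C assms(1)]] by simp
  also have "\<dots> \<le> u" by (rule SUP_least) (use assms(2) in auto)
  finally show ?thesis .
qed

end

definition basic_part :: "'a::unital_cstar_algebra spec_open \<Rightarrow> 'a spec_open" where
  "basic_part u = Sup {basic_open C a | C a. C \<in> \<C> \<and> a \<in> carrier (\<L> C) \<and> basic_open C a \<le> u}"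

lemma basic_part_mono: "u \<le> v \<Longrightarrow> basic_part u \<le> basic_part v"
  unfolding basic_part_def by (rule Sup_subset_mono) (auto intro: order_trans)

lemma basic_part_upper:
  "C \<in> \<C> \<Longrightarrow> a \<in> carrier (\<L> C) \<Longrightarrow> basic_open C a \<le> u \<Longrightarrow> basic_open C a \<le> basic_part u"
  unfolding basic_part_def by (rule Sup_upper) blast

lemma basic_inf_le_basic_part:
  assumes C: "C \<in> \<C>" "a \<in> carrier (\<L> C)" and D: "D \<in> \<C>" "b \<in> carrier (\<L> D)"
  shows "inf (basic_open C a) (basic_open D b) \<le> basic_part (inf (basic_open C a) (basic_open D b))"
    (is "?x \<le> _")
proof -
  let ?\<E> = "{E. E \<in> \<C> \<and> C \<subseteq> E \<and> D \<subseteq> E}"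
  have "?x \<le> inf (spec_prop (InIdl C)) (spec_prop (InIdl D))"
    using basic_open_over C D by (intro inf_mono) blast+
  also have "\<dots> \<le> (SUP S'\<in>{{InIdl E} | E. E \<in> \<C> \<and> C \<subseteq> E \<and> D \<subseteq> E}. INF g\<in>S'. spec_prop g)"
    using spec_axiom_holds[OF spec_axiom.directed[OF C(1) D(1)]] by simp
  also have "\<dots> \<le> (SUP E\<in>?\<E>. spec_prop (InIdl E))"
    by (rule SUP_least) (auto intro: SUP_upper)
  finally have "?x \<le> inf ?x (SUP E\<in>?\<E>. spec_prop (InIdl E))" by simp
  also have "\<dots> = (SUP E\<in>?\<E>. inf ?x (spec_prop (InIdl E)))"
    by (simp add: inf_Sup_frame image_image)
  also have "\<dots> \<le> basic_part ?x"
  proof (rule SUP_least)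
    fix E assume "E \<in> ?\<E>"
    then have E: "E \<in> \<C>" "C \<subseteq> E" "D \<subseteq> E" by auto
    let ?a = "lat_map E a" and ?b = "lat_map E b"
    have ab: "?a \<in> carrier (\<L> E)" "?b \<in> carrier (\<L> E)" using E C D by (simp_all add: lat_map_closed)
    have "inf ?x (spec_prop (InIdl E)) \<le> basic_open E ?a"
      using basic_open_later[OF C(1) E(1,2) C(2)]
      by (rule order_trans[rotated]) (simp add: le_infI1)
    moreover have "inf ?x (spec_prop (InIdl E)) \<le> basic_open E ?b"
      using basic_open_later[OF D(1) E(1,3) D(2)]
      by (rule order_trans[rotated]) (simp add: le_infI1)
    ultimately have "inf ?x (spec_prop (InIdl E)) \<le> basic_open E (?a \<sqinter>\<^bsub>\<L> E\<^esub> ?b)"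
      using basic_open_meet[OF E(1) ab] by (meson le_inf_iff order_trans)
    also have "\<dots> \<le> basic_part ?x"
    proof (rule basic_part_upper[OF E(1)])
      show cl: "?a \<sqinter>\<^bsub>\<L> E\<^esub> ?b \<in> carrier (\<L> E)" using ab by (rule spec_lattice_closed)
      have "basic_open E (?a \<sqinter>\<^bsub>\<L> E\<^esub> ?b) \<le> basic_open E ?a"
        "basic_open E (?a \<sqinter>\<^bsub>\<L> E\<^esub> ?b) \<le> basic_open E ?b"
        using basic_open_mono[OF E(1)] spec_meet_lower[OF ab] cl ab by blast+
      then show "basic_open E (?a \<sqinter>\<^bsub>\<L> E\<^esub> ?b) \<le> ?x"
        using basic_open_earlier[OF C(1) E(1,2) C(2)] basic_open_earlier[OF D(1) E(1,3) D(2)]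
        by (meson le_inf_iff order_trans)
    qed
    finally show "inf ?x (spec_prop (InIdl E)) \<le> basic_part ?x" .
  qed
  finally show ?thesis .
qed

lemma inf_le_basic_part:
  assumes "u \<le> basic_part u" "v \<le> basic_part v"
  shows "inf u v \<le> basic_part (inf u v)"
proof -
  have "inf u v \<le> inf (basic_part u) (basic_part v)" using assms by (rule inf_mono)
  also have "\<dots> \<le> basic_part (inf u v)"
    unfolding basic_part_def[of v] inf_Sup_frame
  proof (intro SUP_least)
    fix y assume "y \<in> {basic_open C a | C a. C \<in> \<C> \<and> a \<in> carrier (\<L> C) \<and> basic_open C a \<le> v}"
    then obtain D b where D: "D \<in> \<C>" "b \<in> carrier (\<L> D)" and y: "y = basic_open D b" "y \<le> v" by auto
    have "inf y (basic_part u) \<le> basic_part (inf u v)"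
      unfolding basic_part_def[of u] inf_Sup_frame
    proof (intro SUP_least)
      fix x assume "x \<in> {basic_open C a | C a. C \<in> \<C> \<and> a \<in> carrier (\<L> C) \<and> basic_open C a \<le> u}"
      then obtain C a where C: "C \<in> \<C>" "a \<in> carrier (\<L> C)" and x: "x = basic_open C a" "x \<le> u" by auto
      have "inf y x \<le> basic_part (inf y x)"
        using basic_inf_le_basic_part[OF D C] x(1) y(1) by simp
      also have "\<dots> \<le> basic_part (inf u v)"
        using x(2) y(2) by (intro basic_part_mono) (simp add: le_infI1 le_infI2)
      finally show "inf y x \<le> basic_part (inf u v)" .
    qed
    then show "inf (basic_part u) y \<le> basic_part (inf u v)" by (simp add: inf.commute)
  qed
  finally show ?thesis .
qed

lemma le_basic_part: "u \<le> basic_part u"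
proof -
  have gen: "spec_prop g \<le> basic_part (spec_prop g)" if "g \<in> spec_symbols" for g :: "'a spec_symbol"
    using that by (auto simp: spec_symbols_def idl_open_eq intro!: basic_part_upper spec_lattice_closed)
  have *: "(INF g\<in>T. spec_prop g) \<le> basic_part (INF g\<in>T. spec_prop g)"
    if "finite T" "T \<subseteq> spec_symbols" for T :: "'a spec_symbol set"
    using that
  proof (induction T)
    case empty
    have "Orderings.top \<le> (SUP C\<in>\<C>. spec_prop (InIdl C) :: 'a spec_open)"
      using spec_axiom_holds[OF spec_axiom.inhabited]
      by (simp add: Setcompr_eq_image image_image)
    also have "\<dots> \<le> basic_part Orderings.top"
      by (intro SUP_least) (auto simp: idl_open_eq intro!: basic_part_upper spec_lattice_closed)
    finally show ?case by simp
  next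
    case (insert g T)
    then show ?case by (simp add: inf_le_basic_part gen)
  qed
  have "(INF g\<in>T. spec_prop g) \<le> basic_part u" if T: "T \<in> Rep_spec_open u" for T
  proof (rule order_trans[OF _ basic_part_mono])
    show "(INF g\<in>T. spec_prop g) \<le> u"
      using SUP_upper[OF T, of "\<lambda>T. INF g\<in>T. spec_prop g"]
      by (simp only: spec_open_eq_SUP[of u, symmetric])
  qed (use *[of T] in_Rep_spec_open[OF T] in simp)
  then have "(SUP T\<in>Rep_spec_open u. INF g\<in>T. spec_prop g) \<le> basic_part u" by (rule SUP_least)
  then show ?thesis by (simp only: spec_open_eq_SUP[of u, symmetric])
qed

section \<open>Ideal families and opens\<close>

text \<open>Families over a locale \<open>W\<close> induce ordinary families of ideals that need not be rounded.\<close>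

definition ideal_family :: "('a::unital_cstar_algebra set \<Rightarrow> 'a lat_term set set) \<Rightarrow> bool" where
  "ideal_family V \<longleftrightarrow> (\<forall>C\<in>\<C>. lat_ideal (\<L> C) (V C)) \<and>
     (\<forall>C\<in>\<C>. \<forall>D\<in>\<C>. C \<subseteq> D \<longrightarrow> lat_map D ` V C \<subseteq> V D)"

lemma lat_idealD:
  assumes "lat_ideal L I"
  shows "a \<in> I \<Longrightarrow> a \<in> carrier L" "\<bottom>\<^bsub>L\<^esub> \<in> I"
    "a \<sqsubseteq>\<^bsub>L\<^esub> b \<Longrightarrow> b \<in> I \<Longrightarrow> a \<in> carrier L \<Longrightarrow> a \<in> I" "a \<in> I \<Longrightarrow> b \<in> I \<Longrightarrow> a \<squnion>\<^bsub>L\<^esub> b \<in> I"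
  using assms by (auto simp: lat_ideal_def)

text \<open>At stage \<open>E\<close>, the conjunction of \<open>T\<close> makes sense and is bounded below by \<open>c\<close>.\<close>

definition stage_bound ::
  "'a::unital_cstar_algebra spec_symbol set \<Rightarrow> 'a set \<Rightarrow> 'a lat_term set \<Rightarrow> bool" where
  "stage_bound T E c \<longleftrightarrow> (\<forall>g\<in>T. case g of InIdl C \<Rightarrow> C \<subseteq> E
     | InFilter C b \<Rightarrow> C \<subseteq> E \<and> c \<sqsubseteq>\<^bsub>\<L> E\<^esub> lat_map E b)"

lemma stage_bound_simps [simp]:
  "stage_bound {} E c"
  "stage_bound (insert (InIdl C) T) E c \<longleftrightarrow> C \<subseteq> E \<and> stage_bound T E c"
  "stage_bound (insert (InFilter C b) T) E c \<longleftrightarrow>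
    C \<subseteq> E \<and> c \<sqsubseteq>\<^bsub>\<L> E\<^esub> lat_map E b \<and> stage_bound T E c"
  "stage_bound (S \<union> T) E c \<longleftrightarrow> stage_bound S E c \<and> stage_bound T E c"
  by (simp_all add: stage_bound_def ball_Un conj_assoc)

lemma stage_bound_subset: "stage_bound T E c \<Longrightarrow> S \<subseteq> T \<Longrightarrow> stage_bound S E c"
  unfolding stage_bound_def by blast

lemma stage_bound_le:
  assumes T: "stage_bound T E c" and c': "c' \<sqsubseteq>\<^bsub>\<L> E\<^esub> c" and symb: "T \<subseteq> spec_symbols"
    and mem: "c \<in> carrier (\<L> E)" "c' \<in> carrier (\<L> E)"
  shows "stage_bound T E c'"
  unfolding stage_bound_def
proof
  fix g assume g: "g \<in> T"
  then have gE: "stage_bound {g} E c" by (intro stage_bound_subset[OF T]) simp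
  have "g \<in> spec_symbols" using g symb by blast
  then show "case g of InIdl C \<Rightarrow> C \<subseteq> E
      | InFilter C b \<Rightarrow> C \<subseteq> E \<and> c' \<sqsubseteq>\<^bsub>\<L> E\<^esub> lat_map E b"
  proof (cases g)
    case (InFilter C b)
    then have b: "C \<subseteq> E" "c \<sqsubseteq>\<^bsub>\<L> E\<^esub> lat_map E b" "b \<in> carrier (\<L> C)"
      using gE \<open>g \<in> spec_symbols\<close> by (simp_all add: spec_symbols_def image_iff)
    then show ?thesis using spec_le_trans[OF c' b(2) mem(2,1) lat_map_closed] InFilter by simp
  qed (use gE in simp)
qed

lemma spec_axiom_stage:
  assumes "spec_axiom S \<S>" and E: "E \<in> \<C>" and I: "lat_ideal (\<L> E) I"
    and ac: "well_inside (\<L> E) a c" and S: "stage_bound S E c"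
    and step: "\<And>S' a' c'. S' \<in> \<S> \<Longrightarrow> well_inside (\<L> E) a' c' \<Longrightarrow> c' \<sqsubseteq>\<^bsub>\<L> E\<^esub> c \<Longrightarrow>
      stage_bound S' E c' \<Longrightarrow> a' \<in> I"
  shows "a \<in> I"
proof -
  have a: "a \<in> carrier (\<L> E)" and c: "c \<in> carrier (\<L> E)" using ac by (simp_all add: well_inside_def)
  note here = step[OF _ ac spec_le_refl[OF c]]
  show ?thesis
    using assms(1)
  proof cases
    case inhabited
    with E show ?thesis by (intro here[of "{InIdl E}"]) auto
  next
    case (down_closed C D)
    with S show ?thesis by (intro here[of "{InIdl C}"]) auto
  next
    case (directed C D)
    with S E show ?thesis by (intro here[of "{InIdl E}"]) auto
  next
    case (over C b)
    with S show ?thesis by (intro here[of "{InIdl C}"]) auto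
  next
    case (later C D b)
    with S show ?thesis by (intro here[of "{InFilter D (lat_map D b)}"]) (auto simp: lat_map_lat_map)
  next
    case (earlier C D b)
    with S show ?thesis by (intro here[of "{InFilter C b}"]) (auto simp: lat_map_lat_map)
  next
    case (filter_top C)
    with S c show ?thesis
      by (intro here[of "{InFilter C \<top>\<^bsub>\<L> C\<^esub>}"]) (auto simp: lat_map_simps spec_le_bounds)
  next
    case (filter_meet C b b')
    with S c show ?thesis
      by (intro here[of "{InFilter C (b \<sqinter>\<^bsub>\<L> C\<^esub> b')}"])
        (auto simp: lat_map_simps lat_map_closed spec_meet_greatest)
  next
    case (filter_up C b b')
    then have CE: "C \<subseteq> E" and b: "c \<sqsubseteq>\<^bsub>\<L> E\<^esub> lat_map E b" using S by auto
    have "c \<sqsubseteq>\<^bsub>\<L> E\<^esub> lat_map E b'"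
      by (rule spec_le_trans[OF b lat_map_mono[OF CE]])
        (use filter_up CE c in \<open>simp_all add: lat_map_closed[OF CE]\<close>)
    then show ?thesis using filter_up CE by (intro here[of "{InFilter C b'}"]) auto
  next
    case (prime_bot C)
    then have "c \<sqsubseteq>\<^bsub>\<L> E\<^esub> \<bottom>\<^bsub>\<L> E\<^esub>" using S by (auto simp: lat_map_simps)
    then have "a \<sqsubseteq>\<^bsub>\<L> E\<^esub> \<bottom>\<^bsub>\<L> E\<^esub>"
      using well_inside_le[OF ac] a c spec_lattice_closed(1) by (blast intro: spec_le_trans)
    then show ?thesis using lat_idealD(2,3)[OF I] a by blast
  next
    case (prime_join C b b')
    then have CE: "C \<subseteq> E" and "c \<sqsubseteq>\<^bsub>\<L> E\<^esub> lat_map E b \<squnion>\<^bsub>\<L> E\<^esub> lat_map E b'"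
      using S by (auto simp: lat_map_simps)
    moreover have "lat_map E b \<in> carrier (\<L> E)" "lat_map E b' \<in> carrier (\<L> E)"
      using prime_join CE by (simp_all add: lat_map_closed)
    ultimately obtain d d' e e' where d: "a \<sqsubseteq>\<^bsub>\<L> E\<^esub> d \<squnion>\<^bsub>\<L> E\<^esub> d'"
      and e: "well_inside (\<L> E) d e" "e \<sqsubseteq>\<^bsub>\<L> E\<^esub> lat_map E b" "e \<sqsubseteq>\<^bsub>\<L> E\<^esub> c"
      and e': "well_inside (\<L> E) d' e'" "e' \<sqsubseteq>\<^bsub>\<L> E\<^esub> lat_map E b'" "e' \<sqsubseteq>\<^bsub>\<L> E\<^esub> c"
      by (metis well_inside_join_split[OF E ac])
    have "d \<in> I" by (rule step[of "{InFilter C b}", OF _ e(1,3)]) (use prime_join CE e in auto)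
    moreover have "d' \<in> I" by (rule step[of "{InFilter C b'}", OF _ e'(1,3)]) (use prime_join CE e' in auto)
    ultimately show ?thesis using lat_idealD(3,4)[OF I] d a by blast
  next
    case (regular C b)
    then have b: "C \<subseteq> E" "c \<sqsubseteq>\<^bsub>\<L> E\<^esub> lat_map E b" using S by auto
    obtain c' where c': "well_inside (\<L> E) a c'" "well_inside (\<L> E) c' c"
      using well_inside_interpolate[OF E ac] by blast
    have mem: "c' \<in> carrier (\<L> E)" "lat_map E b \<in> carrier (\<L> E)"
      using c' b regular by (auto simp: well_inside_def lat_map_closed)
    have "well_inside (\<L> E) c' (lat_map E b)"
      using well_inside_mono[OF spec_le_refl c'(2) b(2)] mem by blast
    then have "{InFilter E c'} \<in> \<S>" using regular E b(1) by blast
    then show ?thesis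
      using c' mem by (intro step[OF _ c'(1) well_inside_le]) (auto simp: lat_map_id spec_le_refl)
  qed
qed

lemma mem_ideal_family:
  assumes V: "ideal_family V" and C: "C \<in> \<C>" and ab: "well_inside (\<L> C) a b"
    and le: "basic_open C b \<le> open_of_family V"
  shows "a \<in> V C"
proof -
  define K where "K = {T. finite T \<and> T \<subseteq> spec_symbols \<and>
    (\<forall>E\<in>\<C>. \<forall>a c. well_inside (\<L> E) a c \<longrightarrow> stage_bound T E c \<longrightarrow> a \<in> V E)}"
  have KI: "T \<in> K" if "finite T" "T \<subseteq> spec_symbols"
    "\<And>E a c. E \<in> \<C> \<Longrightarrow> well_inside (\<L> E) a c \<Longrightarrow> stage_bound T E c \<Longrightarrow> a \<in> V E" for T
    unfolding K_def using that by blast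
  have KD: "a \<in> V E" if "T \<in> K" "E \<in> \<C>" "well_inside (\<L> E) a c" "stage_bound T E c" for T E a c
    using that unfolding K_def by blast
  have K: "theory_open spec_symbols spec_axiom K"
  proof (rule theory_openI, goal_cases)
    case (1 T)
    then show ?case by (simp add: K_def)
  next
    case (2 S T)
    then show ?case by (intro KI) (blast intro: KD stage_bound_subset)+
  next
    case (3 S \<S> T)
    show ?case
    proof (rule KI[OF 3(3,4)])
      fix E a c assume E: "E \<in> \<C>" and ac: "well_inside (\<L> E) a c" and T: "stage_bound T E c"
      have I: "lat_ideal (\<L> E) (V E)" using V E by (simp add: ideal_family_def)
      show "a \<in> V E"
      proof (rule spec_axiom_stage[OF 3(1) E I ac stage_bound_subset[OF T 3(2)]])
        fix S' a' c' assume S': "S' \<in> \<S>" "well_inside (\<L> E) a' c'" "c' \<sqsubseteq>\<^bsub>\<L> E\<^esub> c" "stage_bound S' E c'"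
        have "stage_bound T E c'"
          using stage_bound_le[OF T S'(3) 3(4)] S'(2) ac by (simp add: well_inside_def)
        then show "a' \<in> V E" using KD[OF 3(5)[OF S'(1)] E S'(2)] S'(4) by simp
      qed
    qed
  qed
  have "basic_open D d \<le> Abs_spec_open K" if D: "D \<in> \<C>" "d \<in> V D" for D d
  proof -
    have "{InFilter D d} \<in> K"
    proof (rule KI)
      show "{InFilter D d} \<subseteq> spec_symbols"
        using V D unfolding ideal_family_def spec_symbols_def by (auto dest: lat_idealD(1))
      fix E a c assume E: "E \<in> \<C>" and ac: "well_inside (\<L> E) a c" and st: "stage_bound {InFilter D d} E c"
      have ideal: "lat_ideal (\<L> E) (V E)" using V E by (simp add: ideal_family_def)
      have "lat_map E ` V D \<subseteq> V E" using V D(1) E st by (simp add: ideal_family_def)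
      then have dE: "lat_map E d \<in> V E" using D(2) by blast
      have "well_inside (\<L> E) a (lat_map E d)"
        using well_inside_mono[OF spec_le_refl ac] st lat_idealD(1)[OF ideal dE] ac
        by (simp add: well_inside_def)
      then show "a \<in> V E"
        using lat_idealD(3)[OF ideal well_inside_le dE] by (simp add: well_inside_def)
    qed simp
    then have "spec_hull {{InFilter D d}} \<subseteq> K" by (intro theory_hull_least[OF K]) blast
    then show ?thesis
      using K by (simp add: less_eq_spec_open_def Rep_spec_prop Abs_spec_open_inverse)
  qed
  then have "open_of_family V \<le> Abs_spec_open K"
    unfolding open_of_family_def by (intro SUP_least) blast
  with le have "basic_open C b \<le> Abs_spec_open K" by (rule order_trans)
  then have "Rep_spec_open (basic_open C b) \<subseteq> K"
    using K by (simp add: less_eq_spec_open_def Abs_spec_open_inverse)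
  moreover have b: "b \<in> carrier (\<L> C)" using ab by (simp add: well_inside_def)
  then have "{InFilter C b} \<in> Rep_spec_open (basic_open C b)"
    using C by (intro mem_spec_prop) (auto simp: spec_symbols_def)
  ultimately have "{InFilter C b} \<in> K" by blast
  then show ?thesis by (rule KD[OF _ C ab]) (use b in \<open>simp add: lat_map_id spec_le_refl\<close>)
qed

lemma basic_open_way_below:
  fixes C :: "'a::unital_cstar_algebra set"
  assumes C: "C \<in> \<C>" and ab: "well_inside (\<L> C) a b"
  shows "basic_open C a \<lless> basic_open C b"
proof (rule wbI)
  fix S assume S: "Defs.directed S" and le: "basic_open C b \<le> Sup S"
  define V where "V D = {d \<in> carrier (\<L> D). \<exists>s\<in>S. basic_open D d \<le> s}" for D :: "'a set"
  have "ideal_family V"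
    unfolding ideal_family_def
  proof (intro conjI ballI impI)
    fix D :: "'a set" assume D: "D \<in> \<C>"
    show "lat_ideal (\<L> D) (V D)"
      unfolding lat_ideal_def
    proof (intro conjI ballI impI)
      show "\<bottom>\<^bsub>\<L> D\<^esub> \<in> V D"
        using S by (auto simp: V_def basic_open_bot[OF D] spec_lattice_closed Defs.directed_def)
      show "d \<in> V D" if "d \<in> carrier (\<L> D)" "e \<in> V D" "d \<sqsubseteq>\<^bsub>\<L> D\<^esub> e" for d e
        using that basic_open_mono[OF D that(3)] unfolding V_def by (blast intro: order_trans)
      fix d e assume de: "d \<in> V D" "e \<in> V D"
      then obtain s t where st: "s \<in> S" "t \<in> S" "basic_open D d \<le> s" "basic_open D e \<le> t"
        and mem: "d \<in> carrier (\<L> D)" "e \<in> carrier (\<L> D)" by (auto simp: V_def)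
      then obtain r where r: "r \<in> S" "s \<le> r" "t \<le> r" using S unfolding Defs.directed_def by blast
      have "basic_open D (d \<squnion>\<^bsub>\<L> D\<^esub> e) \<le> sup (basic_open D d) (basic_open D e)"
        by (rule basic_open_join[OF D mem])
      also have "\<dots> \<le> r" using st r by (meson le_sup_iff order_trans)
      finally show "d \<squnion>\<^bsub>\<L> D\<^esub> e \<in> V D" using r(1) mem by (auto simp: V_def spec_lattice_closed)
    qed (auto simp: V_def)
  next
    fix D E :: "'a set" assume DE: "D \<in> \<C>" "E \<in> \<C>" "D \<subseteq> E"
    then show "lat_map E ` V D \<subseteq> V E"
      using basic_open_earlier[OF DE] by (auto simp: V_def lat_map_closed intro: order_trans)
  qed
  moreover have "s \<le> open_of_family V" if "s \<in> S" for s
  proof -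
    have "basic_open D d \<le> open_of_family V"
      if "D \<in> \<C>" "d \<in> carrier (\<L> D)" "basic_open D d \<le> s" for D d
      unfolding open_of_family_def
      by (rule SUP_upper2[OF that(1)], rule SUP_upper) (use that \<open>s \<in> S\<close> in \<open>auto simp: V_def\<close>)
    then have "basic_part s \<le> open_of_family V"
      unfolding basic_part_def by (intro Sup_least) auto
    then show ?thesis using le_basic_part order_trans by blast
  qed
  then have "Sup S \<le> open_of_family V" by (rule Sup_least)
  with le have "basic_open C b \<le> open_of_family V" by (rule order_trans)
  ultimately have "a \<in> V C" using mem_ideal_family[OF _ C ab] by blast
  then show "\<exists>s\<in>S. basic_open C a \<le> s" by (simp add: V_def)
qed

definition family_of_open :: "'a::unital_cstar_algebra spec_open \<Rightarrow> 'a set \<Rightarrow> 'a lat_term set set" where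
  "family_of_open u = (\<lambda>C\<in>\<C>. {a. \<exists>b. well_inside (\<L> C) a b \<and> basic_open C b \<le> u})"

lemma mem_family_of_open:
  "C \<in> \<C> \<Longrightarrow> a \<in> family_of_open u C \<longleftrightarrow> (\<exists>b. well_inside (\<L> C) a b \<and> basic_open C b \<le> u)"
  by (simp add: family_of_open_def)

lemma basic_open_le_family:
  assumes C: "C \<in> \<C>" and a: "a \<in> U C"
  shows "basic_open C a \<le> open_of_family U"
  unfolding open_of_family_def by (rule SUP_upper2[OF C], rule SUP_upper[OF a])

lemma basic_open_le_of_mem:
  assumes C: "C \<in> \<C>" and a: "a \<in> family_of_open u C"
  shows "basic_open C a \<le> u"
proof -
  obtain b where b: "well_inside (\<L> C) a b" "basic_open C b \<le> u"
    using a mem_family_of_open[OF C] by blast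
  then show ?thesis
    using basic_open_mono[OF C well_inside_le[OF b(1)]] by (auto simp: well_inside_def)
qed

lemma open_of_family_of_open: "open_of_family (family_of_open u) = u"
proof (rule antisym)
  show "open_of_family (family_of_open u) \<le> u"
    unfolding open_of_family_def by (intro SUP_least basic_open_le_of_mem)
  have "basic_open C a \<le> open_of_family (family_of_open u)"
    if C: "C \<in> \<C>" "a \<in> carrier (\<L> C)" and u: "basic_open C a \<le> u" for C a
  proof (rule basic_open_regular[OF C])
    fix D a' assume D: "D \<in> \<C>" "C \<subseteq> D" "well_inside (\<L> D) a' (lat_map D a)"
    have "basic_open D (lat_map D a) \<le> u"
      using basic_open_earlier[OF C(1) D(1,2) C(2)] u by (rule order_trans)
    then show "basic_open D a' \<le> open_of_family (family_of_open u)"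
      using D by (intro basic_open_le_family) (auto simp: mem_family_of_open)
  qed
  then have "basic_part u \<le> open_of_family (family_of_open u)"
    unfolding basic_part_def by (intro Sup_least) auto
  then show "u \<le> open_of_family (family_of_open u)" using le_basic_part order_trans by blast
qed

lemma locally_compact_spec: "locally_compact_locale TYPE('a::unital_cstar_algebra spec_open)"
  unfolding locally_compact_locale_def
proof (intro allI antisym)
  fix y :: "'a spec_open"
  show "Sup {x. x \<lless> y} \<le> y" by (rule Sup_least) (simp add: wb_le)
  have "basic_open C a \<le> Sup {x. x \<lless> y}" if Ca: "C \<in> \<C>" "a \<in> family_of_open y C" for C a
  proof (rule Sup_upper, rule CollectI)
    obtain b where "well_inside (\<L> C) a b" "basic_open C b \<le> y"
      using Ca mem_family_of_open[OF Ca(1)] by blast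
    then show "basic_open C a \<lless> y"
      using wb_mono[OF order.refl basic_open_way_below[OF Ca(1)]] by blast
  qed
  then have "open_of_family (family_of_open y) \<le> Sup {x. x \<lless> y}"
    unfolding open_of_family_def by (intro SUP_least)
  then show "y \<le> Sup {x. x \<lless> y}" by (simp add: open_of_family_of_open)
qed

lemma ideal_families_ideal_family:
  assumes "U \<in> ideal_families"
  shows "ideal_family U"
  using assms unfolding ideal_families_def ideal_family_def
  by (auto simp: rounded_ideal_def PiE_iff)

lemma family_of_open_of_family:
  assumes U: "U \<in> ideal_families"
  shows "family_of_open (open_of_family U) = U"
proof
  fix C
  show "family_of_open (open_of_family U) C = U C"
  proof (cases "C \<in> \<C>")
    case True
    have "a \<in> family_of_open (open_of_family U) C" if a: "a \<in> U C" for a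
    proof -
      have "rounded_ideal (\<L> C) (U C)" using U True by (auto simp: ideal_families_def PiE_iff)
      then obtain b where "b \<in> U C" "well_inside (\<L> C) a b" using a by (auto simp: rounded_ideal_def)
      then show ?thesis using basic_open_le_family[OF True] by (auto simp: mem_family_of_open[OF True])
    qed
    moreover have "a \<in> U C" if "a \<in> family_of_open (open_of_family U) C" for a
      using that mem_ideal_family[OF ideal_families_ideal_family[OF U] True]
      by (auto simp: mem_family_of_open[OF True])
    ultimately show ?thesis by blast
  next
    case False
    then show ?thesis using U by (auto simp: family_of_open_def ideal_families_def PiE_iff extensional_def)
  qed
qed

section \<open>Points of the exponential\<close>

definition family_scott ::
  "'a::unital_cstar_algebra set \<Rightarrow> 'a lat_term set \<Rightarrow> 'a spec_open scott_open" where
  "family_scott C a = Abs_scott_open {u. a \<in> family_of_open u C}"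

lemma scott_family:
  assumes C: "C \<in> \<C>"
  shows "scott {u. a \<in> family_of_open u C}"
proof (rule scottI)
  show "v \<in> {u. a \<in> family_of_open u C}" if "u \<in> {u. a \<in> family_of_open u C}" "u \<le> v" for u v
    using that order_trans unfolding mem_family_of_open[OF C] by blast
  fix S assume S: "Defs.directed S" "Sup S \<in> {u. a \<in> family_of_open u C}"
  then obtain b where b: "well_inside (\<L> C) a b" "basic_open C b \<le> Sup S"
    by (auto simp: mem_family_of_open[OF C])
  obtain c where c: "well_inside (\<L> C) a c" "well_inside (\<L> C) c b"
    using well_inside_interpolate[OF C b(1)] by blast
  show "\<exists>s\<in>S. s \<in> {u. a \<in> family_of_open u C}"
    using wbD[OF basic_open_way_below[OF C c(2)] S(1) b(2)] c(1)
    by (auto simp: mem_family_of_open[OF C])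
qed

lemma Rep_family_scott:
  "C \<in> \<C> \<Longrightarrow> u \<in> Rep_scott_open (family_scott C a) \<longleftrightarrow> a \<in> family_of_open u C"
  by (simp add: family_scott_def Abs_scott_open_inverse scott_family)

abbreviation finite_join ::
  "('a::unital_cstar_algebra set \<times> 'a lat_term set) set \<Rightarrow> 'a spec_open" where
  "finite_join F \<equiv> (SUP (C, a)\<in>F. basic_open C a)"

lemma scott_open_finite_join:
  assumes "open_of_family U \<in> Rep_scott_open V"
  obtains F where "finite F" "F \<subseteq> (SIGMA C:\<C>. U C)" "finite_join F \<in> Rep_scott_open V"
proof -
  let ?S = "{finite_join F | F. finite F \<and> F \<subseteq> (SIGMA C:\<C>. U C)}"
  have "Defs.directed ?S"
  proof (rule directedI)
    show "?S \<noteq> {}" by blast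
    fix x y assume "x \<in> ?S" "y \<in> ?S"
    then obtain F G where *: "x = finite_join F" "y = finite_join G" "finite F" "finite G"
      "F \<subseteq> (SIGMA C:\<C>. U C)" "G \<subseteq> (SIGMA C:\<C>. U C)" by blast
    then have "finite_join (F \<union> G) \<in> ?S" by blast
    moreover have "x \<le> finite_join (F \<union> G)" "y \<le> finite_join (F \<union> G)"
      unfolding * by (rule SUP_subset_mono; simp)+
    ultimately show "\<exists>z\<in>?S. x \<le> z \<and> y \<le> z" by blast
  qed
  moreover have "open_of_family U \<le> Sup ?S"
    unfolding open_of_family_def
  proof (intro SUP_least Sup_upper CollectI exI conjI)
    fix C a assume "C \<in> \<C>" "a \<in> U C"
    then show "{(C, a)} \<subseteq> (SIGMA C:\<C>. U C)" by simp
  qed simp_all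
  then have "Sup ?S \<in> Rep_scott_open V" using assms scott_up[OF scott_Rep] by blast
  ultimately have "\<exists>s\<in>?S. s \<in> Rep_scott_open V" by (rule scott_dir[OF scott_Rep])
  then show thesis using that by blast
qed

lemma finite_join_le:
  assumes "F \<subseteq> (SIGMA C:\<C>. U C)"
  shows "finite_join F \<le> open_of_family U"
  by (rule SUP_least) (use assms in \<open>auto intro: basic_open_le_family\<close>)

abbreviation finite_joins_in ::
  "'a::unital_cstar_algebra spec_open scott_open \<Rightarrow> ('a set \<times> 'a lat_term set) set set" where
  "finite_joins_in V \<equiv>
    {F. finite F \<and> F \<subseteq> (SIGMA C:\<C>. carrier (\<L> C)) \<and> finite_join F \<in> Rep_scott_open V}"

lemma scott_open_eq_SUP: "V = (SUP F\<in>finite_joins_in V. INF (C, a)\<in>F. family_scott C a)"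
proof -
  have *: "u \<in> Rep_scott_open (INF (C, a)\<in>F. family_scott C a) \<longleftrightarrow> F \<subseteq> (SIGMA C:\<C>. family_of_open u C)"
    if "finite F" "F \<subseteq> (SIGMA C:\<C>. carrier (\<L> C))" for u F
    using that
  proof (induction F)
    case empty
    then show ?case by (simp add: Rep_scott_simps)
  next
    case (insert p F)
    then show ?case by (auto simp: Rep_scott_simps Rep_family_scott)
  qed
  have "u \<in> Rep_scott_open (SUP F\<in>finite_joins_in V. INF (C, a)\<in>F. family_scott C a) \<longleftrightarrow>
      (\<exists>F\<in>finite_joins_in V. F \<subseteq> (SIGMA C:\<C>. family_of_open u C))" for u
  proof -
    have "u \<in> Rep_scott_open (SUP F\<in>finite_joins_in V. INF (C, a)\<in>F. family_scott C a) \<longleftrightarrow>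
        (\<exists>F\<in>finite_joins_in V. u \<in> Rep_scott_open (INF (C, a)\<in>F. family_scott C a))"
      by (simp add: Rep_scott_simps(3))
    also have "\<dots> \<longleftrightarrow> (\<exists>F\<in>finite_joins_in V. F \<subseteq> (SIGMA C:\<C>. family_of_open u C))"
      by (rule bex_cong[OF HOL.refl], rule *) simp_all
    finally show ?thesis .
  qed
  moreover have "(\<exists>F\<in>finite_joins_in V. F \<subseteq> (SIGMA C:\<C>. family_of_open u C)) \<longleftrightarrow>
      u \<in> Rep_scott_open V" for u
  proof
    assume "\<exists>F\<in>finite_joins_in V. F \<subseteq> (SIGMA C:\<C>. family_of_open u C)"
    then obtain F where F: "finite_join F \<in> Rep_scott_open V" "F \<subseteq> (SIGMA C:\<C>. family_of_open u C)"
      by blast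
    show "u \<in> Rep_scott_open V"
      using scott_up[OF scott_Rep F(1) finite_join_le[OF F(2)]] by (simp add: open_of_family_of_open)
  next
    assume "u \<in> Rep_scott_open V"
    then have "open_of_family (family_of_open u) \<in> Rep_scott_open V" by (simp add: open_of_family_of_open)
    then obtain F where F: "finite F" "F \<subseteq> (SIGMA C:\<C>. family_of_open u C)"
      "finite_join F \<in> Rep_scott_open V" by (rule scott_open_finite_join)
    have "(SIGMA C:\<C>. family_of_open u C) \<subseteq> (SIGMA C:\<C>. carrier (\<L> C))"
      by (auto simp: mem_family_of_open dest: well_insideD)
    with F(2) have "F \<subseteq> (SIGMA C:\<C>. carrier (\<L> C))" by (rule subset_trans)
    with F show "\<exists>F\<in>finite_joins_in V. F \<subseteq> (SIGMA C:\<C>. family_of_open u C)" by (intro bexI[of _ F]) simp_all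
  qed
  ultimately have "u \<in> Rep_scott_open V \<longleftrightarrow>
      u \<in> Rep_scott_open (SUP F\<in>finite_joins_in V. INF (C, a)\<in>F. family_scott C a)" for u
    by (simp only:)
  then show ?thesis by (intro Rep_scott_open_inject[THEN iffD1] Set.set_eqI)
qed

context
  fixes p :: "'a::unital_cstar_algebra spec_open scott_open \<Rightarrow> 'w::frame"
  assumes p: "frame_hom p"
begin

lemma frame_hom_eq_SUP:
  "p V = (SUP F\<in>finite_joins_in V. INF (C, a)\<in>F. p (family_scott C a))"
proof -
  have "p V = p (SUP F\<in>finite_joins_in V. INF (C, a)\<in>F. family_scott C a)"
    by (simp only: scott_open_eq_SUP[symmetric])
  also have "\<dots> = (SUP F\<in>finite_joins_in V. p (INF (C, a)\<in>F. family_scott C a))"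
    using p unfolding frame_hom_def by (metis image_image)
  also have "\<dots> = (SUP F\<in>finite_joins_in V. INF (C, a)\<in>F. p (family_scott C a))"
    by (rule SUP_cong[OF HOL.refl])
      (simp add: frame_hom_INF[OF p] case_prod_unfold)
  finally show ?thesis .
qed

lemma frame_hom_family_bot: "C \<in> \<C> \<Longrightarrow> p (family_scott C \<bottom>\<^bsub>\<L> C\<^esub>) = Orderings.top"
proof -
  assume C: "C \<in> \<C>"
  have "\<bottom>\<^bsub>\<L> C\<^esub> \<in> family_of_open u C" for u
    using well_inside_bot[OF spec_lattice_closed(1)] basic_open_bot[OF C] C
    by (auto simp: mem_family_of_open intro!: exI[of _ "\<bottom>\<^bsub>\<L> C\<^esub>"])
  then have "family_scott C \<bottom>\<^bsub>\<L> C\<^esub> = Orderings.top"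
    using C by (auto simp: Rep_scott_open_inject[symmetric] Rep_scott_simps Rep_family_scott)
  then show ?thesis using p by (simp add: frame_hom_def)
qed

lemma frame_hom_family_mono:
  assumes "C \<in> \<C>" "D \<in> \<C>" "\<And>u. a \<in> family_of_open u C \<Longrightarrow> b \<in> family_of_open u D"
  shows "p (family_scott C a) \<le> p (family_scott D b)"
  by (rule frame_hom_mono[OF p]) (use assms in \<open>auto simp: less_eq_scott_open_def Rep_family_scott\<close>)

lemma frame_hom_family_le:
  assumes C: "C \<in> \<C>" and "a \<in> carrier (\<L> C)" "b \<in> carrier (\<L> C)" "a \<sqsubseteq>\<^bsub>\<L> C\<^esub> b"
  shows "p (family_scott C b) \<le> p (family_scott C a)"
proof (rule frame_hom_family_mono[OF C C])
  fix u assume "b \<in> family_of_open u C"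
  then obtain c where c: "well_inside (\<L> C) b c" "basic_open C c \<le> u"
    by (auto simp: mem_family_of_open C)
  have "well_inside (\<L> C) a c"
    using c(1) well_inside_mono[OF assms(4) c(1) spec_le_refl] assms(2) by (simp add: well_inside_def)
  then show "a \<in> family_of_open u C" using c(2) by (auto simp: mem_family_of_open C)
qed

lemma frame_hom_family_join:
  assumes C: "C \<in> \<C>"
  shows "inf (p (family_scott C a)) (p (family_scott C b)) \<le> p (family_scott C (a \<squnion>\<^bsub>\<L> C\<^esub> b))"
proof -
  have "a \<squnion>\<^bsub>\<L> C\<^esub> b \<in> family_of_open u C" if ab: "a \<in> family_of_open u C" "b \<in> family_of_open u C" for u
  proof -
    obtain c d where c: "well_inside (\<L> C) a c" "basic_open C c \<le> u"
      and d: "well_inside (\<L> C) b d" "basic_open C d \<le> u"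
      using ab by (auto simp: mem_family_of_open C)
    have "basic_open C (c \<squnion>\<^bsub>\<L> C\<^esub> d) \<le> sup (basic_open C c) (basic_open C d)"
      using basic_open_join[OF C] well_insideD(2)[OF c(1)] well_insideD(2)[OF d(1)] by blast
    also have "\<dots> \<le> u" using c d by simp
    finally show ?thesis using well_inside_join[OF c(1) d(1)] by (auto simp: mem_family_of_open C)
  qed
  then have "inf (family_scott C a) (family_scott C b) \<le> family_scott C (a \<squnion>\<^bsub>\<L> C\<^esub> b)"
    using C by (auto simp: less_eq_scott_open_def Rep_family_scott Rep_scott_simps)
  then show ?thesis using frame_hom_mono[OF p] p by (metis frame_hom_def)
qed

lemma frame_hom_family_rounded:
  assumes C: "C \<in> \<C>"
  shows "p (family_scott C a) \<le> (SUP b\<in>{b. well_inside (\<L> C) a b}. p (family_scott C b))"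
proof -
  have "\<exists>b. well_inside (\<L> C) a b \<and> b \<in> family_of_open u C" if "a \<in> family_of_open u C" for u
    using that well_inside_interpolate[OF C] unfolding mem_family_of_open[OF C] by blast
  then have "family_scott C a \<le> (SUP b\<in>{b. well_inside (\<L> C) a b}. family_scott C b)"
    using C by (auto simp: less_eq_scott_open_def Rep_family_scott Rep_scott_simps)
  then have "p (family_scott C a) \<le> p (SUP b\<in>{b. well_inside (\<L> C) a b}. family_scott C b)"
    by (rule frame_hom_mono[OF p])
  also have "\<dots> = (SUP b\<in>{b. well_inside (\<L> C) a b}. p (family_scott C b))"
    using p unfolding frame_hom_def by (metis image_image)
  finally show ?thesis .
qed

lemma frame_hom_family_lat_map:
  assumes C: "C \<in> \<C>" and D: "D \<in> \<C>" and CD: "C \<subseteq> D"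
  shows "p (family_scott C a) \<le> p (family_scott D (lat_map D a))"
proof (rule frame_hom_family_mono[OF C D])
  fix u assume "a \<in> family_of_open u C"
  then obtain b where b: "well_inside (\<L> C) a b" "basic_open C b \<le> u"
    by (auto simp: mem_family_of_open C)
  have "basic_open D (lat_map D b) \<le> u"
    by (rule order_trans[OF basic_open_earlier[OF C D CD well_insideD(2)[OF b(1)]] b(2)])
  then show "lat_map D a \<in> family_of_open u D"
    using lat_map_well_inside[OF CD b(1)] by (auto simp: mem_family_of_open D)
qed

end

lemma frame_hom_point_of_open: "frame_hom (point_of_open u)"
  by (auto simp: frame_hom_def point_of_open_def Rep_scott_simps)

lemma bij_betw_point_of_open:
  "bij_betw (\<lambda>U. point_of_open (open_of_family U)) ideal_families
    {p :: 'a::unital_cstar_algebra spec_open scott_open \<Rightarrow> bool. frame_hom p}"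
proof (rule bij_betw_byWitness)
  define fam where "fam p = (\<lambda>C\<in>\<C>. {a \<in> carrier (\<L> C). p (family_scott C a)})"
    for p :: "'a spec_open scott_open \<Rightarrow> bool"
  show "\<forall>U\<in>ideal_families. fam (point_of_open (open_of_family U)) = U"
  proof
    fix U :: "'a set \<Rightarrow> 'a lat_term set set" assume U: "U \<in> ideal_families"
    have "fam (point_of_open (open_of_family U)) = family_of_open (open_of_family U)"
      using well_insideD(1)
      by (fastforce simp: fam_def fun_eq_iff point_of_open_def Rep_family_scott mem_family_of_open
          family_of_open_def restrict_def)
    then show "fam (point_of_open (open_of_family U)) = U" by (simp add: family_of_open_of_family U)
  qed
  show "\<forall>p\<in>{p. frame_hom p}. point_of_open (open_of_family (fam p)) = p"
  proof (intro ballI ext)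
    fix p :: "'a spec_open scott_open \<Rightarrow> bool" and V assume "p \<in> {p. frame_hom p}"
    then have p: "frame_hom p" by simp
    have "p V \<longleftrightarrow> (\<exists>F\<in>finite_joins_in V. \<forall>(C, a)\<in>F. p (family_scott C a))"
      by (subst frame_hom_eq_SUP[OF p]) simp
    also have "\<dots> \<longleftrightarrow> (\<exists>F\<in>finite_joins_in V. F \<subseteq> (SIGMA C:\<C>. fam p C))"
    proof (rule bex_cong[OF HOL.refl])
      fix F assume "F \<in> finite_joins_in V"
      then have "C \<in> \<C> \<and> a \<in> carrier (\<L> C)" if "(C, a) \<in> F" for C a using that by auto
      then show "(\<forall>(C, a)\<in>F. p (family_scott C a)) \<longleftrightarrow> F \<subseteq> (SIGMA C:\<C>. fam p C)"
        by (auto simp: fam_def)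
    qed
    also have "\<dots> \<longleftrightarrow> point_of_open (open_of_family (fam p)) V"
      unfolding point_of_open_def
    proof
      assume "\<exists>F\<in>finite_joins_in V. F \<subseteq> (SIGMA C:\<C>. fam p C)"
      then show "open_of_family (fam p) \<in> Rep_scott_open V"
        using finite_join_le scott_up[OF scott_Rep] by blast
    next
      assume "open_of_family (fam p) \<in> Rep_scott_open V"
      then obtain F where F: "finite F" "F \<subseteq> (SIGMA C:\<C>. fam p C)" "finite_join F \<in> Rep_scott_open V"
        by (rule scott_open_finite_join)
      have "(SIGMA C:\<C>. fam p C) \<subseteq> (SIGMA C:\<C>. carrier (\<L> C))" by (auto simp: fam_def)
      with F(2) have "F \<subseteq> (SIGMA C:\<C>. carrier (\<L> C))" by (rule subset_trans)
      with F show "\<exists>F\<in>finite_joins_in V. F \<subseteq> (SIGMA C:\<C>. fam p C)" by (intro bexI[of _ F]) simp_all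
    qed
    finally show "point_of_open (open_of_family (fam p)) V = p V" by simp
  qed
  show "(\<lambda>U. point_of_open (open_of_family U)) ` ideal_families \<subseteq> {p. frame_hom p}"
    by (auto simp: frame_hom_point_of_open)
  show "fam ` {p. frame_hom p} \<subseteq> ideal_families"
  proof clarify
    fix p :: "'a spec_open scott_open \<Rightarrow> bool" assume p: "frame_hom p"
    have "rounded_ideal (\<L> C) (fam p C)" if C: "C \<in> \<C>" for C
      unfolding rounded_ideal_def lat_ideal_def
    proof (intro conjI ballI impI)
      show "fam p C \<subseteq> carrier (\<L> C)" using C by (auto simp: fam_def)
      show "\<bottom>\<^bsub>\<L> C\<^esub> \<in> fam p C"
        using frame_hom_family_bot[OF p C] C by (simp add: fam_def spec_lattice_closed)
      show "a \<in> fam p C" if "a \<in> carrier (\<L> C)" "b \<in> fam p C" "a \<sqsubseteq>\<^bsub>\<L> C\<^esub> b" for a b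
        using frame_hom_family_le[OF p C] that C by (auto simp: fam_def)
      show "a \<squnion>\<^bsub>\<L> C\<^esub> b \<in> fam p C" if "a \<in> fam p C" "b \<in> fam p C" for a b
        using frame_hom_family_join[OF p C, of a b] that C by (auto simp: fam_def spec_lattice_closed)
      show "\<exists>b\<in>fam p C. well_inside (\<L> C) a b" if "a \<in> fam p C" for a
        using frame_hom_family_rounded[OF p C, of a] that C by (auto simp: fam_def dest: well_insideD)
    qed
    moreover have "lat_map D ` fam p C \<subseteq> fam p D" if "C \<in> \<C>" "D \<in> \<C>" "C \<subseteq> D" for C D
      using frame_hom_family_lat_map[OF p that] that by (auto simp: fam_def lat_map_closed)
    ultimately show "fam p \<in> ideal_families" by (auto simp: ideal_families_def fam_def)
  qed
qed

lemma frame_hom_point_of_family_over: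
  fixes U :: "'a::unital_cstar_algebra set \<Rightarrow> 'a lat_term set \<Rightarrow> 'w::frame"
  shows "frame_hom (point_of_family_over U)"
proof -
  let ?p = "point_of_family_over U" and ?m = "\<lambda>F. INF (C, a)\<in>F. U C a"
  have p: "?p V = (SUP F\<in>finite_joins_in V. ?m F)" for V
    by (simp add: point_of_family_over_def)
  have mono: "?p V \<le> ?p W" if "V \<le> W" for V W
    unfolding p by (rule SUP_subset_mono) (use that in \<open>auto simp: less_eq_scott_open_def\<close>)
  show ?thesis
    unfolding frame_hom_def
  proof (intro conjI allI)
    have "?m {} \<le> ?p Orderings.top" unfolding p by (rule SUP_upper) (simp add: Rep_scott_simps)
    then show "?p Orderings.top = Orderings.top" by (simp add: top_unique)
    fix V W
    show "?p (inf V W) = inf (?p V) (?p W)"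
    proof (rule antisym)
      show "?p (inf V W) \<le> inf (?p V) (?p W)" by (simp add: mono)
      have "inf (?m F) (?m G) \<le> ?p (inf V W)" if F: "F \<in> finite_joins_in V" and G: "G \<in> finite_joins_in W" for F G
      proof -
        have "finite_join F \<le> finite_join (F \<union> G)" "finite_join G \<le> finite_join (F \<union> G)"
          by (rule SUP_subset_mono; simp)+
        then have "F \<union> G \<in> finite_joins_in (inf V W)"
          using F G scott_up[OF scott_Rep] by (auto simp: Rep_scott_simps)
        then have "?m (F \<union> G) \<le> ?p (inf V W)" unfolding p by (rule SUP_upper)
        then show ?thesis by (simp add: INF_union)
      qed
      then have "inf (?m F) (?p W) \<le> ?p (inf V W)" if "F \<in> finite_joins_in V" for F
        unfolding p[of W] inf_Sup_frame by (intro SUP_least) (use that in auto)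
      then show "inf (?p V) (?p W) \<le> ?p (inf V W)"
        unfolding p[of V] inf.commute[of _ "?p W"] inf_Sup_frame
        by (intro SUP_least) (auto simp: inf.commute[of "?p W"])
    qed
  next
    fix A
    show "?p (Sup A) = Sup (?p ` A)"
    proof (rule antisym)
      have "?m F \<le> Sup (?p ` A)" if F: "F \<in> finite_joins_in (Sup A)" for F
      proof -
        obtain V where V: "V \<in> A" "F \<in> finite_joins_in V" using F by (auto simp: Rep_scott_simps(3))
        then have "?m F \<le> ?p V" unfolding p by (intro SUP_upper)
        also have "\<dots> \<le> Sup (?p ` A)" using V by (intro SUP_upper)
        finally show ?thesis .
      qed
      then show "?p (Sup A) \<le> Sup (?p ` A)" unfolding p[of "Sup A"] by (rule SUP_least)
      show "Sup (?p ` A) \<le> ?p (Sup A)" by (intro SUP_least mono Sup_upper)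
    qed
  qed
qed

lemma point_of_family_over_family_scott:
  fixes U :: "'a::unital_cstar_algebra set \<Rightarrow> 'a lat_term set \<Rightarrow> 'w::frame"
  assumes U: "U \<in> ideal_families_over" and C: "C \<in> \<C>" and a: "a \<in> carrier (\<L> C)"
  shows "point_of_family_over U (family_scott C a) = U C a"
proof (rule antisym)
  have ideal: "rounded_ideal_over (\<L> D) (U D)" if "D \<in> \<C>" for D
    using U that by (auto simp: ideal_families_over_def PiE_iff)
  have "(INF (D, d)\<in>F. U D d) \<le> U C a" if F: "F \<in> finite_joins_in (family_scott C a)" for F
  proof -
    let ?w = "INF (D, d)\<in>F. U D d"
    define V where "V D = {d \<in> carrier (\<L> D). ?w \<le> U D d}" for D
    have "lat_ideal (\<L> D) (V D)" if "D \<in> \<C>" for D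
      using ideal[OF that] unfolding rounded_ideal_over_def lat_ideal_def V_def
      by (auto simp: spec_lattice_closed intro: order_trans)
        (meson le_inf_iff order_trans)
    moreover have "lat_map E ` V D \<subseteq> V E" if DE: "D \<in> \<C>" "E \<in> \<C>" "D \<subseteq> E" for D E
    proof -
      have "U D d \<le> U E (lat_map E d)" if "d \<in> carrier (\<L> D)" for d
        using U DE that by (auto simp: ideal_families_over_def)
      then show ?thesis using DE by (auto simp: V_def lat_map_closed intro: order_trans)
    qed
    ultimately have V: "ideal_family V" by (simp add: ideal_family_def)
    have "?w \<le> U D d" if "(D, d) \<in> F" for D d using INF_lower[OF that, of "\<lambda>(D, d). U D d"] by simp
    then have "F \<subseteq> (SIGMA C:\<C>. V C)" using F by (auto simp: V_def)
    then have FV: "finite_join F \<le> open_of_family V" by (rule finite_join_le)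
    have "a \<in> family_of_open (finite_join F) C" using F C by (simp add: Rep_family_scott)
    then obtain b where b: "well_inside (\<L> C) a b" "basic_open C b \<le> finite_join F"
      by (auto simp: mem_family_of_open C)
    have "a \<in> V C" by (rule mem_ideal_family[OF V C b(1) order_trans[OF b(2) FV]])
    then show ?thesis by (simp add: V_def)
  qed
  then show "point_of_family_over U (family_scott C a) \<le> U C a"
    unfolding point_of_family_over_def by (rule SUP_least)
  have "U C a \<le> (SUP b\<in>{b. well_inside (\<L> C) a b}. U C b)"
    using ideal[OF C] a by (simp add: rounded_ideal_over_def)
  also have "\<dots> \<le> point_of_family_over U (family_scott C a)"
  proof (rule SUP_least)
    fix b assume "b \<in> {b. well_inside (\<L> C) a b}"
    then have "{(C, b)} \<in> finite_joins_in (family_scott C a)"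
      using C by (auto simp: Rep_family_scott mem_family_of_open dest: well_insideD)
    then have "(INF (D, d)\<in>{(C, b)}. U D d) \<le> point_of_family_over U (family_scott C a)"
      unfolding point_of_family_over_def by (rule SUP_upper)
    then show "U C b \<le> point_of_family_over U (family_scott C a)" by simp
  qed
  finally show "U C a \<le> point_of_family_over U (family_scott C a)" .
qed

lemma bij_betw_point_of_family_over:
  "bij_betw point_of_family_over ideal_families_over
    {p :: 'a::unital_cstar_algebra spec_open scott_open \<Rightarrow> 'w::frame. frame_hom p}"
proof (rule bij_betw_byWitness)
  define fam where "fam p = (\<lambda>C\<in>\<C>. \<lambda>a\<in>carrier (\<L> C). p (family_scott C a))"
    for p :: "'a spec_open scott_open \<Rightarrow> 'w"
  show "\<forall>U\<in>ideal_families_over. fam (point_of_family_over U) = U"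
  proof
    fix U :: "'a set \<Rightarrow> 'a lat_term set \<Rightarrow> 'w" assume U: "U \<in> ideal_families_over"
    have "fam (point_of_family_over U) C a = U C a" for C a
    proof (cases "C \<in> \<C>")
      case True
      then have "U C \<in> extensional (carrier (\<L> C))"
        using U by (auto simp: ideal_families_over_def PiE_iff)
      then show ?thesis
        using True U by (auto simp: fam_def point_of_family_over_family_scott restrict_def extensional_def)
    next
      case False
      then show ?thesis
        using U by (auto simp: fam_def ideal_families_over_def PiE_iff extensional_def)
    qed
    then show "fam (point_of_family_over U) = U" by blast
  qed
  show "\<forall>p\<in>{p. frame_hom p}. point_of_family_over (fam p) = p"
  proof (intro ballI ext)
    fix p :: "'a spec_open scott_open \<Rightarrow> 'w" and V assume "p \<in> {p. frame_hom p}"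
    then have p: "frame_hom p" by simp
    have "point_of_family_over (fam p) V = (SUP F\<in>finite_joins_in V. INF (C, a)\<in>F. p (family_scott C a))"
      unfolding point_of_family_over_def
      by (rule SUP_cong[OF HOL.refl], rule INF_cong[OF HOL.refl]) (auto simp: fam_def)
    then show "point_of_family_over (fam p) V = p V" by (simp only: frame_hom_eq_SUP[OF p, of V])
  qed
  show "point_of_family_over ` ideal_families_over \<subseteq> {p. frame_hom p}"
    by (auto simp: frame_hom_point_of_family_over)
  show "fam ` {p. frame_hom p} \<subseteq> ideal_families_over"
  proof clarify
    fix p :: "'a spec_open scott_open \<Rightarrow> 'w" assume p: "frame_hom p"
    have "rounded_ideal_over (\<L> C) (fam p C)" if C: "C \<in> \<C>" for C
      unfolding rounded_ideal_over_def
    proof (intro conjI ballI impI)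
      show "fam p C \<bottom>\<^bsub>\<L> C\<^esub> = Orderings.top"
        using frame_hom_family_bot[OF p C] C by (simp add: fam_def spec_lattice_closed)
      show "fam p C b \<le> fam p C a" if "a \<in> carrier (\<L> C)" "b \<in> carrier (\<L> C)" "a \<sqsubseteq>\<^bsub>\<L> C\<^esub> b" for a b
        using frame_hom_family_le[OF p C that] that C by (simp add: fam_def)
      show "inf (fam p C a) (fam p C b) \<le> fam p C (a \<squnion>\<^bsub>\<L> C\<^esub> b)"
        if "a \<in> carrier (\<L> C)" "b \<in> carrier (\<L> C)" for a b
        using frame_hom_family_join[OF p C, of a b] that C by (simp add: fam_def spec_lattice_closed)
      show "fam p C a \<le> (SUP b\<in>{b. well_inside (\<L> C) a b}. fam p C b)" if "a \<in> carrier (\<L> C)" for a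
      proof -
        have "(SUP b\<in>{b. well_inside (\<L> C) a b}. fam p C b) =
            (SUP b\<in>{b. well_inside (\<L> C) a b}. p (family_scott C b))"
          by (rule SUP_cong[OF HOL.refl]) (use C in \<open>simp add: fam_def well_inside_def\<close>)
        then show ?thesis using frame_hom_family_rounded[OF p C, of a] that C by (simp add: fam_def)
      qed
    qed
    moreover have "fam p C a \<le> fam p D (lat_map D a)"
      if "C \<in> \<C>" "D \<in> \<C>" "C \<subseteq> D" "a \<in> carrier (\<L> C)" for C D a
      using frame_hom_family_lat_map[OF p that(1-3)] that by (simp add: fam_def lat_map_closed)
    ultimately show "fam p \<in> ideal_families_over"
      by (auto simp: ideal_families_over_def fam_def)
  qed
qed

theorem theorem19:
  shows "locally_compact_locale TYPE('a::unital_cstar_algebra spec_open) \<and>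
    bij_betw (\<lambda>U. point_of_open (open_of_family U)) ideal_families
      {p :: 'a spec_open scott_open \<Rightarrow> bool. frame_hom p} \<and>
    bij_betw point_of_family_over ideal_families_over
      {p :: 'a spec_open scott_open \<Rightarrow> 'w::frame. frame_hom p}"
  using locally_compact_spec bij_betw_point_of_open bij_betw_point_of_family_over by blast

end
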